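(* Let $S$ be a densely defined, closed, symmetric operator in a Hilbert space $\mathcal H$ and let $\{\mathcal G,\Gamma_0,\Gamma_1\}$ be a quasi boundary triple for $T\subset S^*$ with corresponding $\gamma$-field $\gamma$ and Weyl function $M$; let $A_0=T\upharpoonright\ker\Gamma_0$ and $A_1=T\upharpoonright\ker\Gamma_1$. Assume that $A_0$ is bounded from below and that $M(\lambda)$ is bounded for one (and hence for all) $\lambda\in\rho(A_0)$. Let $B$ be a self-adjoint operator in $\mathcal G$ which is bounded from above and assume that the following conditions are satisfied: (i) $\|\overline{M(\lambda)}\|\to0$ as $\lambda\to-\infty$; (ii) $\operatorname{ran}\overline{M(\lambda)}^{1/2}\subset\operatorname{dom}B$ for all $\lambda<\min\sigma(A_0)$; (iii) $B\bigl(\operatorname{ran}\overline{M(\lambda)}\bigr)\subset\operatorname{ran}\Gamma_0$ for all $\lambda<\min\sigma(A_0)$; (iv) $\operatorname{ran}\Gamma_1\subset\operatorname{dom}B$; (v) $B(\operatorname{ran}\Gamma_1)\subset\operatorname{ran}\Gamma_0$, or $A_1$ is self-adjoint and bounded from below. Then the operator $$A_{[B]}f=Tf,\qquad \operatorname{dom}A_{[B]}=\bigl\{f\in\operatorname{dom}T:\Gamma_0 f=B\Gamma_1 f\bigr\},$$ is a self-adjoint extension of $S$, which is bounded from below, and $$(A_{[B]}-\lambda)^{-1}=(A_0-\lambda)^{-1}+\gamma(\lambda)\bigl(I-BM(\lambda)\bigr)^{-1}B\gamma(\overline\lambda)^*$$ holds for all $\lambda\in\rho(A_{[B]})\cap\rho(A_0)$.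 Moreover, the following statements are true. (a) If $B\le0$, then $\min\sigma(A_{[B]})\ge\min\sigma(A_0)$. (b) If there exist $\alpha\in(0,1]$, $\mu\le\min\sigma(A_0)$ and $C>0$ such that $$\bigl\|\overline{M(\lambda)}\bigr\|\le\frac{C}{(\mu-\lambda)^\alpha}\qquad\text{for all }\lambda<\mu,$$ then $$\min\sigma(A_{[B]})\ge\mu-\bigl(C\|B_+\|\bigr)^{1/\alpha}.$$
   Context: Let $S$ be a densely defined, closed, symmetric operator in $\mathcal H$, and let $T\subset S^*$ be a linear operator with $\overline T=S^*$. A triple $\{\mathcal G,\Gamma_0,\Gamma_1\}$ is a quasi boundary triple for $T\subset S^*$ if $\mathcal G$ is a Hilbert space and $\Gamma_0,\Gamma_1:\operatorname{dom}T\to\mathcal G$ are linear maps such that: (1) $(Tf,g)-(f,Tg)=(\Gamma_1f,\Gamma_0g)-(\Gamma_0f,\Gamma_1g)$ for all $f,g\in\operatorname{dom}T$; (2) $(\Gamma_0,\Gamma_1)^\top:\operatorname{dom}T\to\mathcal G\times\mathcal G$ has dense range; (3) $A_0:=T\upharpoonright\ker\Gamma_0$ is self-adjoint in $\mathcal H$. Put $A_1:=T\upharpoonright\ker\Gamma_1$ (not necessarily self-adjoint). For $\lambda\in\rho(A_0)$ one has $\operatorname{dom}T=\ker\Gamma_0\,\dot+\,\ker(T-\lambda)$, so $\Gamma_0\upharpoonright\ker(T-\lambda)$ is injective with range $\operatorname{ran}\Gamma_0$. The $\gamma$-field is $\gamma(\lambda):=(\Gamma_0\upharpoonright\ker(T-\lambda))^{-1}$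 (mapping $\operatorname{ran}\Gamma_0\subset\mathcal G$ onto $\ker(T-\lambda)$), and the Weyl function is $M(\lambda):=\Gamma_1\gamma(\lambda)$, an operator in $\mathcal G$ with domain $\operatorname{ran}\Gamma_0$, $\lambda\in\rho(A_0)$. One has $M(\lambda)\subset M(\overline\lambda)^*$, so $M(\lambda)$ is closable; $\overline{M(\lambda)}$ denotes its closure. The adjoint $\gamma(\lambda)^*$ is bounded and everywhere defined from $\mathcal H$ to $\mathcal G$. If $M(\lambda_0)$ is bounded for one $\lambda_0\in\rho(A_0)$, then $M(\lambda)$ is bounded for all $\lambda\in\rho(A_0)$. For a self-adjoint operator $B$ with spectral measure $E_B$, $B_\pm:=\pm\int_{\mathbb R_\pm}\lambda\,\mathrm dE_B(\lambda)$, so $B_\pm\ge0$ and $B=B_+-B_-$; $B_+$ is bounded if $B$ is bounded from above. If $A_0$ is bounded from below and $\|\overline{M(\lambda)}\|\to0$ as $\lambda\to-\infty$, then $\overline{M(\lambda)}$ is a bounded non-negative self-adjoint operator for each $\lambda<\min\sigma(A_0)$, so that $\overline{M(\lambda)}^{1/2}$ is well defined. *)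

theory Defs
  imports "HOL-Analysis.Analysis"
begin

section \<open>Complex Hilbert spaces\<close>

text \<open>
  The inner product is linear in the first argument and conjugate linear in the second.
  Norm, metric and topology are those of the underlying real Banach space; the last axiom says
  that the norm is induced by the inner product.
\<close>

class complex_hilbert = banach +
  fixes scaleC :: "complex \<Rightarrow> 'a \<Rightarrow> 'a"  (infixr \<open>*\<^sub>C\<close> 75)
    and cinner :: "'a \<Rightarrow> 'a \<Rightarrow> complex"
  assumes scaleC_add_right: "a *\<^sub>C (x + y) = a *\<^sub>C x + a *\<^sub>C y"
    and scaleC_add_left: "(a + b) *\<^sub>C x = a *\<^sub>C x + b *\<^sub>C x"
    and scaleC_scaleC: "a *\<^sub>C (b *\<^sub>C x) = (a * b) *\<^sub>C x"
    and scaleC_of_real: "complex_of_real r *\<^sub>C x = r *\<^sub>R x"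
    and cinner_commute: "cinner x y = cnj (cinner y x)"
    and cinner_add_left: "cinner (x + y) z = cinner x z + cinner y z"
    and cinner_scaleC_left: "cinner (a *\<^sub>C x) y = a * cinner x y"
    and cinner_self: "cinner x x = complex_of_real ((norm x)\<^sup>2)"

lemma complex_vector_space: "vector_space (scaleC :: complex \<Rightarrow> 'a \<Rightarrow> 'a::complex_hilbert)"
  using scaleC_of_real[of 1]
  by unfold_locales (simp_all add: scaleC_add_right scaleC_add_left scaleC_scaleC)

instantiation complex :: complex_hilbert
begin

definition "a *\<^sub>C (x::complex) = a * x"
definition "cinner x y = x * cnj y" for x y :: complex

instance
  by standard
    (simp_all add: scaleC_complex_def cinner_complex_def algebra_simps scaleR_conv_of_real
      complex_norm_square del: of_real_power)

end

instantiation prod :: (complex_hilbert, complex_hilbert) complex_hilbert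
begin

definition "a *\<^sub>C p = (a *\<^sub>C fst p, a *\<^sub>C snd p)" for p :: "'a \<times> 'b"
definition "cinner p q = cinner (fst p) (fst q) + cinner (snd p) (snd q)" for p q :: "'a \<times> 'b"

instance
proof
  fix p q :: "'a \<times> 'b"
  show "cinner p q = cnj (cinner q p)"
    unfolding cinner_prod_def complex_cnj_add
    using cinner_commute[of "fst p" "fst q"] cinner_commute[of "snd p" "snd q"] by simp
  show "cinner p p = complex_of_real ((norm p)\<^sup>2)"
    by (simp add: cinner_prod_def cinner_self norm_prod_def del: of_real_power)
qed (simp_all add: scaleC_prod_def cinner_prod_def scaleC_add_right scaleC_add_left scaleC_scaleC
      scaleC_of_real cinner_add_left cinner_scaleC_left algebra_simps prod_eq_iff)

end

abbreviation csubspace :: "'a::complex_hilbert set \<Rightarrow> bool" where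
  "csubspace \<equiv> module.subspace scaleC"

definition clinear_on :: "'a::complex_hilbert set \<Rightarrow> ('a \<Rightarrow> 'b::complex_hilbert) \<Rightarrow> bool" where
  "clinear_on U f \<longleftrightarrow>
     (\<forall>x\<in>U. \<forall>y\<in>U. f (x + y) = f x + f y) \<and> (\<forall>a. \<forall>x\<in>U. f (a *\<^sub>C x) = a *\<^sub>C f x)"


section \<open>Linear operators\<close>

text \<open>
  A (not necessarily everywhere defined) linear operator is identified with its graph. Thus the
  domain and the range are \<^const>\<open>Domain\<close> and \<^const>\<open>Range\<close>, extension of operators is set
  inclusion, the inverse is \<^const>\<open>converse\<close>, an operator is closed if it is a \<^const>\<open>closed\<close>
  set, and the closure of a closable operator is the \<^const>\<open>closure\<close> of the set.
\<close>

type_synonym ('a, 'b) op = "('a \<times> 'b) set"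

definition linear_op :: "('a::complex_hilbert, 'b::complex_hilbert) op \<Rightarrow> bool" where
  "linear_op A \<longleftrightarrow> csubspace A \<and> single_valued A"

definition densely_defined :: "('a::complex_hilbert, 'b) op \<Rightarrow> bool" where
  "densely_defined A \<longleftrightarrow> closure (Domain A) = UNIV"

definition op_add :: "('a, 'b::complex_hilbert) op \<Rightarrow> ('a, 'b) op \<Rightarrow> ('a, 'b) op"
    (infixl \<open>+\<^sub>o\<close> 65) where
  "A +\<^sub>o B = {(x, y + z) | x y z. (x, y) \<in> A \<and> (x, z) \<in> B}"

definition op_diff :: "('a, 'b::complex_hilbert) op \<Rightarrow> ('a, 'b) op \<Rightarrow> ('a, 'b) op"
    (infixl \<open>-\<^sub>o\<close> 65) where
  "A -\<^sub>o B = {(x, y - z) | x y z. (x, y) \<in> A \<and> (x, z) \<in> B}"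

abbreviation op_comp :: "('b, 'c) op \<Rightarrow> ('a, 'b) op \<Rightarrow> ('a, 'c) op"  (infixr \<open>\<circ>\<^sub>o\<close> 75) where
  "A \<circ>\<^sub>o B \<equiv> B O A"

definition scalar_op :: "complex \<Rightarrow> ('a::complex_hilbert, 'a) op" where
  "scalar_op z = {(x, z *\<^sub>C x) | x. True}"

definition op_ker :: "('a, 'b::complex_hilbert) op \<Rightarrow> 'a set" where
  "op_ker A = {x. (x, 0) \<in> A}"

definition bounded_op :: "('a::complex_hilbert, 'b::complex_hilbert) op \<Rightarrow> bool" where
  "bounded_op A \<longleftrightarrow> (\<exists>K. \<forall>(x, y)\<in>A. norm y \<le> K * norm x)"

text \<open>As for \<^const>\<open>onorm\<close>, this is meaningful for bounded operators; \<open>0 / 0 = 0\<close> is harmless.\<close>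

definition op_norm :: "('a::complex_hilbert, 'b::complex_hilbert) op \<Rightarrow> real" where
  "op_norm A = (SUP (x, y)\<in>A. norm y / norm x)"

text \<open>For a densely defined operator this is the graph of the usual adjoint.\<close>

definition op_adjoint :: "('a::complex_hilbert, 'b::complex_hilbert) op \<Rightarrow> ('b, 'a) op" where
  "op_adjoint A = {(u, v). \<forall>(x, y)\<in>A. cinner y u = cinner x v}"

definition symmetric_op :: "('a::complex_hilbert, 'a) op \<Rightarrow> bool" where
  "symmetric_op A \<longleftrightarrow> (\<forall>(f, f')\<in>A. \<forall>(g, g')\<in>A. cinner f' g = cinner f g')"

definition self_adjoint :: "('a::complex_hilbert, 'a) op \<Rightarrow> bool" where
  "self_adjoint A \<longleftrightarrow> linear_op A \<and> densely_defined A \<and> op_adjoint A = A"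

text \<open>
  In the following four notions, for symmetric \<open>A\<close>, taking the real part only serves to convert
  the type: \<open>cinner (A f) f\<close> is real.
\<close>

definition bounded_from_below :: "('a::complex_hilbert, 'a) op \<Rightarrow> bool" where
  "bounded_from_below A \<longleftrightarrow> (\<exists>c. \<forall>(f, f')\<in>A. c * (norm f)\<^sup>2 \<le> Re (cinner f' f))"

definition bounded_from_above :: "('a::complex_hilbert, 'a) op \<Rightarrow> bool" where
  "bounded_from_above A \<longleftrightarrow> (\<exists>c. \<forall>(f, f')\<in>A. Re (cinner f' f) \<le> c * (norm f)\<^sup>2)"

definition nonneg_op :: "('a::complex_hilbert, 'a) op \<Rightarrow> bool" where
  "nonneg_op A \<longleftrightarrow> (\<forall>(f, f')\<in>A. 0 \<le> Re (cinner f' f))"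

definition nonpos_op :: "('a::complex_hilbert, 'a) op \<Rightarrow> bool" where
  "nonpos_op A \<longleftrightarrow> (\<forall>(f, f')\<in>A. Re (cinner f' f) \<le> 0)"

definition op_sqrt :: "('a::complex_hilbert, 'a) op \<Rightarrow> ('a, 'a) op" where
  "op_sqrt A = (THE R. self_adjoint R \<and> nonneg_op R \<and> R \<circ>\<^sub>o R = A)"

definition resolvent_set :: "('a::complex_hilbert, 'a) op \<Rightarrow> complex set" where
  "resolvent_set A =
     {z. single_valued ((A -\<^sub>o scalar_op z)\<inverse>) \<and> Domain ((A -\<^sub>o scalar_op z)\<inverse>) = UNIV
          \<and> bounded_op ((A -\<^sub>o scalar_op z)\<inverse>)}"

definition spectrum :: "('a::complex_hilbert, 'a) op \<Rightarrow> complex set" where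
  "spectrum A = - resolvent_set A"

text \<open>
  The minimum of the spectrum of a self-adjoint operator that is bounded from below. As the
  spectrum is then a closed set of reals bounded from below, the infimum is a minimum unless the
  spectrum is empty, which happens only in the trivial space; there the value is \<open>\<infinity>\<close>.
\<close>

definition min_spectrum :: "('a::complex_hilbert, 'a) op \<Rightarrow> ereal" where
  "min_spectrum A = Inf {ereal t | t. complex_of_real t \<in> spectrum A}"


section \<open>Spectral measures\<close>

text \<open>Projection-valued measures on the Borel sets of the real line.\<close>

definition projection_valued_measure ::
    "(real set \<Rightarrow> 'a \<Rightarrow> 'a::complex_hilbert) \<Rightarrow> bool" where
  "projection_valued_measure E \<longleftrightarrow>
     (\<forall>X\<in>sets borel. clinear_on UNIV (E X) \<and> (\<forall>x. E X (E X x) = E X x)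
        \<and> (\<forall>x y. cinner (E X x) y = cinner x (E X y))) \<and>
     (\<forall>x. E UNIV x = x) \<and>
     (\<forall>F :: nat \<Rightarrow> real set. range F \<subseteq> sets borel \<longrightarrow> disjoint_family F \<longrightarrow>
        (\<forall>x. (\<lambda>n. E (F n) x) sums E (\<Union>n. F n) x))"

text \<open>The finite measure \<open>X \<mapsto> (E(X)x, x)\<close>.\<close>

definition scalar_measure :: "(real set \<Rightarrow> 'a \<Rightarrow> 'a::complex_hilbert) \<Rightarrow> 'a \<Rightarrow> real measure" where
  "scalar_measure E x = measure_of UNIV (sets borel) (\<lambda>X. ennreal (Re (cinner (E X x) x)))"

definition spectral_domain ::
    "(real set \<Rightarrow> 'a \<Rightarrow> 'a::complex_hilbert) \<Rightarrow> (real \<Rightarrow> real) \<Rightarrow> 'a set" where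
  "spectral_domain E \<phi> = {x. integrable (scalar_measure E x) (\<lambda>t. (\<phi> t)\<^sup>2)}"

text \<open>
  The operator \<open>\<integral>\<phi> dE\<close>, for Borel \<open>\<phi>\<close>, has the domain \<^const>\<open>spectral_domain\<close> and satisfies
  \<open>((\<integral>\<phi> dE)x, z) = \<integral>\<phi>(t) d(E(t)x, z)\<close>, where the complex measure \<open>(E(\<cdot>)x, z)\<close> is
  expressed by polarization through the positive measures \<open>(E(\<cdot>)w, w)\<close>, \<open>w = x + \<i>\<^sup>k z\<close>.
\<close>

definition spectral_integral ::
    "(real set \<Rightarrow> 'a \<Rightarrow> 'a::complex_hilbert) \<Rightarrow> (real \<Rightarrow> real) \<Rightarrow> ('a, 'a) op" where
  "spectral_integral E \<phi> = {(x, y). x \<in> spectral_domain E \<phi> \<and>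
     (\<forall>z\<in>spectral_domain E \<phi>. cinner y z =
        (\<Sum>k<4. \<i> ^ k * complex_of_real (\<integral>t. \<phi> t \<partial>scalar_measure E (x + \<i> ^ k *\<^sub>C z))) / 4)}"

definition is_spectral_measure ::
    "(real set \<Rightarrow> 'a \<Rightarrow> 'a) \<Rightarrow> ('a::complex_hilbert, 'a) op \<Rightarrow> bool" where
  "is_spectral_measure E B \<longleftrightarrow>
     projection_valued_measure E \<and> B = spectral_integral E (\<lambda>t. t)"

text \<open>
  The positive part \<open>B\<^sub>+ = \<integral>\<^bsub>[0,\<infinity>)\<^esub> t dE(t)\<close> of the self-adjoint operator with spectral
  measure \<open>E\<close>.
\<close>

definition spectral_pos_part :: "(real set \<Rightarrow> 'a \<Rightarrow> 'a::complex_hilbert) \<Rightarrow> ('a, 'a) op" where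
  "spectral_pos_part E = spectral_integral E (\<lambda>t. indicator {0..} t * t)"


section \<open>Quasi boundary triples\<close>

definition op_restrict :: "('a, 'b) op \<Rightarrow> ('a \<Rightarrow> bool) \<Rightarrow> ('a, 'b) op" where
  "op_restrict T P = {(f, f')\<in>T. P f}"

text \<open>
  The boundary maps are total functions of which only the values on \<open>Domain T\<close> matter; the
  boundary space is the type \<open>'g\<close>.
\<close>

definition quasi_boundary_triple ::
    "('h::complex_hilbert, 'h) op \<Rightarrow> ('h, 'h) op \<Rightarrow> ('h \<Rightarrow> 'g::complex_hilbert) \<Rightarrow> ('h \<Rightarrow> 'g) \<Rightarrow> bool"
  where
  "quasi_boundary_triple S T \<Gamma>\<^sub>0 \<Gamma>\<^sub>1 \<longleftrightarrow>
     linear_op T \<and> T \<subseteq> op_adjoint S \<and> closure T = op_adjoint S \<and>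
     clinear_on (Domain T) \<Gamma>\<^sub>0 \<and> clinear_on (Domain T) \<Gamma>\<^sub>1 \<and>
     (\<forall>(f, Tf)\<in>T. \<forall>(g, Tg)\<in>T.
        cinner Tf g - cinner f Tg = cinner (\<Gamma>\<^sub>1 f) (\<Gamma>\<^sub>0 g) - cinner (\<Gamma>\<^sub>0 f) (\<Gamma>\<^sub>1 g)) \<and>
     closure ((\<lambda>f. (\<Gamma>\<^sub>0 f, \<Gamma>\<^sub>1 f)) ` Domain T) = UNIV \<and>
     self_adjoint (op_restrict T (\<lambda>f. \<Gamma>\<^sub>0 f = 0))"

text \<open>
  The \<open>\<gamma>\<close>-field is the inverse of the restriction of \<open>\<Gamma>\<^sub>0\<close> to \<open>ker (T - z)\<close>. It and the Weyl
  function are only of interest for \<open>z\<close> in the resolvent set of \<open>A\<^sub>0\<close>.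
\<close>

definition gamma_field ::
    "('h::complex_hilbert, 'h) op \<Rightarrow> ('h \<Rightarrow> 'g::complex_hilbert) \<Rightarrow> complex \<Rightarrow> ('g, 'h) op" where
  "gamma_field T \<Gamma>\<^sub>0 z = {(f, \<Gamma>\<^sub>0 f) | f. f \<in> op_ker (T -\<^sub>o scalar_op z)}\<inverse>"

definition weyl_function ::
    "('h::complex_hilbert, 'h) op \<Rightarrow> ('h \<Rightarrow> 'g::complex_hilbert) \<Rightarrow> ('h \<Rightarrow> 'g) \<Rightarrow> complex \<Rightarrow> ('g, 'g) op"
  where
  "weyl_function T \<Gamma>\<^sub>0 \<Gamma>\<^sub>1 z = {(f, \<Gamma>\<^sub>1 f) | f. f \<in> Domain T} \<circ>\<^sub>o gamma_field T \<Gamma>\<^sub>0 z"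

text \<open>The condition \<open>\<Gamma>\<^sub>0 f = B \<Gamma>\<^sub>1 f\<close> includes \<open>\<Gamma>\<^sub>1 f \<in> dom B\<close>.\<close>

definition bc_extension ::
    "('h::complex_hilbert, 'h) op \<Rightarrow> ('h \<Rightarrow> 'g::complex_hilbert) \<Rightarrow> ('h \<Rightarrow> 'g) \<Rightarrow> ('g, 'g) op \<Rightarrow> ('h, 'h) op"
  where
  "bc_extension T \<Gamma>\<^sub>0 \<Gamma>\<^sub>1 B = op_restrict T (\<lambda>f. (\<Gamma>\<^sub>1 f, \<Gamma>\<^sub>0 f) \<in> B)"

end

theory Submission
  imports Defs
begin

text \<open>
  Two ideas carry the proof, one for the lower bounds and one for self-adjointness.

  The lower bounds come from the Hermitian form
  \<open>q\<^sub>l(f) = (T f, f) + (\<Gamma>\<^sub>0 f, \<Gamma>\<^sub>1 f) - l |f|\<^sup>2\<close> on \<open>dom T\<close>. On \<open>dom A\<^sub>0\<close> it is the form of \<open>A\<^sub>0 - l\<close>, and on the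
  domain of \<open>A\<^sub>B\<close> it equals \<open>((A\<^sub>B - l) f, f) + (B \<Gamma>\<^sub>1 f, \<Gamma>\<^sub>1 f)\<close>. For \<open>l\<close> below the spectrum of \<open>A\<^sub>0\<close> it is
  nonnegative on all of \<open>dom T\<close> (\<open>form_nonneg\<close>): every \<open>f\<close> differs from an element of \<open>ker (T - t)\<close> by an
  element of \<open>dom A\<^sub>0\<close>, and the error terms vanish as \<open>t \<rightarrow> -\<infinity>\<close> since \<open>M(t) \<rightarrow> 0\<close>. Testing the form with
  \<open>ker (T - l)\<close> improves this to \<open>b |\<Gamma>\<^sub>1 f|\<^sup>2 \<le> q\<^sub>l(f)\<close> whenever \<open>b |M(l)| \<le> 1\<close> (\<open>boundary_bound\<close>). Hence
  \<open>A\<^sub>B \<ge> l\<close> if \<open>B \<le> b\<close> for such a \<open>b\<close> (\<open>extension_lower_bound\<close>). Taking \<open>b = 0\<close> gives (a), taking for \<open>b\<close>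
  the norm of \<open>B\<^sub>+\<close> gives (b), and any upper bound of \<open>B\<close> gives semiboundedness for \<open>l\<close> near \<open>-\<infinity>\<close>.

  The extension is symmetric by Green's identity, so it is self-adjoint once \<open>A\<^sub>B - l\<close> is onto for
  one real \<open>l\<close> (\<open>symmetric_surj_self_adjoint\<close>). Solving \<open>(A\<^sub>B - l) f = h\<close> amounts to solving
  \<open>\<phi> = B (M \<phi> + \<Gamma>\<^sub>1 (A\<^sub>0 - l)\<^sup>-\<^sup>1 h)\<close> in \<open>ran \<Gamma>\<^sub>0\<close>, where \<open>M\<close> is the closure of \<open>M(l)\<close>. With \<open>R\<close> the square root
  of \<open>M\<close>, which maps into \<open>dom B\<close>, the operator \<open>I - R B R\<close> is everywhere defined, symmetric and, for \<open>l\<close>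
  near \<open>-\<infinity>\<close>, coercive, hence onto; this solves the equation in the boundary space, and the range
  conditions on \<open>B\<close> place the solution in \<open>ran \<Gamma>\<^sub>0\<close> (\<open>bc_extension_surj\<close>).

  The remaining material supplies the operator theory behind these steps: the projection theorem
  and uniform boundedness, existence and uniqueness of square roots, the relation between lower
  bounds and the spectrum (a lower bound that is a resolvent point can be increased), and the
  inequality \<open>(B x, x) \<le> |B\<^sub>+| |x|\<^sup>2\<close> for a spectral measure of \<open>B\<close>.
\<close>

section \<open>Geometry of complex Hilbert spaces\<close>

lemma csubspace_iff:
  "csubspace V \<longleftrightarrow> 0 \<in> V \<and> (\<forall>x\<in>V. \<forall>y\<in>V. x + y \<in> V) \<and> (\<forall>c. \<forall>x\<in>V. c *\<^sub>C x \<in> V)"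
  by (rule module.subspace_def) (use complex_vector_space in \<open>simp add: vector_space_def module_def\<close>)

lemma scaleC_one [simp]: "1 *\<^sub>C x = x"
  using scaleC_of_real[of 1 x] by simp

lemma scaleC_zero_left [simp]: "0 *\<^sub>C x = 0"
  using scaleC_of_real[of 0 x] by simp

lemma scaleC_minus_one: "(-1) *\<^sub>C x = - x"
  using scaleC_of_real[of "-1" x] by simp

lemma scaleC_zero_right [simp]: "a *\<^sub>C 0 = 0"
  using scaleC_add_right[of a 0 0] by simp

lemma scaleC_minus_right: "a *\<^sub>C (- x) = - (a *\<^sub>C x)"
  using scaleC_add_right[of a x "- x"] by (simp add: eq_neg_iff_add_eq_0 add.commute)

lemma scaleC_diff_right: "a *\<^sub>C (x - y) = a *\<^sub>C x - a *\<^sub>C y"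
  using scaleC_add_right[of a x "- y"] by (simp add: scaleC_minus_right)

lemma scaleC_left_commute: "a *\<^sub>C b *\<^sub>C x = b *\<^sub>C a *\<^sub>C x"
  by (simp add: scaleC_scaleC mult.commute)

lemma csubspace_diff: "csubspace V \<Longrightarrow> x \<in> V \<Longrightarrow> y \<in> V \<Longrightarrow> x - y \<in> V"
  unfolding csubspace_iff by (metis diff_conv_add_uminus scaleC_minus_one)

lemma cinner_add_right: "cinner x (y + z) = cinner x y + cinner x z"
  by (metis cinner_add_left cinner_commute complex_cnj_add)

lemma cinner_scaleC_right: "cinner x (a *\<^sub>C y) = cnj a * cinner x y"
  by (metis cinner_commute cinner_scaleC_left complex_cnj_mult)

lemma cinner_scaleR_left: "cinner (r *\<^sub>R x) y = r * cinner x y"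
  by (metis cinner_scaleC_left scaleC_of_real)

lemma cinner_scaleR_right: "cinner x (r *\<^sub>R y) = r * cinner x y"
  by (metis cinner_scaleC_right complex_cnj_complex_of_real scaleC_of_real)

lemma cinner_zero_left [simp]: "cinner 0 y = 0"
  using cinner_scaleC_left[of 0 0 y] by simp

lemma cinner_zero_right [simp]: "cinner x 0 = 0"
  using cinner_scaleC_right[of x 0 0] by simp

lemma cinner_minus_left: "cinner (- x) y = - cinner x y"
  using cinner_scaleC_left[of "-1" x y] by (simp add: scaleC_minus_one)

lemma cinner_minus_right: "cinner x (- y) = - cinner x y"
  using cinner_scaleC_right[of x "-1" y] by (simp add: scaleC_minus_one)

lemma cinner_diff_left: "cinner (x - y) z = cinner x z - cinner y z"
  using cinner_add_left[of x "- y" z] by (simp add: cinner_minus_left)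

lemma cinner_diff_right: "cinner x (y - z) = cinner x y - cinner x z"
  using cinner_add_right[of x y "- z"] by (simp add: cinner_minus_right)

lemmas cinner_simps = cinner_add_left cinner_add_right cinner_diff_left cinner_diff_right
  cinner_minus_left cinner_minus_right cinner_scaleC_left cinner_scaleC_right
  cinner_scaleR_left cinner_scaleR_right

lemma Re_cinner_commute: "Re (cinner x y) = Re (cinner y x)"
  by (subst cinner_commute) simp

lemma Re_cinner_self: "Re (cinner x x) = (norm x)\<^sup>2"
  by (simp add: cinner_self del: of_real_power)

lemma norm_add_sq: "(norm (x + y))\<^sup>2 = (norm x)\<^sup>2 + 2 * Re (cinner x y) + (norm y)\<^sup>2"
  for x y :: "'a::complex_hilbert"
proof -
  have "(norm (x + y))\<^sup>2 = Re (cinner (x + y) (x + y))"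
    by (simp add: Re_cinner_self)
  then show ?thesis
    by (simp add: cinner_simps Re_cinner_self Re_cinner_commute[of y x])
qed

lemma norm_diff_sq: "(norm (x - y))\<^sup>2 = (norm x)\<^sup>2 - 2 * Re (cinner x y) + (norm y)\<^sup>2"
  for x y :: "'a::complex_hilbert"
  using norm_add_sq[of x "- y"] by (simp add: cinner_minus_right)

lemma parallelogram:
  "(norm (x + y))\<^sup>2 + (norm (x - y))\<^sup>2 = 2 * (norm x)\<^sup>2 + 2 * (norm y)\<^sup>2"
  for x y :: "'a::complex_hilbert"
  by (simp add: norm_add_sq norm_diff_sq)

lemma cinner_self_eq_0 [simp]: "cinner x x = 0 \<longleftrightarrow> x = 0"
  by (simp add: cinner_self)

lemma norm_scaleC: "norm (a *\<^sub>C x) = cmod a * norm x"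
proof -
  have "complex_of_real ((norm (a *\<^sub>C x))\<^sup>2) = (a * cnj a) * cinner x x"
    by (simp add: cinner_self[symmetric] cinner_simps del: of_real_power)
  also have "\<dots> = complex_of_real ((cmod a * norm x)\<^sup>2)"
    by (simp add: cinner_self complex_norm_square[symmetric] power_mult_distrib)
  finally show ?thesis
    by (simp only: of_real_eq_iff) (simp add: power2_eq_iff_nonneg)
qed

text \<open>
  Cauchy-Schwarz for a semidefinite form is nonnegativity of the quadratic polynomial
  \<open>s \<mapsto> a - 2 s b + s\<^sup>2 c\<close>; it is isolated here because it is applied to the inner product, to
  nonnegative operators and to unbounded forms.
\<close>

lemma discriminant_nonpos:
  fixes a b c :: real
  assumes "\<And>s. 0 \<le> a - 2 * s * b + s\<^sup>2 * c"
  shows "b\<^sup>2 \<le> a * c"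
proof (cases "c = 0")
  case True
  show ?thesis
  proof (cases "b = 0")
    case False
    then show ?thesis using assms[of "(a + 1) / (2 * b)"] True by simp
  qed (simp add: True)
next
  case False
  have "0 \<le> c"
  proof (rule ccontr)
    assume "\<not> 0 \<le> c"
    define s where "s = 1 + (\<bar>a\<bar> + 2 * \<bar>b\<bar>) / (- c)"
    have c: "c < 0" using \<open>\<not> 0 \<le> c\<close> by simp
    have s1: "1 \<le> s" unfolding s_def using c by (auto simp: divide_nonneg_nonpos)
    have sc: "s * c = c - (\<bar>a\<bar> + 2 * \<bar>b\<bar>)" unfolding s_def using c by (simp add: field_simps)
    have "a - 2 * s * b + s\<^sup>2 * c = a + s * (s * c - 2 * b)"
      by (simp add: algebra_simps power2_eq_square)
    also have "\<dots> \<le> a + 1 * (s * c - 2 * b)"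
    proof -
      have "s * c - 2 * b \<le> 0" using sc c by linarith
      then have "s * (s * c - 2 * b) \<le> 1 * (s * c - 2 * b)"
        using s1 by (intro mult_right_mono_neg)
      then show ?thesis by simp
    qed
    also have "\<dots> < 0" using sc c abs_ge_self[of a] abs_ge_minus_self[of b] by simp
    finally show False using assms[of s] by linarith
  qed
  with False have c: "0 < c" by simp
  have "0 \<le> a - 2 * (b / c) * b + (b / c)\<^sup>2 * c" by (rule assms)
  also have "\<dots> = a - b\<^sup>2 / c" using c by (simp add: field_simps power2_eq_square)
  finally show ?thesis using c by (simp add: field_simps)
qed

lemma Re_cinner_bound: "\<bar>Re (cinner x y)\<bar> \<le> norm x * norm y"
proof (rule power2_le_imp_le)
  have "(Re (cinner x y))\<^sup>2 \<le> (norm x)\<^sup>2 * (norm y)\<^sup>2"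
  proof (rule discriminant_nonpos)
    fix s
    have "0 \<le> (norm (x - s *\<^sub>R y))\<^sup>2" by simp
    then show "0 \<le> (norm x)\<^sup>2 - 2 * s * Re (cinner x y) + s\<^sup>2 * (norm y)\<^sup>2"
      by (simp add: norm_diff_sq cinner_simps power_mult_distrib)
  qed
  then show "\<bar>Re (cinner x y)\<bar>\<^sup>2 \<le> (norm x * norm y)\<^sup>2"
    by (simp add: power_mult_distrib)
qed simp

lemma norm_cinner_le: "cmod (cinner x y) \<le> norm x * norm y"
proof (cases "cinner x y = 0")
  case False
  define u where "u = cnj (cinner x y) / cmod (cinner x y)"
  have "Re (cinner (u *\<^sub>C x) y) = cmod (cinner x y)"
  proof -
    have "cnj (cinner x y) * cinner x y = complex_of_real ((cmod (cinner x y))\<^sup>2)"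
      by (simp only: complex_norm_square mult.commute)
    then have "cinner (u *\<^sub>C x) y = complex_of_real ((cmod (cinner x y))\<^sup>2 / cmod (cinner x y))"
      by (simp add: u_def cinner_simps)
    then show ?thesis using False by (simp add: power2_eq_square)
  qed
  moreover have "norm (u *\<^sub>C x) = norm x"
    using False by (simp add: norm_scaleC u_def norm_divide)
  ultimately show ?thesis using Re_cinner_bound[of "u *\<^sub>C x" y] by simp
qed simp

lemma bounded_bilinear_cinner: "bounded_bilinear cinner"
proof
  show "\<exists>K. \<forall>a b. norm (cinner a b) \<le> norm a * norm b * K"
    by (rule exI[of _ 1]) (simp add: norm_cinner_le)
qed (simp_all add: cinner_simps scaleR_conv_of_real)

lemmas tendsto_cinner [tendsto_intros] = bounded_bilinear.tendsto[OF bounded_bilinear_cinner]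
lemmas continuous_on_cinner [continuous_intros] =
  bounded_bilinear.continuous_on[OF bounded_bilinear_cinner]

lemma bounded_linear_scaleC: "bounded_linear (\<lambda>x. a *\<^sub>C x)"
proof
  show "\<exists>K. \<forall>x. norm (a *\<^sub>C x) \<le> norm x * K"
    by (rule exI[of _ "cmod a"]) (simp add: norm_scaleC)
  show "a *\<^sub>C r *\<^sub>R x = r *\<^sub>R a *\<^sub>C x" for r and x :: 'a
    by (simp add: scaleC_of_real[symmetric] scaleC_left_commute)
qed (simp add: scaleC_add_right)

lemmas tendsto_scaleC [tendsto_intros] = bounded_linear.tendsto[OF bounded_linear_scaleC]

lemma dense_cases:
  fixes x :: "'a::first_countable_topology"
  assumes "closure X = UNIV" obtains u where "\<And>n::nat. u n \<in> X" "u \<longlonglongrightarrow> x"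
  using assms closure_sequential[of x X] by auto

lemma dense_orthogonal_eq_0:
  assumes "closure X = UNIV" "\<And>y. y \<in> X \<Longrightarrow> cinner y x = 0"
  shows "x = 0"
proof -
  obtain u where u: "\<And>n::nat. u n \<in> X" "u \<longlonglongrightarrow> x"
    by (rule dense_cases[OF assms(1), of x]) blast
  have "(\<lambda>n. cinner (u n) x) \<longlonglongrightarrow> cinner x x"
    by (intro tendsto_intros u)
  then have "cinner x x = 0"
    using assms(2)[OF u(1)] by (simp add: LIMSEQ_const_iff)
  then show ?thesis by simp
qed

lemma dense_ext:
  assumes "closure X = UNIV" "\<And>z. z \<in> X \<Longrightarrow> cinner z x = cinner z y"
  shows "x = y"
  using dense_orthogonal_eq_0[OF assms(1), of "x - y"] assms(2) by (simp add: cinner_diff_right)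

text \<open>
  Evaluate the estimate along elements of \<open>X\<close> that converge to \<open>x\<close>.
\<close>

lemma norm_le_dense:
  assumes "closure X = UNIV" "\<And>z. z \<in> X \<Longrightarrow> Re (cinner x z) \<le> K * norm z" "0 \<le> K"
  shows "norm x \<le> K"
proof (cases "x = 0")
  case False
  obtain u where u: "\<And>n::nat. u n \<in> X" "u \<longlonglongrightarrow> x"
    by (rule dense_cases[OF assms(1), of x]) blast
  have "Re (cinner x x) \<le> K * norm x"
  proof (rule LIMSEQ_le)
    show "(\<lambda>n. Re (cinner x (u n))) \<longlonglongrightarrow> Re (cinner x x)"
      "(\<lambda>n. K * norm (u n)) \<longlonglongrightarrow> K * norm x"
      by (intro tendsto_intros u)+
  qed (use assms(2) u in auto)
  then show ?thesis using False by (simp add: Re_cinner_self power2_eq_square)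
qed (use assms in simp)

text \<open>
  The projection theorem, in the form from which ranges of operators are recognized as the whole
  space: a nearest point \<open>w\<close> of \<open>V\<close> to \<open>x\<close> exists by completeness, and \<open>x - w\<close> is orthogonal to \<open>V\<close>.
\<close>

lemma closed_subspace_eq_UNIV:
  fixes V :: "'a::complex_hilbert set"
  assumes V: "csubspace V" "closed V"
    and orth: "\<And>z. (\<And>v. v \<in> V \<Longrightarrow> cinner v z = 0) \<Longrightarrow> z = 0"
  shows "V = UNIV"
proof -
  have "x \<in> V" for x
  proof -
    have ne: "V \<noteq> {}" using V(1) by (auto simp: csubspace_iff)
    define d where "d = infdist x V"
    have d_le: "d \<le> norm (x - v)" if "v \<in> V" for v
      unfolding d_def using infdist_le[OF that] by (simp add: dist_norm)
    have "\<exists>v\<in>V. norm (x - v) < d + 1 / Suc n" for n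
    proof -
      have "\<exists>v\<in>V. dist x v < d + 1 / Suc n"
        using ne cInf_lessD[of "dist x ` V" "d + 1 / Suc n"] by (auto simp: d_def infdist_def)
      then show ?thesis by (simp add: dist_norm)
    qed
    then obtain v where v: "\<And>n. v n \<in> V" "\<And>n. norm (x - v n) < d + 1 / Suc n" by metis
    have d0: "0 \<le> d" by (simp add: d_def infdist_nonneg)
    \<comment> \<open>The parallelogram identity makes a minimizing sequence a Cauchy sequence.\<close>
    have close: "(norm (v m - v n))\<^sup>2 \<le> (8 * d + 4) / Suc N" if "m \<ge> N" "n \<ge> N" for m n N
    proof -
      have half: "(1/2) *\<^sub>R (v m + v n) \<in> V"
        using V(1) v(1) by (simp add: csubspace_iff scaleC_of_real[symmetric])
      have le: "norm (x - v k) \<le> d + 1 / Suc N" if "k \<ge> N" for k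
      proof -
        have "1 / real (Suc k) \<le> 1 / Suc N" using that by (simp add: frac_le)
        then show ?thesis using v(2)[of k] by linarith
      qed
      have sq: "(norm (x - v k))\<^sup>2 \<le> d\<^sup>2 + (2 * d + 1) / Suc N" if "k \<ge> N" for k
      proof -
        have "(norm (x - v k))\<^sup>2 \<le> (d + 1 / Suc N)\<^sup>2" using le[OF that] by (intro power_mono) auto
        also have "\<dots> = d\<^sup>2 + 2 * d / Suc N + (1 / Suc N)\<^sup>2" by (simp add: power2_sum)
        also have "(1 / Suc N)\<^sup>2 \<le> 1 / real (Suc N)"
          by (simp add: power_divide power2_eq_square divide_simps)
        finally show ?thesis by (simp add: add_divide_distrib)
      qed
      have "x - (1/2) *\<^sub>R (v m + v n) = (1/2) *\<^sub>R ((x - v m) + (x - v n))"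
        by (simp add: algebra_simps scaleR_2[symmetric])
      then have "d \<le> norm ((x - v m) + (x - v n)) / 2"
        using d_le[OF half] by simp
      then have "d\<^sup>2 \<le> (norm ((x - v m) + (x - v n)) / 2)\<^sup>2" using d0 by (intro power_mono) auto
      then have "4 * d\<^sup>2 \<le> (norm ((x - v m) + (x - v n)))\<^sup>2" by (simp add: power_divide)
      moreover have "(norm ((x - v m) + (x - v n)))\<^sup>2 + (norm ((x - v m) - (x - v n)))\<^sup>2
          = 2 * (norm (x - v m))\<^sup>2 + 2 * (norm (x - v n))\<^sup>2"
        by (rule parallelogram)
      moreover have "norm ((x - v m) - (x - v n)) = norm (v m - v n)"
        by (simp add: norm_minus_commute)
      ultimately have "(norm (v m - v n))\<^sup>2 \<le> 4 * ((2 * d + 1) / Suc N)"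
        using sq[OF \<open>m \<ge> N\<close>] sq[OF \<open>n \<ge> N\<close>] by (simp only:)
      then show ?thesis by (simp add: field_simps)
    qed
    have "Cauchy v"
    proof (rule metric_CauchyI)
      fix e :: real assume e: "0 < e"
      obtain N :: nat where "(8 * d + 4) / e\<^sup>2 < N" using reals_Archimedean2 by blast
      then have N: "(8 * d + 4) / e\<^sup>2 < Suc N" by simp
      then have "(8 * d + 4) / Suc N < e\<^sup>2" using e by (simp add: field_simps)
      then have "norm (v m - v n) < e" if "m \<ge> N" "n \<ge> N" for m n
        using close[OF that] e by (intro power2_less_imp_less[of _ e]) auto
      then show "\<exists>M. \<forall>m\<ge>M. \<forall>n\<ge>M. dist (v m) (v n) < e" by (auto simp: dist_norm)
    qed
    then obtain w where w: "v \<longlonglongrightarrow> w" using Cauchy_convergent convergent_def by blast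
    have wV: "w \<in> V" using closed_sequentially[OF V(2)] v(1) w by blast
    have "norm (x - w) \<le> d"
    proof (rule LIMSEQ_le)
      show "(\<lambda>n. norm (x - v n)) \<longlonglongrightarrow> norm (x - w)" by (intro tendsto_intros w)
      show "(\<lambda>n. d + 1 / Suc n) \<longlonglongrightarrow> d"
        using tendsto_add[OF tendsto_const LIMSEQ_inverse_real_of_nat, of d]
        by (simp add: inverse_eq_divide)
    qed (use v(2) less_imp_le in blast)
    then have min: "norm (x - w) \<le> norm (x - u)" if "u \<in> V" for u
      using d_le[OF that] by linarith
    have Re0: "Re (cinner u (x - w)) = 0" if u: "u \<in> V" for u
    proof -
      have "(Re (cinner (x - w) u))\<^sup>2 \<le> 0 * (norm u)\<^sup>2"
      proof (rule discriminant_nonpos)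
        fix s :: real
        have "w + s *\<^sub>R u \<in> V"
          using V(1) wV u by (simp add: csubspace_iff scaleC_of_real[symmetric])
        then have "(norm (x - w))\<^sup>2 \<le> (norm ((x - w) - s *\<^sub>R u))\<^sup>2"
          using min by (intro power_mono) (auto simp: algebra_simps)
        then show "0 \<le> 0 - 2 * s * Re (cinner (x - w) u) + s\<^sup>2 * (norm u)\<^sup>2"
          by (simp add: norm_diff_sq cinner_simps power_mult_distrib)
      qed
      then show ?thesis by (simp add: Re_cinner_commute)
    qed
    have "cinner u (x - w) = 0" if u: "u \<in> V" for u
    proof -
      have "\<i> *\<^sub>C u \<in> V" using V(1) u by (simp add: csubspace_iff)
      from Re0[OF this] Re0[OF u] show ?thesis by (simp add: complex_eq_iff cinner_simps)
    qed
    then have "x - w = 0" by (rule orth)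
    then show "x \<in> V" using wV by simp
  qed
  then show ?thesis by auto
qed

text \<open>
  The uniform boundedness principle for vectors seen as functionals: by Baire's theorem one of the
  closed sets \<open>C n\<close> of points at which the family is bounded by \<open>n\<close> contains a ball.
\<close>

lemma weakly_bounded_imp_bounded:
  fixes S :: "'a::complex_hilbert set"
  assumes "\<And>x. \<exists>K. \<forall>s\<in>S. Re (cinner s x) \<le> K"
  shows "\<exists>K. \<forall>s\<in>S. norm s \<le> K"
proof -
  define C where "C n = {x. \<forall>s\<in>S. Re (cinner s x) \<le> real n \<and> Re (cinner s (- x)) \<le> real n}" for n
  have cl: "closed (C n)" for n
  proof -
    have "C n = (\<Inter>s\<in>S. {x. Re (cinner s x) \<le> real n} \<inter> {x. Re (cinner s (- x)) \<le> real n})"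
      by (auto simp: C_def)
    then show ?thesis
      by (auto intro!: closed_INT closed_Int closed_Collect_le continuous_intros)
  qed
  have cover: "(\<Union>n. C n) = UNIV"
  proof -
    have "\<exists>n. x \<in> C n" for x
    proof -
      obtain K L where K: "\<forall>s\<in>S. Re (cinner s x) \<le> K" and L: "\<forall>s\<in>S. Re (cinner s (- x)) \<le> L"
        using assms by metis
      obtain n where "max K L \<le> real n" using real_arch_simple by blast
      then have "x \<in> C n" using K L by (fastforce simp: C_def intro: order_trans)
      then show ?thesis ..
    qed
    then show ?thesis by auto
  qed
  have "\<exists>n. interior (C n) \<noteq> {}"
  proof (rule ccontr)
    assume "\<not> ?thesis"
    then have *: "closed X \<and> interior X = {}" if "X \<in> range C" for X
      using that cl by blast
    have "interior (\<Union>(range C)) = {}"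
      using Met_TC.metric_Baire_category_alt[of "range C", simplified mcomplete_iff_complete
          closedin_mtopology_eq_closed mtopology_is_euclidean euclidean_interior_of closed_closedin[symmetric],
          OF complete_UNIV] * by simp
    then show False using cover by simp
  qed
  then obtain n x e where e: "0 < e" "ball x e \<subseteq> C n" by (auto simp: mem_interior)
  have "norm s \<le> 4 * real n / e" if s: "s \<in> S" for s
  proof (cases "s = 0")
    case False
    define y where "y = (e / (2 * norm s)) *\<^sub>R s"
    have "norm y < e" using e False by (simp add: y_def)
    then have "x + y \<in> C n" "x \<in> C n" using e by (auto simp: dist_norm subset_eq)
    then have "Re (cinner s (x + y)) \<le> n" "Re (cinner s (- x)) \<le> n" using s by (auto simp: C_def)
    then have "Re (cinner s y) \<le> 2 * n" by (simp add: cinner_simps)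
    moreover have "Re (cinner s y) = e * norm s / 2"
      using False by (simp add: y_def cinner_simps Re_cinner_self power2_eq_square)
    ultimately show ?thesis using e by (simp add: field_simps)
  qed (use e in simp)
  then show ?thesis by blast
qed

section \<open>Square roots of bounded nonnegative operators\<close>

definition symmetric_map :: "('a::complex_hilbert \<Rightarrow> 'a) \<Rightarrow> bool" where
  "symmetric_map f \<longleftrightarrow> (\<forall>x y. cinner (f x) y = cinner x (f y))"

lemma symmetric_mapD: "symmetric_map f \<Longrightarrow> cinner (f x) y = cinner x (f y)"
  by (simp add: symmetric_map_def)

lemma cinner_ext: "(\<And>z. cinner z x = cinner z y) \<Longrightarrow> x = y"
  by (rule dense_ext[of UNIV]) auto

lemma cinner_ext_left: "(\<And>z. cinner x z = cinner y z) \<Longrightarrow> x = y"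
  by (rule cinner_ext) (metis cinner_commute)

text \<open>Symmetry alone forces linearity, since \<open>(f x, z) = (x, f z)\<close> is linear in \<open>x\<close>.\<close>

lemma symmetric_map_linear:
  assumes "symmetric_map f"
  shows "f (x + y) = f x + f y" "f (x - y) = f x - f y" "f (a *\<^sub>C x) = a *\<^sub>C f x"
    "f (r *\<^sub>R x) = r *\<^sub>R f x" "f 0 = 0"
proof -
  show sc: "f (a *\<^sub>C x) = a *\<^sub>C f x" for a x
    by (rule cinner_ext_left) (simp add: symmetric_mapD[OF assms] cinner_simps)
  show "f (x + y) = f x + f y" "f (x - y) = f x - f y"
    by (rule cinner_ext_left; simp add: symmetric_mapD[OF assms] cinner_simps)+
  show "f (r *\<^sub>R x) = r *\<^sub>R f x" using sc[of "complex_of_real r" x] by (simp add: scaleC_of_real)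
  show "f 0 = 0" using sc[of 0 0] by simp
qed

lemma nonneg_Cauchy_Schwarz:
  assumes f: "symmetric_map f" and nn: "\<And>x. 0 \<le> Re (cinner (f x) x)"
  shows "(Re (cinner (f x) y))\<^sup>2 \<le> Re (cinner (f x) x) * Re (cinner (f y) y)"
proof (rule discriminant_nonpos)
  fix s :: real
  have "Re (cinner (f y) x) = Re (cinner (f x) y)"
    by (metis symmetric_mapD[OF f] Re_cinner_commute)
  with nn[of "x - s *\<^sub>R y"]
  show "0 \<le> Re (cinner (f x) x) - 2 * s * Re (cinner (f x) y) + s\<^sup>2 * Re (cinner (f y) y)"
    by (simp add: symmetric_map_linear[OF f] cinner_simps power2_eq_square algebra_simps)
qed

text \<open>
  The norm bound follows from the bound of the quadratic form: by the Cauchy-Schwarz inequality,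
  \<open>|f x|\<^sup>4 = (f x, f x)\<^sup>2 \<le> (f x, x) (f (f x), f x)\<close>.
\<close>

lemma nonneg_map_bound:
  assumes f: "symmetric_map f" and nn: "\<And>x. 0 \<le> Re (cinner (f x) x)"
    and c: "\<And>x. Re (cinner (f x) x) \<le> c * (norm x)\<^sup>2" "0 \<le> c"
  shows "norm (f x) \<le> c * norm x"
proof (cases "f x = 0")
  case False
  have "((norm (f x))\<^sup>2)\<^sup>2 = (Re (cinner (f x) (f x)))\<^sup>2" by (simp add: Re_cinner_self)
  also have "\<dots> \<le> Re (cinner (f x) x) * Re (cinner (f (f x)) (f x))"
    by (rule nonneg_Cauchy_Schwarz[OF f nn])
  also have "\<dots> \<le> (c * (norm x)\<^sup>2) * (c * (norm (f x))\<^sup>2)"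
    by (intro mult_mono c nn) (use c in auto)
  finally have "(norm (f x))\<^sup>2 * (norm (f x))\<^sup>2 \<le> (c * norm x)\<^sup>2 * (norm (f x))\<^sup>2"
    by (simp only: power2_eq_square mult_ac)
  moreover have "0 < (norm (f x))\<^sup>2" using False by simp
  ultimately have "(norm (f x))\<^sup>2 \<le> (c * norm x)\<^sup>2" by (rule mult_right_le_imp_le)
  then show ?thesis using c(2) by (simp add: power2_le_iff_abs_le)
qed (use c(2) in simp)

lemma nonneg_map_eq_0:
  assumes "symmetric_map f" "\<And>x. 0 \<le> Re (cinner (f x) x)" "Re (cinner (f x) x) = 0"
  shows "f x = 0"
  using nonneg_Cauchy_Schwarz[OF assms(1,2), of x "f x"] assms(3) by (simp add: Re_cinner_self)

lemma bounded_linear_symmetric_map: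
  assumes "symmetric_map f" "\<And>x. norm (f x) \<le> c * norm x"
  shows "bounded_linear f"
  by (rule bounded_linear_intro[where K = c])
    (simp_all add: symmetric_map_linear[OF assms(1)] assms(2) mult.commute)

text \<open>
  For \<open>0 \<le> f \<le> I\<close> put \<open>D = I - f\<close>. The iteration \<open>X\<^sub>n\<^sub>+\<^sub>1 = (D + X\<^sub>n\<^sup>2)/2\<close> is majorized in norm by the
  scalar iteration \<open>s\<^sub>n\<^sub>+\<^sub>1 = (1 + s\<^sub>n\<^sup>2)/2\<close>, which increases and is bounded by \<open>1\<close>. Hence \<open>X\<^sub>n\<close>
  converges in norm to a contraction \<open>X\<close> with \<open>2 X = D + X\<^sup>2\<close>, that is \<open>(I - X)\<^sup>2 = f\<close>.
\<close>

primrec sqrt_majorant :: "nat \<Rightarrow> real" where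
  "sqrt_majorant 0 = 0"
| "sqrt_majorant (Suc n) = (1 + (sqrt_majorant n)\<^sup>2) / 2"

primrec sqrt_iterate :: "('a::complex_hilbert \<Rightarrow>\<^sub>L 'a) \<Rightarrow> nat \<Rightarrow> 'a \<Rightarrow>\<^sub>L 'a" where
  "sqrt_iterate D 0 = 0"
| "sqrt_iterate D (Suc n) = (1/2) *\<^sub>R (D + (sqrt_iterate D n o\<^sub>L sqrt_iterate D n))"

lemma sqrt_majorant_bounds: "0 \<le> sqrt_majorant n \<and> sqrt_majorant n \<le> 1"
proof (induction n)
  case (Suc n)
  then have "(sqrt_majorant n)\<^sup>2 \<le> 1" by (simp add: power_le_one)
  then show ?case by simp
qed simp

lemma sqrt_majorant_mono: "sqrt_majorant n \<le> sqrt_majorant (Suc n)"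
  using zero_le_power2[of "1 - sqrt_majorant n"] by (simp add: power2_diff)

lemma convergent_sqrt_majorant: "convergent sqrt_majorant"
proof (rule Bseq_monoseq_convergent)
  show "Bseq sqrt_majorant" by (rule BseqI'[of _ 1]) (use sqrt_majorant_bounds in auto)
  show "monoseq sqrt_majorant" by (rule incseq_imp_monoseq[OF incseq_SucI]) (rule sqrt_majorant_mono)
qed

lemma convergent_sqrt_iterate:
  assumes D: "norm D \<le> 1"
  shows "convergent (sqrt_iterate D)" "norm (sqrt_iterate D n) \<le> 1"
proof -
  define X where "X = sqrt_iterate D"
  define s where "s = sqrt_majorant"
  have X_le: "norm (X n) \<le> s n" for n
  proof (induction n)
    case (Suc n)
    have "norm (X n o\<^sub>L X n) \<le> norm (X n) * norm (X n)" by (rule norm_blinfun_compose)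
    also have "\<dots> \<le> (s n)\<^sup>2" unfolding power2_eq_square
      using Suc sqrt_majorant_bounds by (intro mult_mono) (auto simp: s_def)
    finally have "norm (D + (X n o\<^sub>L X n)) \<le> 1 + (s n)\<^sup>2" using D norm_triangle_mono by blast
    then show ?case by (simp add: X_def s_def)
  qed (simp add: X_def s_def)
  then show "norm (sqrt_iterate D n) \<le> 1"
    using sqrt_majorant_bounds[of n] unfolding X_def s_def by (meson order_trans)
  have step: "norm (X (Suc n) - X n) \<le> s (Suc n) - s n" for n
  proof (induction n)
    case 0 show ?case using D by (simp add: X_def s_def blinfun_compose_zero)
  next
    case (Suc n)
    let ?Y = "X (Suc n)" and ?Z = "X n"
    have "X (Suc (Suc n)) - X (Suc n) = (1/2) *\<^sub>R ((?Y o\<^sub>L (?Y - ?Z)) + ((?Y - ?Z) o\<^sub>L ?Z))"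
      by (simp add: X_def blinfun.bilinear_simps bounded_bilinear.diff_left[OF bounded_bilinear_blinfun_compose]
          bounded_bilinear.diff_right[OF bounded_bilinear_blinfun_compose] algebra_simps
          del: sqrt_iterate.simps(2)) (simp add: algebra_simps)
    then have "norm (X (Suc (Suc n)) - X (Suc n))
        \<le> (norm ?Y * norm (?Y - ?Z) + norm (?Y - ?Z) * norm ?Z) / 2"
      by (simp del: sqrt_iterate.simps)
        (meson add_mono norm_blinfun_compose norm_triangle_le)
    also have "\<dots> \<le> (s (Suc n) * (s (Suc n) - s n) + (s (Suc n) - s n) * s n) / 2"
      using X_le[of n] X_le[of "Suc n"] Suc sqrt_majorant_bounds sqrt_majorant_mono[of n]
      by (intro divide_right_mono add_mono mult_mono) (auto simp: s_def)
    also have "\<dots> = s (Suc (Suc n)) - s (Suc n)"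
      by (simp add: s_def power2_eq_square algebra_simps add_divide_distrib diff_divide_distrib)
    finally show ?case .
  qed
  have far: "norm (X (n + k) - X n) \<le> s (n + k) - s n" for n k
  proof (induction k)
    case (Suc k)
    have "norm (X (n + Suc k) - X n) \<le> norm (X (Suc (n + k)) - X (n + k)) + norm (X (n + k) - X n)"
      using norm_triangle_ineq[of "X (Suc (n + k)) - X (n + k)" "X (n + k) - X n"] by simp
    with step[of "n + k"] Suc show ?case by simp
  qed simp
  have "Cauchy s" using convergent_sqrt_majorant by (simp add: s_def Cauchy_convergent_iff)
  have "Cauchy X"
  proof (rule CauchyI')
    fix e :: real assume "0 < e"
    then obtain N where N: "\<And>m n. m \<ge> N \<Longrightarrow> n \<ge> N \<Longrightarrow> dist (s m) (s n) < e"
      using metric_CauchyD[OF \<open>Cauchy s\<close>] by blast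
    have "dist (X m) (X n) < e" if "m \<ge> N" "n > m" for m n
    proof -
      obtain k where k: "n = m + k" using \<open>n > m\<close> less_imp_add_positive by blast
      have "dist (X m) (X n) \<le> s n - s m" using far[of m k] by (simp add: k dist_norm norm_minus_commute)
      also have "\<dots> \<le> dist (s m) (s n)" by (simp add: dist_real_def)
      finally show ?thesis using N[of m n] that by simp
    qed
    then show "\<exists>M. \<forall>m\<ge>M. \<forall>n>m. dist (X m) (X n) < e" by blast
  qed
  then show "convergent (sqrt_iterate D)" by (simp add: Cauchy_convergent_iff X_def)
qed

text \<open>
  The root commutes with everything that commutes with \<open>f\<close>, being a limit of polynomials in \<open>f\<close>;
  this is what makes nonnegative roots unique.
\<close>

lemma contraction_sqrt_exists:
  assumes f: "symmetric_map f" and nn: "\<And>x. 0 \<le> Re (cinner (f x) x)"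
    and le: "\<And>x. Re (cinner (f x) x) \<le> (norm x)\<^sup>2"
  shows "\<exists>r. symmetric_map r \<and> (\<forall>x. 0 \<le> Re (cinner (r x) x)) \<and> (\<forall>x. r (r x) = f x) \<and>
    (\<forall>x. norm (r x) \<le> 2 * norm x) \<and>
    (\<forall>g. bounded_linear g \<longrightarrow> (\<forall>x. g (f x) = f (g x)) \<longrightarrow> (\<forall>x. g (r x) = r (g x)))"
proof -
  have fD: "symmetric_map (\<lambda>x. x - f x)"
    using f by (simp add: symmetric_map_def cinner_simps)
  have nD: "norm (x - f x) \<le> 1 * norm x" for x
    by (rule nonneg_map_bound[OF fD]) (use nn le in \<open>auto simp: cinner_simps Re_cinner_self\<close>)
  then have bD: "bounded_linear (\<lambda>x. x - f x)" by (rule bounded_linear_symmetric_map[OF fD])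
  define D where "D = Blinfun (\<lambda>x. x - f x)"
  have D: "blinfun_apply D x = x - f x" for x
    unfolding D_def by (simp add: bounded_linear_Blinfun_apply[OF bD])
  have "norm D \<le> 1" using nD by (intro norm_blinfun_bound) (auto simp: D)
  note conv = convergent_sqrt_iterate[OF this]
  then obtain X where X: "sqrt_iterate D \<longlonglongrightarrow> X" by (auto simp: convergent_def)
  have lim: "(\<lambda>n. sqrt_iterate D n x) \<longlonglongrightarrow> X x" for x
    by (intro blinfun.tendsto X tendsto_const)
  have "norm X \<le> 1"
    by (rule LIMSEQ_le_const2[OF tendsto_norm[OF X]]) (use conv(2) in auto)
  then have nX: "norm (X x) \<le> norm x" for x
    using norm_blinfun[of X x] mult_right_mono[of "norm X" 1 "norm x"] by auto
  have Xeq: "X = (1/2) *\<^sub>R (D + (X o\<^sub>L X))"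
  proof (rule LIMSEQ_unique)
    show "(\<lambda>n. sqrt_iterate D (Suc n)) \<longlonglongrightarrow> X" using X by (rule LIMSEQ_Suc)
    show "(\<lambda>n. sqrt_iterate D (Suc n)) \<longlonglongrightarrow> (1/2) *\<^sub>R (D + (X o\<^sub>L X))"
      unfolding sqrt_iterate.simps
      by (intro tendsto_intros X bounded_bilinear.tendsto[OF bounded_bilinear_blinfun_compose])
  qed
  have XX: "X (X x) = 2 *\<^sub>R X x - (x - f x)" for x
    using arg_cong[OF Xeq, of "\<lambda>Y. 2 *\<^sub>R blinfun_apply Y x"]
    by (simp add: blinfun.bilinear_simps D)
  define r where "r x = x - X x" for x
  have "symmetric_map (sqrt_iterate D n)" for n
  proof (induction n)
    case (Suc n)
    then show ?case using fD by (simp add: symmetric_map_def blinfun.bilinear_simps D cinner_simps)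
  qed (simp add: symmetric_map_def)
  then have symX: "symmetric_map X"
    unfolding symmetric_map_def
    by (intro allI LIMSEQ_unique[OF tendsto_cinner[OF lim tendsto_const]])
      (simp add: symmetric_map_def tendsto_cinner[OF tendsto_const lim])
  show ?thesis
  proof (intro exI[of _ r] conjI allI impI)
    show "symmetric_map r" using symX by (simp add: symmetric_map_def r_def cinner_simps)
    show "0 \<le> Re (cinner (r x) x)" for x
    proof -
      have "Re (cinner (X x) x) \<le> norm (X x) * norm x" using Re_cinner_bound abs_le_D1 by blast
      also have "\<dots> \<le> norm x * norm x" using nX by (intro mult_right_mono) auto
      finally show ?thesis by (simp add: r_def cinner_simps Re_cinner_self power2_eq_square)
    qed
    show "r (r x) = f x" for x
      by (simp add: r_def blinfun.bilinear_simps XX scaleR_2)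
    show "norm (r x) \<le> 2 * norm x" for x
      unfolding r_def using norm_triangle_ineq4[of x "X x"] nX[of x] by linarith
    fix g :: "'a \<Rightarrow> 'a" and x
    assume g: "bounded_linear g" and gf: "\<forall>x. g (f x) = f (g x)"
    interpret g: bounded_linear g by (rule g)
    have "g (sqrt_iterate D n x) = sqrt_iterate D n (g x)" for n x
      by (induction n arbitrary: x)
        (simp_all add: blinfun.bilinear_simps D g.zero g.add g.diff g.scaleR gf)
    then have "(\<lambda>n. g (sqrt_iterate D n x)) \<longlonglongrightarrow> X (g x)" using lim by simp
    then have "g (X x) = X (g x)" using LIMSEQ_unique[OF g.tendsto[OF lim]] by blast
    then show "g (r x) = r (g x)" by (simp add: r_def g.diff)
  qed
qed

text \<open>
  Rescaling \<open>f\<close> by an upper bound of its norm reduces this to contractions.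
\<close>

lemma nonneg_sqrt_exists:
  assumes f: "symmetric_map f" and nn: "\<And>x. 0 \<le> Re (cinner (f x) x)"
    and bd: "\<And>x. norm (f x) \<le> c * norm x"
  shows "\<exists>r. symmetric_map r \<and> (\<forall>x. 0 \<le> Re (cinner (r x) x)) \<and> (\<forall>x. r (r x) = f x) \<and>
    bounded_linear r \<and>
    (\<forall>g. bounded_linear g \<longrightarrow> (\<forall>x. g (f x) = f (g x)) \<longrightarrow> (\<forall>x. g (r x) = r (g x)))"
proof -
  define k where "k = max 1 c"
  have k: "0 < k" by (simp add: k_def)
  define h where "h x = (1 / k) *\<^sub>R f x" for x
  have h: "symmetric_map h" using f by (simp add: symmetric_map_def h_def cinner_simps)
  have le: "Re (cinner (h x) x) \<le> (norm x)\<^sup>2" for x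
  proof -
    have "Re (cinner (f x) x) \<le> norm (f x) * norm x" using Re_cinner_bound abs_le_D1 by blast
    also have "\<dots> \<le> (k * norm x) * norm x"
      by (intro mult_right_mono order_trans[OF bd]) (auto simp: k_def)
    finally show ?thesis using k by (simp add: h_def cinner_simps divide_simps power2_eq_square mult_ac)
  qed
  have nnh: "0 \<le> Re (cinner (h x) x)" for x using nn k by (simp add: h_def cinner_simps)
  obtain q where q: "symmetric_map q" "\<forall>x. 0 \<le> Re (cinner (q x) x)" "\<forall>x. q (q x) = h x"
    "\<forall>x. norm (q x) \<le> 2 * norm x"
    "\<forall>g. bounded_linear g \<longrightarrow> (\<forall>x. g (h x) = h (g x)) \<longrightarrow> (\<forall>x. g (q x) = q (g x))"
    using contraction_sqrt_exists[OF h nnh le] by blast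
  define r where "r x = sqrt k *\<^sub>R q x" for x
  show ?thesis
  proof (intro exI[of _ r] conjI allI impI)
    show "symmetric_map r" using q(1) by (simp add: symmetric_map_def r_def cinner_simps)
    show "0 \<le> Re (cinner (r x) x)" for x using q(2) k by (simp add: r_def cinner_simps)
    show "r (r x) = f x" for x
      using k by (simp add: r_def symmetric_map_linear[OF q(1)] q(3) h_def)
    have "bounded_linear q" using bounded_linear_symmetric_map[OF q(1)] q(4) by blast
    then show "bounded_linear r"
      unfolding r_def[abs_def] by (rule bounded_linear_compose[OF bounded_linear_scaleR_right])
    fix g :: "'a \<Rightarrow> 'a" and x
    assume g: "bounded_linear g" and gf: "\<forall>x. g (f x) = f (g x)"
    interpret g: bounded_linear g by (rule g)
    show "g (r x) = r (g x)" using q(5) g gf by (simp add: r_def h_def g.scaleR)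
  qed
qed

lemma nonneg_sqrt_unique:
  assumes r: "symmetric_map r" "\<And>x. 0 \<le> Re (cinner (r x) x)"
    and q: "symmetric_map q" "\<And>x. 0 \<le> Re (cinner (q x) x)"
    and eq: "\<And>x. q (q x) = r (r x)" and comm: "\<And>x. q (r x) = r (q x)"
  shows "q = r"
proof
  fix x
  \<comment> \<open>\<open>(q + r) (q - r) = q\<^sup>2 - r\<^sup>2 = 0\<close>, so both roots vanish on the range of \<open>q - r\<close>.\<close>
  define y where "y = q x - r x"
  have "q y + r y = 0"
    by (simp add: y_def symmetric_map_linear[OF r(1)] symmetric_map_linear[OF q(1)] eq comm)
  then have "Re (cinner (q y) y) + Re (cinner (r y) y) = 0"
    by (metis cinner_add_left cinner_zero_left plus_complex.sel(1) zero_complex.sel(1))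
  then have "Re (cinner (q y) y) = 0" "Re (cinner (r y) y) = 0"
    using q(2)[of y] r(2)[of y] by linarith+
  then have "q y = 0" "r y = 0" using nonneg_map_eq_0 q r by blast+
  then have "cinner y y = 0"
    by (simp add: y_def[of] cinner_diff_left symmetric_mapD[OF q(1)] symmetric_mapD[OF r(1)])
  then show "q x = r x" by (simp add: y_def)
qed

section \<open>Linear operators as graphs\<close>

lemma linear_opD:
  assumes "linear_op A"
  shows "(0, 0) \<in> A"
    and "(x, y) \<in> A \<Longrightarrow> (x', y') \<in> A \<Longrightarrow> (x + x', y + y') \<in> A"
    and "(x, y) \<in> A \<Longrightarrow> (x', y') \<in> A \<Longrightarrow> (x - x', y - y') \<in> A"
    and "(x, y) \<in> A \<Longrightarrow> (a *\<^sub>C x, a *\<^sub>C y) \<in> A"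
    and "(x, y) \<in> A \<Longrightarrow> (x, z) \<in> A \<Longrightarrow> y = z"
proof -
  have A: "csubspace A" "single_valued A" using assms by (auto simp: linear_op_def)
  show "(0, 0) \<in> A" using A(1) by (simp add: csubspace_iff zero_prod_def)
  show "(x, y) \<in> A \<Longrightarrow> (x', y') \<in> A \<Longrightarrow> (x + x', y + y') \<in> A"
    using A(1) unfolding csubspace_iff by (metis add_Pair)
  show "(x, y) \<in> A \<Longrightarrow> (x', y') \<in> A \<Longrightarrow> (x - x', y - y') \<in> A"
    using csubspace_diff[OF A(1)] by (metis diff_Pair)
  show "(x, y) \<in> A \<Longrightarrow> (a *\<^sub>C x, a *\<^sub>C y) \<in> A"
    using A(1) unfolding csubspace_iff scaleC_prod_def by (metis fst_conv snd_conv)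
  show "(x, y) \<in> A \<Longrightarrow> (x, z) \<in> A \<Longrightarrow> y = z" using A(2) by (auto dest: single_valuedD)
qed

lemma linear_opI:
  assumes "(0, 0) \<in> A"
    and "\<And>x y x' y'. (x, y) \<in> A \<Longrightarrow> (x', y') \<in> A \<Longrightarrow> (x + x', y + y') \<in> A"
    and "\<And>a x y. (x, y) \<in> A \<Longrightarrow> (a *\<^sub>C x, a *\<^sub>C y) \<in> A"
    and "\<And>x y z. (x, y) \<in> A \<Longrightarrow> (x, z) \<in> A \<Longrightarrow> y = z"
  shows "linear_op A"
  using assms by (auto simp: linear_op_def csubspace_iff zero_prod_def scaleC_prod_def single_valued_def)

lemma in_diff_scalar_op: "(f, h) \<in> A -\<^sub>o scalar_op z \<longleftrightarrow> (f, h + z *\<^sub>C f) \<in> A"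
  by (auto simp: op_diff_def scalar_op_def) (metis add_diff_cancel)

lemma in_op_adjoint: "(u, v) \<in> op_adjoint A \<longleftrightarrow> (\<forall>x y. (x, y) \<in> A \<longrightarrow> cinner y u = cinner x v)"
  by (auto simp: op_adjoint_def)

lemma self_adjointD:
  assumes "self_adjoint A"
  shows "linear_op A" "closure (Domain A) = UNIV"
    and "(x, y) \<in> A \<Longrightarrow> (u, v) \<in> A \<Longrightarrow> cinner y u = cinner x v"
    and "(\<And>x y. (x, y) \<in> A \<Longrightarrow> cinner y u = cinner x v) \<Longrightarrow> (u, v) \<in> A"
proof -
  have A: "linear_op A" "closure (Domain A) = UNIV" "op_adjoint A = A"
    using assms by (simp_all add: self_adjoint_def densely_defined_def)
  show "linear_op A" "closure (Domain A) = UNIV" by (rule A)+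
  show "(x, y) \<in> A \<Longrightarrow> (u, v) \<in> A \<Longrightarrow> cinner y u = cinner x v"
    using in_op_adjoint[of u v A] unfolding A(3) by blast
  show "(\<And>x y. (x, y) \<in> A \<Longrightarrow> cinner y u = cinner x v) \<Longrightarrow> (u, v) \<in> A"
    using in_op_adjoint[of u v A] unfolding A(3) by blast
qed

lemma self_adjoint_closed:
  assumes A: "self_adjoint A" and lim: "u \<longlonglongrightarrow> x" "v \<longlonglongrightarrow> y" "\<And>n. (u n, v n) \<in> A"
  shows "(x, y) \<in> A"
proof (rule self_adjointD(4)[OF A])
  fix w z assume wz: "(w, z) \<in> A"
  have "(\<lambda>n. cinner z (u n)) \<longlonglongrightarrow> cinner z x" "(\<lambda>n. cinner w (v n)) \<longlonglongrightarrow> cinner w y"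
    by (intro tendsto_intros lim)+
  moreover have "cinner z (u n) = cinner w (v n)" for n
    using self_adjointD(3)[OF A wz lim(3)] .
  ultimately show "cinner z x = cinner w y" using LIMSEQ_unique by simp
qed

lemma csubspace_closure:
  assumes "csubspace V" shows "csubspace (closure V)"
proof -
  note V = assms[unfolded csubspace_iff]
  show ?thesis
    unfolding csubspace_iff
  proof (intro conjI ballI allI)
    show "0 \<in> closure V" by (rule subsetD[OF closure_subset]) (use V in blast)
    fix x a assume "x \<in> closure V"
    then obtain u where u: "\<And>n::nat. u n \<in> V" "u \<longlonglongrightarrow> x"
      unfolding closure_sequential by blast
    have "(\<lambda>n. a *\<^sub>C u n) \<longlonglongrightarrow> a *\<^sub>C x" by (intro tendsto_intros u)
    then show "a *\<^sub>C x \<in> closure V" using V u(1) unfolding closure_sequential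
      by (intro exI[of _ "\<lambda>n. a *\<^sub>C u n"]) simp
    fix y assume "y \<in> closure V"
    then obtain v where v: "\<And>n::nat. v n \<in> V" "v \<longlonglongrightarrow> y"
      unfolding closure_sequential by blast
    have "(\<lambda>n. u n + v n) \<longlonglongrightarrow> x + y" by (intro tendsto_intros u v)
    then show "x + y \<in> closure V" using V u(1) v(1) unfolding closure_sequential
      by (intro exI[of _ "\<lambda>n. u n + v n"]) simp
  qed
qed

text \<open>
  One real \<open>t\<close> with \<open>A - t\<close> onto is enough: if \<open>(u, v)\<close> is in the graph of the adjoint, then \<open>u\<close> agrees
  with the solution \<open>f\<close> of \<open>(A - t) f = v - t u\<close> when tested against the range of \<open>A - t\<close>. Density of
  the domain is part of the conclusion and has the same reason.
\<close>

lemma symmetric_surj_self_adjoint: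
  assumes A: "linear_op A" "symmetric_op A" and surj: "\<And>h. \<exists>f. (f, h + complex_of_real t *\<^sub>C f) \<in> A"
  shows "self_adjoint A"
proof -
  have sym: "cinner y u = cinner x v" if "(x, y) \<in> A" "(u, v) \<in> A" for x y u v
    using A(2) that by (auto simp: symmetric_op_def)
  have symt: "cinner h u = cinner x k"
    if "(x, h + complex_of_real t *\<^sub>C x) \<in> A" "(u, k + complex_of_real t *\<^sub>C u) \<in> A" for x h u k
    using sym[OF that] by (simp add: cinner_simps)
  have dense: "closure (Domain A) = UNIV"
  proof (rule closed_subspace_eq_UNIV)
    have "csubspace (Domain A)"
      using linear_opD[OF A(1)] unfolding csubspace_iff by (metis Domain.simps)
    then show "csubspace (closure (Domain A))" by (rule csubspace_closure)
    fix z assume z: "\<And>v. v \<in> closure (Domain A) \<Longrightarrow> cinner v z = 0"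
    obtain h where h: "(h, z + complex_of_real t *\<^sub>C h) \<in> A" using surj by blast
    \<comment> \<open>With \<open>z = (A - t) h\<close>, orthogonality to the domain says \<open>((A - t) f, h) = 0\<close> for all \<open>f\<close>.\<close>
    have "cinner k h = 0" for k
    proof -
      obtain f where f: "(f, k + complex_of_real t *\<^sub>C f) \<in> A" using surj by blast
      have "f \<in> closure (Domain A)" by (rule subsetD[OF closure_subset]) (use f in blast)
      with z symt[OF f h] show ?thesis by simp
    qed
    from this[of h] have "h = 0" by simp
    with h have "(0, z) \<in> A" by simp
    then show "z = 0" by (rule linear_opD(5)[OF A(1) _ linear_opD(1)[OF A(1)]])
  qed simp
  have "op_adjoint A \<subseteq> A"
  proof (clarify)
    fix u v assume uv: "(u, v) \<in> op_adjoint A"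
    obtain f where f: "(f, (v - complex_of_real t *\<^sub>C u) + complex_of_real t *\<^sub>C f) \<in> A"
      using surj[of "v - complex_of_real t *\<^sub>C u"] by auto
    have "cinner k u = cinner k f" for k
    proof -
      obtain g where g: "(g, k + complex_of_real t *\<^sub>C g) \<in> A" using surj by blast
      have "cinner (k + complex_of_real t *\<^sub>C g) u = cinner g v" using uv g unfolding in_op_adjoint by blast
      with symt[OF g f] show ?thesis by (simp add: cinner_simps eq_diff_eq) (metis add_right_cancel)
    qed
    then have "u = f" by (rule cinner_ext)
    with f show "(u, v) \<in> A" by simp
  qed
  moreover have "A \<subseteq> op_adjoint A" using sym by (auto simp: in_op_adjoint)
  ultimately show ?thesis using A dense by (auto simp: self_adjoint_def densely_defined_def)
qed

subsection \<open>Resolvent set and lower bounds\<close>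

lemma resolvent_set_surj: "z \<in> resolvent_set A \<Longrightarrow> \<exists>f. (f, h + z *\<^sub>C f) \<in> A"
proof -
  assume "z \<in> resolvent_set A"
  then have "h \<in> Domain ((A -\<^sub>o scalar_op z)\<inverse>)" by (simp add: resolvent_set_def)
  then show ?thesis by (auto simp: in_diff_scalar_op)
qed

lemma resolvent_set_inj:
  assumes "z \<in> resolvent_set A" "(f, h + z *\<^sub>C f) \<in> A" "(g, h + z *\<^sub>C g) \<in> A" shows "f = g"
proof -
  have "single_valued ((A -\<^sub>o scalar_op z)\<inverse>)" using assms(1) by (simp add: resolvent_set_def)
  then show ?thesis using assms(2,3) by (auto simp: single_valued_def in_diff_scalar_op)
qed

lemma resolvent_set_bound:
  assumes "z \<in> resolvent_set A"
  obtains K where "0 < K" "\<forall>f h. (f, h + z *\<^sub>C f) \<in> A \<longrightarrow> norm f \<le> K * norm h"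
proof -
  obtain K where K: "\<forall>(x, y)\<in>(A -\<^sub>o scalar_op z)\<inverse>. norm y \<le> K * norm x"
    using assms by (auto simp: resolvent_set_def bounded_op_def)
  have "norm f \<le> max 1 K * norm h" if "(f, h + z *\<^sub>C f) \<in> A" for f h
  proof -
    have "norm f \<le> K * norm h" using K that by (auto simp: in_diff_scalar_op)
    also have "\<dots> \<le> max 1 K * norm h" by (intro mult_right_mono) auto
    finally show ?thesis .
  qed
  then show ?thesis using that[of "max 1 K"] by simp
qed

lemma resolvent_setI:
  assumes A: "linear_op A" and surj: "\<And>h. \<exists>f. (f, h + z *\<^sub>C f) \<in> A"
    and bd: "0 < d" "\<And>f h. (f, h + z *\<^sub>C f) \<in> A \<Longrightarrow> d * norm f \<le> norm h"
  shows "z \<in> resolvent_set A"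
proof -
  have "f = g" if "(f, h + z *\<^sub>C f) \<in> A" "(g, h + z *\<^sub>C g) \<in> A" for f g h
  proof -
    have "(f - g, 0 + z *\<^sub>C (f - g)) \<in> A"
      using linear_opD(3)[OF A that] by (simp add: scaleC_diff_right)
    from bd(2)[OF this] show ?thesis using bd(1) by (simp add: mult_le_0_iff)
  qed
  moreover have "norm f \<le> (1 / d) * norm h" if "(f, h + z *\<^sub>C f) \<in> A" for f h
    using bd(2)[OF that] bd(1) by (simp add: field_simps)
  then have "bounded_op ((A -\<^sub>o scalar_op z)\<inverse>)"
    unfolding bounded_op_def by (intro exI[of _ "1 / d"]) (auto simp: in_diff_scalar_op)
  moreover have "h \<in> Domain ((A -\<^sub>o scalar_op z)\<inverse>)" for h
    using surj[of h] by (auto simp: in_diff_scalar_op)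
  ultimately show ?thesis
    unfolding resolvent_set_def by (auto simp: single_valued_def in_diff_scalar_op)
qed

definition lower_bound :: "('a::complex_hilbert, 'a) op \<Rightarrow> real \<Rightarrow> bool" where
  "lower_bound A c \<longleftrightarrow> (\<forall>f g. (f, g) \<in> A \<longrightarrow> c * (norm f)\<^sup>2 \<le> Re (cinner g f))"

lemma bounded_from_below_iff: "bounded_from_below A \<longleftrightarrow> (\<exists>c. lower_bound A c)"
  by (auto simp: bounded_from_below_def lower_bound_def)

lemma lower_bound_mono: "lower_bound A c \<Longrightarrow> d \<le> c \<Longrightarrow> lower_bound A d"
  unfolding lower_bound_def by (blast intro: order_trans mult_right_mono[OF _ zero_le_power2])

text \<open>
  For self-adjoint \<open>A\<close> an estimate \<open>d |f| \<le> |(A - z) f|\<close> is enough for \<open>z \<in> \<rho>(A)\<close>: the range of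
  \<open>A - z\<close> is closed, and its orthogonal complement \<open>ker (A - z\<^sup>*)\<close> is trivial: eigenvalues of
  \<open>A\<close> are real, and for real \<open>z\<close> the estimate excludes the eigenvalue \<open>z\<close>.
\<close>

lemma self_adjoint_resolventI:
  assumes A: "self_adjoint A" and d: "0 < d"
    and bd: "\<And>f h. (f, h + z *\<^sub>C f) \<in> A \<Longrightarrow> d * norm f \<le> norm h"
  shows "z \<in> resolvent_set A"
proof -
  note lin = linear_opD[OF self_adjointD(1)[OF A]]
  define V where "V = {h. \<exists>f. (f, h + z *\<^sub>C f) \<in> A}"
  have "V = UNIV"
  proof (rule closed_subspace_eq_UNIV)
    show "csubspace V"
      unfolding csubspace_iff V_def
    proof (intro conjI ballI allI; clarsimp)
      show "\<exists>f. (f, z *\<^sub>C f) \<in> A" using lin(1) by (intro exI[of _ 0]) simp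
    next
      fix x y f g
      assume "(f, x + z *\<^sub>C f) \<in> A" "(g, y + z *\<^sub>C g) \<in> A"
      from lin(2)[OF this] show "\<exists>f. (f, x + y + z *\<^sub>C f) \<in> A"
        by (intro exI[of _ "f + g"]) (simp add: scaleC_add_right algebra_simps)
    next
      fix a x f assume "(f, x + z *\<^sub>C f) \<in> A"
      from lin(4)[OF this, of a] show "\<exists>f. (f, a *\<^sub>C x + z *\<^sub>C f) \<in> A"
        by (intro exI[of _ "a *\<^sub>C f"]) (simp add: scaleC_add_right scaleC_left_commute)
    qed
    show "closed V"
    proof (rule closed_sequential_limits[THEN iffD2], intro allI impI, elim conjE)
      fix x l assume x: "\<forall>n. x n \<in> V" and l: "x \<longlonglongrightarrow> l"
      then obtain f where f: "\<And>n. (f n, x n + z *\<^sub>C f n) \<in> A"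
        unfolding V_def mem_Collect_eq by metis
      have "Cauchy f"
      proof (rule metric_CauchyI)
        fix e :: real assume "0 < e"
        then obtain N where N: "\<forall>m\<ge>N. \<forall>n\<ge>N. dist (x m) (x n) < d * e"
          using metric_CauchyD[OF LIMSEQ_imp_Cauchy[OF l], of "d * e"] d by auto
        have "dist (f m) (f n) < e" if "m \<ge> N" "n \<ge> N" for m n
        proof -
          have "(f m - f n, (x m - x n) + z *\<^sub>C (f m - f n)) \<in> A"
            using lin(3)[OF f[of m] f[of n]] by (simp add: scaleC_diff_right algebra_simps)
          from bd[OF this] have "d * dist (f m) (f n) < d * e"
            using N that by (simp add: dist_norm) (meson le_less_trans)
          then show ?thesis using d by simp
        qed
        then show "\<exists>M. \<forall>m\<ge>M. \<forall>n\<ge>M. dist (f m) (f n) < e" by blast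
      qed
      then obtain g where g: "f \<longlonglongrightarrow> g" by (auto simp: Cauchy_convergent_iff convergent_def)
      have "(g, l + z *\<^sub>C g) \<in> A"
        by (rule self_adjoint_closed[OF A g _ f]) (intro tendsto_intros l g)
      then show "l \<in> V" by (auto simp: V_def)
    qed
    fix u assume u: "\<And>v. v \<in> V \<Longrightarrow> cinner v u = 0"
    have zu: "(u, cnj z *\<^sub>C u) \<in> A"
    proof (rule self_adjointD(4)[OF A])
      fix x y assume "(x, y) \<in> A"
      then have "y - z *\<^sub>C x \<in> V" by (auto simp: V_def intro!: exI[of _ x])
      from u[OF this] show "cinner y u = cinner x (cnj z *\<^sub>C u)" by (simp add: cinner_simps)
    qed
    from self_adjointD(3)[OF A zu zu] have "u = 0 \<or> cnj z = z" by (simp add: cinner_simps)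
    then show "u = 0"
    proof
      assume "cnj z = z"
      with zu have "(u, 0 + z *\<^sub>C u) \<in> A" by simp
      from bd[OF this] show "u = 0" using d by (simp add: mult_le_0_iff)
    qed
  qed
  then have "\<exists>f. (f, h + z *\<^sub>C f) \<in> A" for h unfolding V_def by blast
  then show ?thesis by (rule resolvent_setI[OF self_adjointD(1)[OF A] _ d bd])
qed

lemma lower_bound_below_resolvent:
  assumes A: "self_adjoint A" and c: "lower_bound A c" and t: "t < c"
  shows "complex_of_real t \<in> resolvent_set A"
proof (rule self_adjoint_resolventI[OF A])
  show "0 < c - t" using t by simp
  fix f h assume *: "(f, h + complex_of_real t *\<^sub>C f) \<in> A"
  show "(c - t) * norm f \<le> norm h"
  proof (cases "f = 0")
    case False
    have "c * (norm f)\<^sup>2 \<le> Re (cinner (h + complex_of_real t *\<^sub>C f) f)"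
      using c * by (auto simp: lower_bound_def)
    then have "(c - t) * (norm f)\<^sup>2 \<le> Re (cinner h f)"
      by (simp add: cinner_simps Re_cinner_self algebra_simps)
    also have "\<dots> \<le> norm h * norm f" using Re_cinner_bound abs_le_D1 by blast
    finally show ?thesis using False by (simp add: power2_eq_square)
  qed simp
qed

lemma resolvent_set_cnj:
  assumes A: "self_adjoint A" and z: "z \<in> resolvent_set A"
  shows "cnj z \<in> resolvent_set A"
proof -
  obtain K where K: "0 < K" "\<forall>f h. (f, h + z *\<^sub>C f) \<in> A \<longrightarrow> norm f \<le> K * norm h"
    using resolvent_set_bound[OF z] .
  show ?thesis
  proof (rule self_adjoint_resolventI[OF A])
    show "0 < 1 / K" using K(1) by simp
    fix f h assume fh: "(f, h + cnj z *\<^sub>C f) \<in> A"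
    define k where "k = h + (cnj z - z) *\<^sub>C f"
    have kz: "k + z *\<^sub>C f = h + cnj z *\<^sub>C f"
      using scaleC_add_left[of "cnj z - z" z f] by (simp add: k_def add.assoc)
    have sa: "Im (cinner h f) = Im z * (norm f)\<^sup>2"
    proof -
      have "cinner (h + cnj z *\<^sub>C f) f = cinner f (h + cnj z *\<^sub>C f)"
        by (rule self_adjointD(3)[OF A fh fh])
      also have "\<dots> = cnj (cinner (h + cnj z *\<^sub>C f) f)" by (rule cinner_commute)
      finally have "Im (cinner (h + cnj z *\<^sub>C f) f) = 0" by (simp add: complex_eq_iff)
      then show ?thesis by (simp add: cinner_simps cinner_self del: of_real_power)
    qed
    \<comment> \<open>\<open>A - z\<close> and its formal adjoint have the same norms because \<open>(A f, f)\<close> is real.\<close>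
    have "(norm k)\<^sup>2 = (norm h)\<^sup>2 + 2 * Re (cinner h ((cnj z - z) *\<^sub>C f)) + (2 * Im z)\<^sup>2 * (norm f)\<^sup>2"
    proof -
      have "(cmod (cnj z - z))\<^sup>2 = (2 * Im z)\<^sup>2" by (simp add: cmod_power2)
      then show ?thesis by (simp add: k_def norm_add_sq norm_scaleC power_mult_distrib)
    qed
    also have "\<dots> = (norm h)\<^sup>2"
      by (simp add: cinner_simps sa power2_eq_square)
    finally have "norm k = norm h" by simp
    moreover have "norm f \<le> K * norm k" using K(2) fh kz by auto
    ultimately show "1 / K * norm f \<le> norm h" using K(1) by (simp add: field_simps)
  qed
qed

text \<open>
  Let \<open>K\<close> be a bound of the resolvent at \<open>c\<close>. With \<open>f = (A - c) u\<close>, the Cauchy-Schwarz inequality for the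
  form of \<open>A - c\<close> gives \<open>|f|\<^sup>4 \<le> ((A - c) f, f) ((A - c) u, u) \<le> ((A - c) f, f) K |f|\<^sup>2\<close>, so \<open>c + 1/K\<close> is
  a lower bound.
\<close>

lemma lower_bound_improve:
  assumes A: "self_adjoint A" and c: "lower_bound A c" and r: "complex_of_real c \<in> resolvent_set A"
  obtains d where "c < d" "lower_bound A d"
proof -
  note lin = linear_opD[OF self_adjointD(1)[OF A]]
  obtain K where K: "0 < K" "\<forall>f h. (f, h + complex_of_real c *\<^sub>C f) \<in> A \<longrightarrow> norm f \<le> K * norm h"
    using resolvent_set_bound[OF r] .
  have pos: "0 \<le> Re (cinner (g - c *\<^sub>R f) f)" if "(f, g) \<in> A" for f g
    using c that by (simp add: lower_bound_def cinner_simps Re_cinner_self)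
  have "lower_bound A (c + 1 / K)"
    unfolding lower_bound_def
  proof (intro allI impI)
    fix f g assume fg: "(f, g) \<in> A"
    obtain u where u: "(u, f + complex_of_real c *\<^sub>C u) \<in> A"
      using resolvent_set_surj[OF r] by blast
    define q where "q = Re (cinner (g - c *\<^sub>R f) f)"
    have "(Re (cinner f f))\<^sup>2 \<le> q * Re (cinner f u)"
    proof (rule discriminant_nonpos)
      fix s :: real
      have "(f - complex_of_real s *\<^sub>C u,
          g - complex_of_real s *\<^sub>C (f + complex_of_real c *\<^sub>C u)) \<in> A"
        by (rule lin(3)[OF fg lin(4)[OF u]])
      then have "(f - s *\<^sub>R u, g - s *\<^sub>R (f + c *\<^sub>R u)) \<in> A" by (simp add: scaleC_of_real)
      note pos[OF this]
      moreover have "Re (cinner g u) = Re (cinner f f) + c * Re (cinner f u)"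
        using self_adjointD(3)[OF A fg u] by (simp add: cinner_simps)
      ultimately show "0 \<le> q - 2 * s * Re (cinner f f) + s\<^sup>2 * Re (cinner f u)"
        by (simp add: q_def cinner_simps scaleC_of_real Re_cinner_commute[of u f]
            power2_eq_square algebra_simps)
    qed
    also have "\<dots> \<le> q * (K * (norm f)\<^sup>2)"
    proof (rule mult_left_mono)
      have "Re (cinner f u) \<le> norm f * norm u" using Re_cinner_bound abs_le_D1 by blast
      also have "\<dots> \<le> norm f * (K * norm f)" using K(2) u by (intro mult_left_mono) auto
      finally show "Re (cinner f u) \<le> K * (norm f)\<^sup>2" by (simp add: power2_eq_square mult_ac)
      show "0 \<le> q" using pos[OF fg] by (simp add: q_def)
    qed
    finally have *: "(norm f)\<^sup>2 * (norm f)\<^sup>2 \<le> (q * K) * (norm f)\<^sup>2"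
      by (simp add: Re_cinner_self power2_eq_square mult_ac)
    have "(norm f)\<^sup>2 \<le> q * K"
    proof (cases "f = 0")
      case False
      then have "0 < (norm f)\<^sup>2" by simp
      with * show ?thesis by (rule mult_right_le_imp_le)
    qed (simp add: q_def)
    then show "(c + 1 / K) * (norm f)\<^sup>2 \<le> Re (cinner g f)"
      using K(1) by (simp add: q_def cinner_simps Re_cinner_self field_simps)
  qed
  then show ?thesis using that[of "c + 1 / K"] K(1) by simp
qed

lemma min_spectrum_imp_resolvent: "ereal t < min_spectrum A \<Longrightarrow> complex_of_real t \<in> resolvent_set A"
proof (rule ccontr)
  assume "ereal t < min_spectrum A" "complex_of_real t \<notin> resolvent_set A"
  moreover from this have "min_spectrum A \<le> ereal t"
    unfolding min_spectrum_def by (intro Inf_lower) (auto simp: spectrum_def)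
  ultimately show False by simp
qed

text \<open>
  The largest lower bound \<open>c \<le> t\<close> is a resolvent point, being below the spectrum; so it could be
  improved if it were smaller than \<open>t\<close>.
\<close>

lemma min_spectrum_imp_lower_bound:
  assumes A: "self_adjoint A" "bounded_from_below A" and t: "ereal t < min_spectrum A"
  shows "lower_bound A t"
proof -
  define C where "C = {c. lower_bound A c \<and> c \<le> t}"
  obtain c0 where c0: "lower_bound A c0" using A(2) by (auto simp: bounded_from_below_iff)
  have ne: "C \<noteq> {}" using lower_bound_mono[OF c0, of "min c0 t"] by (auto simp: C_def)
  have bdd: "bdd_above C" by (auto simp: C_def bdd_above_def)
  define c where "c = Sup C"
  have ct: "c \<le> t" unfolding c_def by (rule cSup_least[OF ne]) (simp add: C_def)
  have lb: "lower_bound A c"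
    unfolding lower_bound_def
  proof (intro allI impI)
    fix f g assume fg: "(f, g) \<in> A"
    show "c * (norm f)\<^sup>2 \<le> Re (cinner g f)"
    proof (cases "f = 0")
      case False
      have "c \<le> Re (cinner g f) / (norm f)\<^sup>2"
        unfolding c_def using fg False
        by (intro cSup_least[OF ne]) (auto simp: C_def lower_bound_def field_simps)
      then show ?thesis using False by (simp add: field_simps)
    qed simp
  qed
  have "ereal c < min_spectrum A" using ct t by (meson ereal_less_eq(3) le_less_trans)
  from lower_bound_improve[OF A(1) lb min_spectrum_imp_resolvent[OF this]]
  obtain d where d: "c < d" "lower_bound A d" .
  have "c = t"
  proof (rule ccontr)
    assume "c \<noteq> t"
    then have "min d t \<in> C" "c < min d t" using d ct lower_bound_mono[OF d(2), of "min d t"]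
      by (auto simp: C_def)
    then show False using cSup_upper[OF _ bdd, of "min d t"] unfolding c_def by linarith
  qed
  then show ?thesis using lb by simp
qed

lemma lower_bound_imp_min_spectrum:
  assumes "self_adjoint A" "lower_bound A c" shows "ereal c \<le> min_spectrum A"
  unfolding min_spectrum_def
proof (rule Inf_greatest, clarify)
  fix t assume "complex_of_real t \<in> spectrum A"
  then show "ereal c \<le> ereal t"
    using lower_bound_below_resolvent[OF assms, of t] by (force simp: spectrum_def)
qed

subsection \<open>Everywhere defined operators\<close>

definition map_op :: "('a \<Rightarrow> 'b) \<Rightarrow> ('a, 'b) op" where
  "map_op f = {(x, y). y = f x}"

lemma in_map_op [simp]: "(x, y) \<in> map_op f \<longleftrightarrow> y = f x"
  by (simp add: map_op_def)

lemma map_op_self_adjoint: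
  assumes f: "symmetric_map f" shows "self_adjoint (map_op f)"
proof -
  have "linear_op (map_op f)" by (rule linear_opI) (simp_all add: symmetric_map_linear[OF f])
  moreover have "op_adjoint (map_op f) = map_op f"
  proof (intro set_eqI, clarify)
    fix u v
    have "(u, v) \<in> op_adjoint (map_op f) \<longleftrightarrow> (\<forall>x. cinner x (f u) = cinner x v)"
      by (simp add: in_op_adjoint symmetric_mapD[OF f])
    also have "\<dots> \<longleftrightarrow> v = f u" using cinner_ext by metis
    finally show "(u, v) \<in> op_adjoint (map_op f) \<longleftrightarrow> (u, v) \<in> map_op f" by simp
  qed
  moreover have "Domain (map_op f) = UNIV" by (auto simp: map_op_def)
  ultimately show ?thesis by (simp add: self_adjoint_def densely_defined_def)
qed

lemma coercive_symmetric_map_surj: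
  assumes f: "symmetric_map f" and d: "0 < d" "\<And>x. d * (norm x)\<^sup>2 \<le> Re (cinner (f x) x)"
  shows "\<exists>x. f x = y"
proof -
  have "complex_of_real 0 \<in> resolvent_set (map_op f)"
    by (rule lower_bound_below_resolvent[OF map_op_self_adjoint[OF f] _ d(1)])
      (simp add: lower_bound_def d(2))
  from resolvent_set_surj[OF this, of y] show ?thesis by auto
qed

text \<open>
  Identifies the description in \<^const>\<open>op_sqrt\<close>. A competing root \<open>R\<close> is a priori unbounded, but \<open>R\<^sup>2\<close> is
  everywhere defined, hence so is \<open>R\<close>, and \<open>|R x|\<^sup>2 = (f x, x)\<close> makes it bounded; it commutes with
  \<open>f = R\<^sup>2\<close> and thus with \<open>r\<close>.
\<close>

lemma op_sqrt_map_op: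
  assumes f: "symmetric_map f" and nn: "\<And>x. 0 \<le> Re (cinner (f x) x)"
    and bd: "\<And>x. norm (f x) \<le> c * norm x"
  shows "\<exists>r. op_sqrt (map_op f) = map_op r \<and> symmetric_map r \<and> (\<forall>x. r (r x) = f x)"
proof -
  obtain r where r: "symmetric_map r" "\<forall>x. 0 \<le> Re (cinner (r x) x)" "\<forall>x. r (r x) = f x"
    "\<forall>g. bounded_linear g \<longrightarrow> (\<forall>x. g (f x) = f (g x)) \<longrightarrow> (\<forall>x. g (r x) = r (g x))"
    using nonneg_sqrt_exists[OF f nn bd] by blast
  have "op_sqrt (map_op f) = map_op r"
    unfolding op_sqrt_def
  proof (rule the_equality)
    show "self_adjoint (map_op r) \<and> nonneg_op (map_op r) \<and> map_op r \<circ>\<^sub>o map_op r = map_op f"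
      using map_op_self_adjoint[OF r(1)] r(2,3) by (auto simp: nonneg_op_def relcomp_unfold)
    fix R :: "('a, 'a) op"
    assume "self_adjoint R \<and> nonneg_op R \<and> R \<circ>\<^sub>o R = map_op f"
    then have R: "self_adjoint R" "nonneg_op R" "R O R = map_op f" by auto
    note lin = linear_opD[OF self_adjointD(1)[OF R(1)]]
    have "\<exists>y. (x, y) \<in> R" for x
    proof -
      have "(x, f x) \<in> R O R" using R(3) by simp
      then show ?thesis by auto
    qed
    then obtain q where q: "\<And>x. (x, q x) \<in> R" by metis
    have Rq: "R = map_op q" using q lin(5) by (auto simp: set_eq_iff)
    have qs: "symmetric_map q"
      unfolding symmetric_map_def using self_adjointD(3)[OF R(1) q q] by simp
    have qq: "q (q x) = f x" for x
    proof -
      have "(x, q (q x)) \<in> R O R" using q by blast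
      then show ?thesis using R(3) by simp
    qed
    have "norm (q x) \<le> sqrt \<bar>c\<bar> * norm x" for x
    proof (rule power2_le_imp_le)
      have "(norm (q x))\<^sup>2 = Re (cinner (f x) x)"
        using symmetric_mapD[OF qs, of "q x" x] by (simp add: Re_cinner_self[symmetric] qq)
      also have "\<dots> \<le> norm (f x) * norm x" using Re_cinner_bound abs_le_D1 by blast
      also have "\<dots> \<le> (\<bar>c\<bar> * norm x) * norm x"
        by (intro mult_right_mono order_trans[OF bd]) auto
      finally show "(norm (q x))\<^sup>2 \<le> (sqrt \<bar>c\<bar> * norm x)\<^sup>2"
        by (simp add: power_mult_distrib power2_eq_square[of "norm x"] mult.assoc)
    qed simp
    then have "bounded_linear q" by (rule bounded_linear_symmetric_map[OF qs])
    then have comm: "q (r x) = r (q x)" for x using r(4) qq by metis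
    have "q = r"
    proof (rule nonneg_sqrt_unique[OF r(1) _ qs])
      show "0 \<le> Re (cinner (r x) x)" "q (q x) = r (r x)" for x using r(2,3) qq by auto
      show "0 \<le> Re (cinner (q x) x)" for x using R(2) q[of x] by (auto simp: nonneg_op_def)
    qed (rule comm)
    then show "R = map_op r" using Rq by simp
  qed
  then show ?thesis using r(1,3) by blast
qed

subsection \<open>Bounded operators\<close>

lemma closure_graph_cases:
  fixes A :: "('a::complex_hilbert, 'b::complex_hilbert) op"
  assumes "(x, y) \<in> closure A"
  obtains u v where "\<And>n::nat. (u n, v n) \<in> A" "u \<longlonglongrightarrow> x" "v \<longlonglongrightarrow> y"
proof -
  obtain w where w: "\<And>n::nat. w n \<in> A" "w \<longlonglongrightarrow> (x, y)"
    using assms unfolding closure_sequential by blast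
  show ?thesis
    using that[of "\<lambda>n. fst (w n)" "\<lambda>n. snd (w n)"] w(1) tendsto_fst[OF w(2)] tendsto_snd[OF w(2)]
    by simp
qed

text \<open>
  Boundedness makes the closure everywhere defined. Symmetry passes to the closure, where it implies
  single-valuedness: the values at \<open>x\<close> are determined by their inner products with all vectors.
\<close>

lemma closure_symmetric_bounded:
  fixes A :: "('a::complex_hilbert, 'a) op"
  assumes A: "linear_op A" "densely_defined A" "symmetric_op A"
    and K: "\<And>x y. (x, y) \<in> A \<Longrightarrow> norm y \<le> K * norm x"
  shows "\<exists>m. closure A = map_op m \<and> symmetric_map m \<and> (\<forall>x. norm (m x) \<le> K * norm x)"
proof -
  have dense: "closure (Domain A) = UNIV" using A(2) by (simp add: densely_defined_def)
  have ex: "\<exists>y. (x, y) \<in> closure A" for x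
  proof -
    obtain u where u: "\<And>n::nat. u n \<in> Domain A" "u \<longlonglongrightarrow> x"
      by (rule dense_cases[OF dense, of x]) blast
    then obtain v where v: "\<And>n. (u n, v n) \<in> A" unfolding Domain_iff by metis
    have "Cauchy v"
    proof (rule metric_CauchyI)
      fix e :: real assume e: "0 < e"
      then obtain N where N: "\<forall>m\<ge>N. \<forall>n\<ge>N. dist (u m) (u n) < e / (\<bar>K\<bar> + 1)"
        using metric_CauchyD[OF LIMSEQ_imp_Cauchy[OF u(2)], of "e / (\<bar>K\<bar> + 1)"] by auto
      have "dist (v m) (v n) < e" if "m \<ge> N" "n \<ge> N" for m n
      proof -
        have "dist (v m) (v n) \<le> K * dist (u m) (u n)"
          using K[OF linear_opD(3)[OF A(1) v[of m] v[of n]]] by (simp add: dist_norm)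
        also have "\<dots> \<le> (\<bar>K\<bar> + 1) * dist (u m) (u n)" by (intro mult_right_mono) auto
        also have "\<dots> < (\<bar>K\<bar> + 1) * (e / (\<bar>K\<bar> + 1))"
          using N that by (intro mult_strict_left_mono) auto
        finally show ?thesis by simp
      qed
      then show "\<exists>M. \<forall>m\<ge>M. \<forall>n\<ge>M. dist (v m) (v n) < e" by blast
    qed
    then obtain y where y: "v \<longlonglongrightarrow> y" by (auto simp: Cauchy_convergent_iff convergent_def)
    have "(\<lambda>n. (u n, v n)) \<longlonglongrightarrow> (x, y)" by (intro tendsto_Pair u y)
    then have "(x, y) \<in> closure A"
      using v unfolding closure_sequential by (intro exI[of _ "\<lambda>n. (u n, v n)"]) simp
    then show ?thesis ..
  qed
  have sym: "cinner y x' = cinner x y'" if "(x, y) \<in> closure A" "(x', y') \<in> closure A" for x y x' y'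
  proof -
    obtain u v where uv: "\<And>n::nat. (u n, v n) \<in> A" "u \<longlonglongrightarrow> x" "v \<longlonglongrightarrow> y"
      by (rule closure_graph_cases[OF \<open>(x, y) \<in> closure A\<close>]) blast
    obtain u' v' where uv': "\<And>n::nat. (u' n, v' n) \<in> A" "u' \<longlonglongrightarrow> x'" "v' \<longlonglongrightarrow> y'"
      by (rule closure_graph_cases[OF \<open>(x', y') \<in> closure A\<close>]) blast
    have "(\<lambda>n. cinner (v n) (u' n)) \<longlonglongrightarrow> cinner y x'" "(\<lambda>n. cinner (u n) (v' n)) \<longlonglongrightarrow> cinner x y'"
      by (intro tendsto_intros uv uv')+
    moreover have "cinner (v n) (u' n) = cinner (u n) (v' n)" for n
      using A(3) uv(1)[of n] uv'(1)[of n] by (auto simp: symmetric_op_def)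
    ultimately show ?thesis using LIMSEQ_unique by simp
  qed
  have bound: "norm y \<le> K * norm x" if xy: "(x, y) \<in> closure A" for x y
  proof -
    obtain u v where uv: "\<And>n::nat. (u n, v n) \<in> A" "u \<longlonglongrightarrow> x" "v \<longlonglongrightarrow> y"
      by (rule closure_graph_cases[OF xy]) blast
    show ?thesis
    proof (rule LIMSEQ_le)
      show "(\<lambda>n. norm (v n)) \<longlonglongrightarrow> norm y" "(\<lambda>n. K * norm (u n)) \<longlonglongrightarrow> K * norm x"
        by (intro tendsto_intros uv)+
    qed (use K uv(1) in blast)
  qed
  obtain m where m: "\<And>x. (x, m x) \<in> closure A" using ex by metis
  have "y = m x" if "(x, y) \<in> closure A" for x y
  proof (rule cinner_ext_left)
    fix z show "cinner y z = cinner (m x) z" using sym[OF that m] sym[OF m m] by simp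
  qed
  then have "closure A = map_op m" using m by auto
  moreover have "symmetric_map m" unfolding symmetric_map_def using sym[OF m m] by simp
  ultimately show ?thesis using bound[OF m] by blast
qed

text \<open>
  For a bounded operator the supremum in \<^const>\<open>op_norm\<close> is taken over a set that is bounded above,
  so it is a genuine bound.
\<close>

lemma op_norm_upper:
  assumes "bounded_op A" "(x, y) \<in> A" shows "norm y / norm x \<le> op_norm A"
proof -
  obtain K where K: "\<forall>(x, y)\<in>A. norm y \<le> K * norm x" using assms(1) by (auto simp: bounded_op_def)
  have "norm y / norm x \<le> \<bar>K\<bar>" if "(x, y) \<in> A" for x y
  proof (cases "x = 0")
    case False
    have "norm y \<le> K * norm x" using K that by auto
    also have "\<dots> \<le> \<bar>K\<bar> * norm x" by (intro mult_right_mono) auto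
    finally show ?thesis using False by (simp add: field_simps)
  qed simp
  then have "bdd_above ((\<lambda>(x, y). norm y / norm x) ` A)"
    unfolding bdd_above_def by (intro exI[of _ "\<bar>K\<bar>"]) auto
  from cSUP_upper[OF assms(2) this] show ?thesis by (simp add: op_norm_def)
qed

lemma op_norm_bound:
  assumes "bounded_op A" "(x, y) \<in> A" shows "norm y \<le> op_norm A * norm x"
proof (cases "x = 0")
  case True
  then show ?thesis using assms by (auto simp: bounded_op_def)
next
  case False
  then show ?thesis using op_norm_upper[OF assms] by (simp add: field_simps)
qed

lemma op_norm_nonneg: "bounded_op A \<Longrightarrow> (0, 0) \<in> A \<Longrightarrow> 0 \<le> op_norm A"
  using op_norm_upper[of A 0 0] by simp

section \<open>Quasi boundary triples\<close>

lemma in_op_restrict: "(f, f') \<in> op_restrict T P \<longleftrightarrow> (f, f') \<in> T \<and> P f"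
  by (simp add: op_restrict_def)

lemma in_gamma_field: "(\<phi>, g) \<in> gamma_field T \<Gamma>\<^sub>0 z \<longleftrightarrow> (g, z *\<^sub>C g) \<in> T \<and> \<phi> = \<Gamma>\<^sub>0 g"
  by (auto simp: gamma_field_def op_ker_def in_diff_scalar_op)

lemma in_weyl_function:
  "(\<phi>, \<psi>) \<in> weyl_function T \<Gamma>\<^sub>0 \<Gamma>\<^sub>1 z \<longleftrightarrow> (\<exists>g. (g, z *\<^sub>C g) \<in> T \<and> \<phi> = \<Gamma>\<^sub>0 g \<and> \<psi> = \<Gamma>\<^sub>1 g)"
  by (auto simp: weyl_function_def in_gamma_field relcomp_unfold Domain_iff)

lemma in_bc_extension:
  "(f, f') \<in> bc_extension T \<Gamma>\<^sub>0 \<Gamma>\<^sub>1 B \<longleftrightarrow> (f, f') \<in> T \<and> (\<Gamma>\<^sub>1 f, \<Gamma>\<^sub>0 f) \<in> B"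
  by (simp add: bc_extension_def in_op_restrict)

locale quasi_boundary =
  fixes S T :: "('h::complex_hilbert, 'h) op" and \<Gamma>\<^sub>0 \<Gamma>\<^sub>1 :: "'h \<Rightarrow> 'g::complex_hilbert"
  assumes triple: "quasi_boundary_triple S T \<Gamma>\<^sub>0 \<Gamma>\<^sub>1"
begin

abbreviation A\<^sub>0 :: "('h, 'h) op" where "A\<^sub>0 \<equiv> op_restrict T (\<lambda>f. \<Gamma>\<^sub>0 f = 0)"

abbreviation \<gamma> :: "complex \<Rightarrow> ('g, 'h) op" where "\<gamma> \<equiv> gamma_field T \<Gamma>\<^sub>0"

abbreviation M :: "complex \<Rightarrow> ('g, 'g) op" where "M \<equiv> weyl_function T \<Gamma>\<^sub>0 \<Gamma>\<^sub>1"

lemma in_A0: "(f, f') \<in> A\<^sub>0 \<longleftrightarrow> (f, f') \<in> T \<and> \<Gamma>\<^sub>0 f = 0"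
  by (rule in_op_restrict)

lemma T_linear: "linear_op T" and A0_self_adjoint: "self_adjoint A\<^sub>0"
  and T_subset: "T \<subseteq> op_adjoint S"
  using triple by (simp_all add: quasi_boundary_triple_def)

lemmas T_lin = linear_opD[OF T_linear]

lemma green:
  assumes "(f, f') \<in> T" "(g, g') \<in> T"
  shows "cinner f' g - cinner f g' = cinner (\<Gamma>\<^sub>1 f) (\<Gamma>\<^sub>0 g) - cinner (\<Gamma>\<^sub>0 f) (\<Gamma>\<^sub>1 g)"
  using triple assms unfolding quasi_boundary_triple_def by fast

lemma boundary_linear:
  assumes "(f, f') \<in> T"
  shows "\<Gamma>\<^sub>0 (a *\<^sub>C f) = a *\<^sub>C \<Gamma>\<^sub>0 f" "\<Gamma>\<^sub>1 (a *\<^sub>C f) = a *\<^sub>C \<Gamma>\<^sub>1 f"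
    and "(g, g') \<in> T \<Longrightarrow> \<Gamma>\<^sub>0 (f + g) = \<Gamma>\<^sub>0 f + \<Gamma>\<^sub>0 g" "(g, g') \<in> T \<Longrightarrow> \<Gamma>\<^sub>1 (f + g) = \<Gamma>\<^sub>1 f + \<Gamma>\<^sub>1 g"
    and "(g, g') \<in> T \<Longrightarrow> \<Gamma>\<^sub>0 (f - g) = \<Gamma>\<^sub>0 f - \<Gamma>\<^sub>0 g" "(g, g') \<in> T \<Longrightarrow> \<Gamma>\<^sub>1 (f - g) = \<Gamma>\<^sub>1 f - \<Gamma>\<^sub>1 g"
proof -
  have lin: "clinear_on (Domain T) \<Gamma>\<^sub>0" "clinear_on (Domain T) \<Gamma>\<^sub>1"
    using triple by (simp_all add: quasi_boundary_triple_def)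
  have sc: "\<Gamma>\<^sub>0 (a *\<^sub>C h) = a *\<^sub>C \<Gamma>\<^sub>0 h" "\<Gamma>\<^sub>1 (a *\<^sub>C h) = a *\<^sub>C \<Gamma>\<^sub>1 h" if "(h, h') \<in> T" for a h h'
    using lin DomainI[OF that] by (simp_all add: clinear_on_def)
  then show "\<Gamma>\<^sub>0 (a *\<^sub>C f) = a *\<^sub>C \<Gamma>\<^sub>0 f" "\<Gamma>\<^sub>1 (a *\<^sub>C f) = a *\<^sub>C \<Gamma>\<^sub>1 f" using assms by blast+
  have add: "\<Gamma>\<^sub>0 (f + h) = \<Gamma>\<^sub>0 f + \<Gamma>\<^sub>0 h" "\<Gamma>\<^sub>1 (f + h) = \<Gamma>\<^sub>1 f + \<Gamma>\<^sub>1 h" if "(h, h') \<in> T" for h h'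
    using lin DomainI[OF assms] DomainI[OF that] by (simp_all add: clinear_on_def)
  then show "(g, g') \<in> T \<Longrightarrow> \<Gamma>\<^sub>0 (f + g) = \<Gamma>\<^sub>0 f + \<Gamma>\<^sub>0 g" "(g, g') \<in> T \<Longrightarrow> \<Gamma>\<^sub>1 (f + g) = \<Gamma>\<^sub>1 f + \<Gamma>\<^sub>1 g"
    by blast+
  show "\<Gamma>\<^sub>0 (f - g) = \<Gamma>\<^sub>0 f - \<Gamma>\<^sub>0 g" "\<Gamma>\<^sub>1 (f - g) = \<Gamma>\<^sub>1 f - \<Gamma>\<^sub>1 g" if g: "(g, g') \<in> T"
    using add[OF T_lin(4)[OF g, of "-1"]] sc[OF g, of "-1"] by (simp_all add: scaleC_minus_one)
qed

lemma boundary_zero: "\<Gamma>\<^sub>0 0 = 0" "\<Gamma>\<^sub>1 0 = 0"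
  using boundary_linear(1,2)[OF T_lin(1), of 0] by simp_all

text \<open>
  Project pairs of boundary values that approximate \<open>(x, 0)\<close> to the first component.
\<close>

lemma range_G0_dense: "closure (\<Gamma>\<^sub>0 ` Domain T) = UNIV"
proof -
  have "x \<in> closure (\<Gamma>\<^sub>0 ` Domain T)" for x
  proof -
    have "closure ((\<lambda>f. (\<Gamma>\<^sub>0 f, \<Gamma>\<^sub>1 f)) ` Domain T) = UNIV"
      using triple by (simp add: quasi_boundary_triple_def)
    then obtain w where w: "\<And>n::nat. w n \<in> (\<lambda>f. (\<Gamma>\<^sub>0 f, \<Gamma>\<^sub>1 f)) ` Domain T" "w \<longlonglongrightarrow> (x, 0)"
      by (rule dense_cases[of _ "(x, 0)"]) blast
    have "(\<lambda>n. fst (w n)) \<longlonglongrightarrow> x" using tendsto_fst[OF w(2)] by simp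
    moreover have "fst (w n) \<in> \<Gamma>\<^sub>0 ` Domain T" for n using w(1)[of n] by auto
    ultimately show ?thesis
      unfolding closure_sequential by (intro exI[of _ "\<lambda>n. fst (w n)"]) simp
  qed
  then show ?thesis by auto
qed

text \<open>
  The decomposition \<open>dom T = ker \<Gamma>\<^sub>0 + ker (T - z)\<close>, with \<open>f0 = (A\<^sub>0 - z)\<^sup>-\<^sup>1 (T - z) f\<close>.
\<close>

lemma decompose:
  assumes z: "z \<in> resolvent_set A\<^sub>0" and f: "(f, f') \<in> T"
  obtains f0 g where "f = f0 + g" "(f0, (f' - z *\<^sub>C f) + z *\<^sub>C f0) \<in> A\<^sub>0" "(g, z *\<^sub>C g) \<in> T"
    "\<Gamma>\<^sub>0 g = \<Gamma>\<^sub>0 f"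
proof -
  obtain f0 where f0: "(f0, (f' - z *\<^sub>C f) + z *\<^sub>C f0) \<in> A\<^sub>0" using resolvent_set_surj[OF z] by blast
  then have f0': "(f0, (f' - z *\<^sub>C f) + z *\<^sub>C f0) \<in> T" "\<Gamma>\<^sub>0 f0 = 0" by (simp_all add: in_A0)
  show ?thesis
  proof (rule that)
    show "f = f0 + (f - f0)" by simp
    show "(f - f0, z *\<^sub>C (f - f0)) \<in> T"
      using T_lin(3)[OF f f0'(1)] by (simp add: scaleC_diff_right algebra_simps)
    show "\<Gamma>\<^sub>0 (f - f0) = \<Gamma>\<^sub>0 f" using boundary_linear(5)[OF f f0'(1)] f0'(2) by simp
  qed (rule f0)
qed

lemma gamma_exists:
  assumes "z \<in> resolvent_set A\<^sub>0" "\<phi> \<in> \<Gamma>\<^sub>0 ` Domain T"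
  obtains g where "(g, z *\<^sub>C g) \<in> T" "\<Gamma>\<^sub>0 g = \<phi>"
  using assms decompose by (metis DomainE imageE)

lemma kernel_unique:
  assumes z: "z \<in> resolvent_set A\<^sub>0" and "(g, z *\<^sub>C g) \<in> T" "(h, z *\<^sub>C h) \<in> T" "\<Gamma>\<^sub>0 g = \<Gamma>\<^sub>0 h"
  shows "g = h"
proof -
  have "(g - h, 0 + z *\<^sub>C (g - h)) \<in> A\<^sub>0" "(0, 0 + z *\<^sub>C 0) \<in> A\<^sub>0"
    using T_lin(3)[OF assms(2,3)] boundary_linear(5)[OF assms(2,3)] assms(4) T_lin(1)
    by (simp_all add: in_A0 scaleC_diff_right boundary_zero)
  from resolvent_set_inj[OF z this] show ?thesis by simp
qed

text \<open>
  Green's identity for \<open>f\<close> and an element \<open>g\<close> of \<open>ker (T - z\<^sup>*)\<close> gives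
  \<open>\<gamma>(z\<^sup>*)\<^sup>* = \<Gamma>\<^sub>1 (A\<^sub>0 - z)\<^sup>-\<^sup>1\<close>, since \<open>\<Gamma>\<^sub>0 f = 0\<close>.
\<close>

lemma gamma_adjoint:
  assumes "(f, h + z *\<^sub>C f) \<in> A\<^sub>0"
  shows "(h, \<Gamma>\<^sub>1 f) \<in> op_adjoint (\<gamma> (cnj z))"
  unfolding in_op_adjoint in_gamma_field
proof (intro allI impI, elim conjE)
  fix \<phi> g assume g: "(g, cnj z *\<^sub>C g) \<in> T" and \<phi>: "\<phi> = \<Gamma>\<^sub>0 g"
  have f: "(f, h + z *\<^sub>C f) \<in> T" "\<Gamma>\<^sub>0 f = 0" using assms by (simp_all add: in_A0)
  from green[OF g f(1)] show "cinner g h = cinner \<phi> (\<Gamma>\<^sub>1 f)"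
    by (simp add: \<phi> f(2) cinner_simps)
qed

lemma gamma_adjoint_unique:
  assumes z: "z \<in> resolvent_set A\<^sub>0" and "(h, u) \<in> op_adjoint (\<gamma> z)" "(h, v) \<in> op_adjoint (\<gamma> z)"
  shows "u = v"
proof (rule dense_ext[OF range_G0_dense])
  fix \<phi> assume "\<phi> \<in> \<Gamma>\<^sub>0 ` Domain T"
  then obtain g where g: "(g, z *\<^sub>C g) \<in> T" "\<Gamma>\<^sub>0 g = \<phi>" by (rule gamma_exists[OF z])
  then have "(\<phi>, g) \<in> \<gamma> z" by (simp add: in_gamma_field)
  then show "cinner \<phi> u = cinner \<phi> v" using assms(2,3) unfolding in_op_adjoint by metis
qed

text \<open>
  The adjoint of \<open>\<gamma>(z)\<close> is everywhere defined, so the vectors \<open>\<gamma>(z) \<phi>\<close> with \<open>|\<phi>| \<le> 1\<close> are weakly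
  bounded, hence bounded.
\<close>

lemma gamma_bounded:
  assumes z: "z \<in> resolvent_set A\<^sub>0"
  obtains K where "0 \<le> K" "\<forall>g. (g, z *\<^sub>C g) \<in> T \<longrightarrow> norm g \<le> K * norm (\<Gamma>\<^sub>0 g)"
proof -
  define U where "U = {g. (g, z *\<^sub>C g) \<in> T \<and> norm (\<Gamma>\<^sub>0 g) \<le> 1}"
  have cz: "cnj z \<in> resolvent_set A\<^sub>0" by (rule resolvent_set_cnj[OF A0_self_adjoint z])
  have "\<exists>K. \<forall>g\<in>U. Re (cinner g h) \<le> K" for h
  proof -
    obtain f where f: "(f, h + cnj z *\<^sub>C f) \<in> A\<^sub>0" using resolvent_set_surj[OF cz] by blast
    have "Re (cinner g h) \<le> norm (\<Gamma>\<^sub>1 f)" if "g \<in> U" for g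
    proof -
      have g: "(\<Gamma>\<^sub>0 g, g) \<in> \<gamma> z" "norm (\<Gamma>\<^sub>0 g) \<le> 1" using that by (simp_all add: U_def in_gamma_field)
      have "cinner g h = cinner (\<Gamma>\<^sub>0 g) (\<Gamma>\<^sub>1 f)"
        using gamma_adjoint[OF f] g(1) unfolding in_op_adjoint by simp
      then have "Re (cinner g h) \<le> norm (\<Gamma>\<^sub>0 g) * norm (\<Gamma>\<^sub>1 f)" using Re_cinner_bound abs_le_D1 by metis
      also have "\<dots> \<le> 1 * norm (\<Gamma>\<^sub>1 f)" using g(2) by (intro mult_right_mono) auto
      finally show ?thesis by simp
    qed
    then show ?thesis by blast
  qed
  then obtain K where K: "\<forall>g\<in>U. norm g \<le> K" using weakly_bounded_imp_bounded[of U] by blast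
  have "norm g \<le> \<bar>K\<bar> * norm (\<Gamma>\<^sub>0 g)" if g: "(g, z *\<^sub>C g) \<in> T" for g
  proof (cases "\<Gamma>\<^sub>0 g = 0")
    case True
    have "g = 0" by (rule kernel_unique[OF z g]) (simp_all add: True boundary_zero T_lin(1))
    then show ?thesis by simp
  next
    case False
    define c where "c = complex_of_real (1 / norm (\<Gamma>\<^sub>0 g))"
    have "c *\<^sub>C g \<in> U"
      using T_lin(4)[OF g, of c] boundary_linear(1)[OF g, of c] False
      by (simp add: U_def norm_scaleC c_def norm_divide scaleC_left_commute[of z])
    then have "norm (c *\<^sub>C g) \<le> \<bar>K\<bar>" using K by force
    then show ?thesis using False by (simp add: norm_scaleC c_def norm_divide field_simps)
  qed
  then show ?thesis using that[of "\<bar>K\<bar>"] by simp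
qed

text \<open>
  Green's identity expresses \<open>(M(z) \<phi>, \<psi>)\<close> through \<open>(\<phi>, M(w) \<psi>)\<close> and \<open>(\<gamma>(z) \<phi>, \<gamma>(w) \<psi>)\<close>, so
  boundedness of the Weyl function propagates from \<open>w\<close> to \<open>z\<close>.
\<close>

lemma weyl_bounded:
  assumes z: "z \<in> resolvent_set A\<^sub>0" and w: "w \<in> resolvent_set A\<^sub>0" "bounded_op (M w)"
  shows "\<exists>K. 0 \<le> K \<and> (\<forall>g. (g, z *\<^sub>C g) \<in> T \<longrightarrow> norm (\<Gamma>\<^sub>1 g) \<le> K * norm (\<Gamma>\<^sub>0 g))"
proof -
  obtain K1 where K1: "0 \<le> K1" "\<forall>g. (g, z *\<^sub>C g) \<in> T \<longrightarrow> norm g \<le> K1 * norm (\<Gamma>\<^sub>0 g)"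
    using gamma_bounded[OF z] .
  obtain K2 where K2: "0 \<le> K2" "\<forall>g. (g, w *\<^sub>C g) \<in> T \<longrightarrow> norm g \<le> K2 * norm (\<Gamma>\<^sub>0 g)"
    using gamma_bounded[OF w(1)] .
  obtain K3 where K3: "\<forall>(x, y)\<in>M w. norm y \<le> K3 * norm x" using w(2) by (auto simp: bounded_op_def)
  define K where "K = cmod (z - cnj w) * K1 * K2 + \<bar>K3\<bar>"
  have K0: "0 \<le> K" using K1(1) K2(1) by (simp add: K_def)
  have "norm (\<Gamma>\<^sub>1 g) \<le> K * norm (\<Gamma>\<^sub>0 g)" if g: "(g, z *\<^sub>C g) \<in> T" for g
  proof (rule norm_le_dense[OF range_G0_dense])
    fix \<psi> assume "\<psi> \<in> \<Gamma>\<^sub>0 ` Domain T"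
    then obtain h where h: "(h, w *\<^sub>C h) \<in> T" "\<Gamma>\<^sub>0 h = \<psi>" by (rule gamma_exists[OF w(1)])
    have "(\<psi>, \<Gamma>\<^sub>1 h) \<in> M w" using h by (auto simp: in_weyl_function)
    then have "norm (\<Gamma>\<^sub>1 h) \<le> K3 * norm \<psi>" using K3 by auto
    also have "\<dots> \<le> \<bar>K3\<bar> * norm \<psi>" by (intro mult_right_mono) auto
    finally have 3: "norm (\<Gamma>\<^sub>1 h) \<le> \<bar>K3\<bar> * norm \<psi>" .
    have "cinner (\<Gamma>\<^sub>1 g) \<psi> = (z - cnj w) * cinner g h + cinner (\<Gamma>\<^sub>0 g) (\<Gamma>\<^sub>1 h)"
      using green[OF g h(1)] by (simp add: h(2) cinner_simps algebra_simps)
    then have "Re (cinner (\<Gamma>\<^sub>1 g) \<psi>) \<le> cmod ((z - cnj w) * cinner g h + cinner (\<Gamma>\<^sub>0 g) (\<Gamma>\<^sub>1 h))"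
      using complex_Re_le_cmod by metis
    also have "\<dots> \<le> cmod (z - cnj w) * cmod (cinner g h) + cmod (cinner (\<Gamma>\<^sub>0 g) (\<Gamma>\<^sub>1 h))"
      using norm_triangle_ineq[of "(z - cnj w) * cinner g h" "cinner (\<Gamma>\<^sub>0 g) (\<Gamma>\<^sub>1 h)"]
      by (simp add: norm_mult)
    also have "\<dots> \<le> cmod (z - cnj w) * ((K1 * norm (\<Gamma>\<^sub>0 g)) * (K2 * norm \<psi>))
        + norm (\<Gamma>\<^sub>0 g) * (\<bar>K3\<bar> * norm \<psi>)"
    proof (intro add_mono mult_left_mono norm_ge_zero)
      have "cmod (cinner g h) \<le> norm g * norm h" by (rule norm_cinner_le)
      also have "\<dots> \<le> (K1 * norm (\<Gamma>\<^sub>0 g)) * (K2 * norm \<psi>)"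
        using K1 K2 g h by (intro mult_mono) auto
      finally show "cmod (cinner g h) \<le> (K1 * norm (\<Gamma>\<^sub>0 g)) * (K2 * norm \<psi>)" .
      have "cmod (cinner (\<Gamma>\<^sub>0 g) (\<Gamma>\<^sub>1 h)) \<le> norm (\<Gamma>\<^sub>0 g) * norm (\<Gamma>\<^sub>1 h)" by (rule norm_cinner_le)
      also have "\<dots> \<le> norm (\<Gamma>\<^sub>0 g) * (\<bar>K3\<bar> * norm \<psi>)" by (intro mult_left_mono 3) auto
      finally show "cmod (cinner (\<Gamma>\<^sub>0 g) (\<Gamma>\<^sub>1 h)) \<le> norm (\<Gamma>\<^sub>0 g) * (\<bar>K3\<bar> * norm \<psi>)" .
    qed
    also have "\<dots> = (K * norm (\<Gamma>\<^sub>0 g)) * norm \<psi>" by (simp add: K_def algebra_simps)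
    finally show "Re (cinner (\<Gamma>\<^sub>1 g) \<psi>) \<le> (K * norm (\<Gamma>\<^sub>0 g)) * norm \<psi>" .
  qed (use K0 in simp)
  then show ?thesis using K0 by blast
qed

text \<open>
  At real points the Weyl function is symmetric, by Green's identity on \<open>ker (T - t)\<close>. So the closure is
  an everywhere defined symmetric map \<open>m\<close>, which represents \<open>M(t)\<close> from here on.
\<close>

lemma weyl_closure:
  assumes t: "complex_of_real t \<in> resolvent_set A\<^sub>0" and w: "w \<in> resolvent_set A\<^sub>0" "bounded_op (M w)"
  obtains m where "closure (M t) = map_op m" "symmetric_map m"
    "\<forall>x. norm (m x) \<le> op_norm (closure (M t)) * norm x" "0 \<le> op_norm (closure (M t))"
    "\<forall>g. (g, complex_of_real t *\<^sub>C g) \<in> T \<longrightarrow> \<Gamma>\<^sub>1 g = m (\<Gamma>\<^sub>0 g)"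
proof -
  obtain K where K: "\<forall>g. (g, complex_of_real t *\<^sub>C g) \<in> T \<longrightarrow> norm (\<Gamma>\<^sub>1 g) \<le> K * norm (\<Gamma>\<^sub>0 g)"
    using weyl_bounded[OF t w] by blast
  have lin: "linear_op (M t)"
  proof (rule linear_opI)
    show "(0, 0) \<in> M t" unfolding in_weyl_function
      by (rule exI[of _ 0]) (simp add: boundary_zero T_lin(1))
  next
    fix x y x' y' assume "(x, y) \<in> M t" "(x', y') \<in> M t"
    then obtain g g' where g: "(g, complex_of_real t *\<^sub>C g) \<in> T" "x = \<Gamma>\<^sub>0 g" "y = \<Gamma>\<^sub>1 g"
      "(g', complex_of_real t *\<^sub>C g') \<in> T" "x' = \<Gamma>\<^sub>0 g'" "y' = \<Gamma>\<^sub>1 g'" by (auto simp: in_weyl_function)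
    show "(x + x', y + y') \<in> M t" unfolding in_weyl_function
      by (rule exI[of _ "g + g'"])
        (use T_lin(2)[OF g(1,4)] boundary_linear(3,4)[OF g(1,4)] g in \<open>simp add: scaleC_add_right\<close>)
  next
    fix a x y assume "(x, y) \<in> M t"
    then obtain g where g: "(g, complex_of_real t *\<^sub>C g) \<in> T" "x = \<Gamma>\<^sub>0 g" "y = \<Gamma>\<^sub>1 g"
      by (auto simp: in_weyl_function)
    show "(a *\<^sub>C x, a *\<^sub>C y) \<in> M t" unfolding in_weyl_function
      by (rule exI[of _ "a *\<^sub>C g"])
        (use T_lin(4)[OF g(1), of a] boundary_linear(1,2)[OF g(1), of a] g
          in \<open>simp add: scaleC_left_commute[of "complex_of_real t"]\<close>)
  next
    fix x y z assume "(x, y) \<in> M t" "(x, z) \<in> M t"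
    then show "y = z" using kernel_unique[OF t] by (auto simp: in_weyl_function)
  qed
  have "Domain (M t) = \<Gamma>\<^sub>0 ` Domain T"
  proof
    show "Domain (M t) \<subseteq> \<Gamma>\<^sub>0 ` Domain T" unfolding Domain_iff subset_iff in_weyl_function by blast
    show "\<Gamma>\<^sub>0 ` Domain T \<subseteq> Domain (M t)"
    proof
      fix \<phi> assume "\<phi> \<in> \<Gamma>\<^sub>0 ` Domain T"
      then obtain g where "(g, complex_of_real t *\<^sub>C g) \<in> T" "\<Gamma>\<^sub>0 g = \<phi>" by (rule gamma_exists[OF t])
      then show "\<phi> \<in> Domain (M t)" unfolding Domain_iff in_weyl_function by blast
    qed
  qed
  then have dense: "densely_defined (M t)" by (simp add: densely_defined_def range_G0_dense)
  have sym: "symmetric_op (M t)"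
    unfolding symmetric_op_def
  proof (clarsimp simp: in_weyl_function)
    fix g h assume g: "(g, complex_of_real t *\<^sub>C g) \<in> T" and h: "(h, complex_of_real t *\<^sub>C h) \<in> T"
    from green[OF this] show "cinner (\<Gamma>\<^sub>1 g) (\<Gamma>\<^sub>0 h) = cinner (\<Gamma>\<^sub>0 g) (\<Gamma>\<^sub>1 h)"
      by (simp add: cinner_simps)
  qed
  obtain m where m: "closure (M t) = map_op m" "symmetric_map m" "\<forall>x. norm (m x) \<le> K * norm x"
    using closure_symmetric_bounded[OF lin dense sym, of K] K by (auto simp: in_weyl_function)
  have bd: "bounded_op (closure (M t))"
    unfolding bounded_op_def m(1) using m(3) by (intro exI[of _ K]) auto
  show ?thesis
  proof (rule that[OF m(1,2)])
    show "\<forall>x. norm (m x) \<le> op_norm (closure (M t)) * norm x"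
      using op_norm_bound[OF bd] m(1) by simp
    show "0 \<le> op_norm (closure (M t))"
      by (rule op_norm_nonneg[OF bd]) (simp add: m(1) symmetric_map_linear[OF m(2)])
    show "\<forall>g. (g, complex_of_real t *\<^sub>C g) \<in> T \<longrightarrow> \<Gamma>\<^sub>1 g = m (\<Gamma>\<^sub>0 g)"
    proof (intro allI impI)
      fix g assume "(g, complex_of_real t *\<^sub>C g) \<in> T"
      then have "(\<Gamma>\<^sub>0 g, \<Gamma>\<^sub>1 g) \<in> M t" by (auto simp: in_weyl_function)
      then have "(\<Gamma>\<^sub>0 g, \<Gamma>\<^sub>1 g) \<in> closure (M t)" by (rule subsetD[OF closure_subset])
      then show "\<Gamma>\<^sub>1 g = m (\<Gamma>\<^sub>0 g)" by (simp add: m(1))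
    qed
  qed
qed

end

lemma op_addI: "(x, y) \<in> A \<Longrightarrow> (x, z) \<in> B \<Longrightarrow> (x, y + z) \<in> A +\<^sub>o B"
  by (auto simp: op_add_def)

section \<open>The quadratic form of a quasi boundary triple\<close>

context quasi_boundary begin

text \<open>
  The form \<open>q\<^sub>l(f) = (T f, f) + (\<Gamma>\<^sub>0 f, \<Gamma>\<^sub>1 f) - l |f|\<^sup>2\<close> on \<open>dom T\<close> extends the form of \<open>A\<^sub>0 - l\<close>, and it stays
  nonnegative. For \<open>t < l\<close> let \<open>g \<in> ker (T - t)\<close> have the boundary value \<open>\<Gamma>\<^sub>0 g = \<Gamma>\<^sub>0 f\<close>, so that
  \<open>f - g \<in> dom A\<^sub>0\<close>. Expanding \<open>((A\<^sub>0 - l) (f - g), f - g) \<ge> 0\<close> with Green's identity yields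
  \<open>q\<^sub>l(f) \<ge> (M(t) \<Gamma>\<^sub>0 f, \<Gamma>\<^sub>0 f) + 2 Re ((T - l) f, g) + (l - t) |g|\<^sup>2\<close>, where the last two terms are at least
  \<open>- |(T - l) f|\<^sup>2 / (l - t)\<close>. This bound tends to \<open>0\<close> as \<open>t \<rightarrow> -\<infinity>\<close> because \<open>M(t)\<close> does.
\<close>

lemma form_nonneg:
  assumes w: "w \<in> resolvent_set A\<^sub>0" "bounded_op (M w)"
    and decay: "((\<lambda>t::real. op_norm (closure (M t))) \<longlongrightarrow> 0) at_bot"
    and l: "lower_bound A\<^sub>0 l" and f: "(f, f') \<in> T"
  shows "l * (norm f)\<^sup>2 \<le> Re (cinner f' f) + Re (cinner (\<Gamma>\<^sub>0 f) (\<Gamma>\<^sub>1 f))"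
proof -
  define q where "q = Re (cinner f' f) + Re (cinner (\<Gamma>\<^sub>0 f) (\<Gamma>\<^sub>1 f)) - l * (norm f)\<^sup>2"
  define N where "N = (norm (f' - l *\<^sub>R f))\<^sup>2"
  have est: "- op_norm (closure (M t)) * (norm (\<Gamma>\<^sub>0 f))\<^sup>2 - N / (l - t) \<le> q" if t: "t < l" for t
  proof -
    have rt: "complex_of_real t \<in> resolvent_set A\<^sub>0"
      by (rule lower_bound_below_resolvent[OF A0_self_adjoint l t])
    obtain m where m: "closure (M t) = map_op m" "symmetric_map m"
      "\<forall>x. norm (m x) \<le> op_norm (closure (M t)) * norm x" "0 \<le> op_norm (closure (M t))"
      "\<forall>g. (g, complex_of_real t *\<^sub>C g) \<in> T \<longrightarrow> \<Gamma>\<^sub>1 g = m (\<Gamma>\<^sub>0 g)"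
      using weyl_closure[OF rt w] .
    have "\<Gamma>\<^sub>0 f \<in> \<Gamma>\<^sub>0 ` Domain T" using f by blast
    then obtain g where g: "(g, complex_of_real t *\<^sub>C g) \<in> T" "\<Gamma>\<^sub>0 g = \<Gamma>\<^sub>0 f"
      by (rule gamma_exists[OF rt])
    define mg where "mg = Re (cinner (\<Gamma>\<^sub>1 g) (\<Gamma>\<^sub>0 g))"
    have "(f - g, f' - complex_of_real t *\<^sub>C g) \<in> A\<^sub>0"
      using T_lin(3)[OF f g(1)] boundary_linear(5)[OF f g(1)] g(2) by (simp add: in_A0)
    then have lb: "l * (norm (f - g))\<^sup>2 \<le> Re (cinner (f' - complex_of_real t *\<^sub>C g) (f - g))"
      using l unfolding lower_bound_def by blast
    have gr: "Re (cinner f' g) - t * Re (cinner f g)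
        = Re (cinner (\<Gamma>\<^sub>0 f) (\<Gamma>\<^sub>1 f)) - mg"
      using arg_cong[OF green[OF f g(1)], of Re] g(2) Re_cinner_commute[of "\<Gamma>\<^sub>1 f" "\<Gamma>\<^sub>0 f"]
        Re_cinner_commute[of "\<Gamma>\<^sub>1 g" "\<Gamma>\<^sub>0 g"]
      by (simp add: mg_def cinner_simps)
    have "0 \<le> (norm ((f' - l *\<^sub>R f) + (l - t) *\<^sub>R g))\<^sup>2" by simp
    also have "\<dots> = N + 2 * (l - t) * (Re (cinner f' g) - l * Re (cinner f g)) + (l - t)\<^sup>2 * (norm g)\<^sup>2"
      by (simp only: norm_add_sq) (simp add: N_def cinner_simps power_mult_distrib)
    finally have "0 \<le> (N + 2 * (l - t) * (Re (cinner f' g) - l * Re (cinner f g))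
        + (l - t)\<^sup>2 * (norm g)\<^sup>2) / (l - t)" using t by simp
    also have "\<dots> = N / (l - t) + (2 * (Re (cinner f' g) - l * Re (cinner f g)) + (l - t) * (norm g)\<^sup>2)"
    proof -
      have "(N + 2 * d * X + d\<^sup>2 * G) / d = N / d + (2 * X + d * G)" if "0 < d" for d X G
        using that by (simp add: field_simps power2_eq_square)
      then show ?thesis by this (use t in simp)
    qed
    \<comment> \<open>completing the square absorbs the cross term between \<open>(T - l) f\<close> and \<open>g\<close>\<close>
    finally have sq: "- N / (l - t) \<le> 2 * (Re (cinner f' g) - l * Re (cinner f g)) + (l - t) * (norm g)\<^sup>2"
      by simp
    have "- mg \<le> norm (\<Gamma>\<^sub>1 g) * norm (\<Gamma>\<^sub>0 g)"
      using Re_cinner_bound[of "\<Gamma>\<^sub>1 g" "\<Gamma>\<^sub>0 g"] by (simp add: mg_def abs_le_iff)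
    also have "\<dots> \<le> (op_norm (closure (M t)) * norm (\<Gamma>\<^sub>0 g)) * norm (\<Gamma>\<^sub>0 g)"
      using m(3,5) g(1) by (intro mult_right_mono) auto
    finally have mg: "- op_norm (closure (M t)) * (norm (\<Gamma>\<^sub>0 f))\<^sup>2 \<le> mg"
      by (simp add: g(2) power2_eq_square mult.assoc)
    have "q \<ge> 2 * (Re (cinner f' g) - l * Re (cinner f g)) + (l - t) * (norm g)\<^sup>2 + mg"
      using lb gr Re_cinner_commute[of g f]
      by (simp add: q_def norm_diff_sq cinner_simps Re_cinner_self algebra_simps)
    with sq mg show ?thesis by linarith
  qed
  have "0 \<le> q"
  proof (rule tendsto_upperbound)
    have "((\<lambda>t. - op_norm (closure (M (complex_of_real t))) * (norm (\<Gamma>\<^sub>0 f))\<^sup>2 - N / (l - t))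
        \<longlongrightarrow> - 0 * (norm (\<Gamma>\<^sub>0 f))\<^sup>2 - 0) at_bot"
    proof (intro tendsto_intros decay)
      have "filterlim (\<lambda>t. l - t) at_top (at_bot :: real filter)"
        unfolding filterlim_at_top eventually_at_bot_linorder
      proof
        fix Z show "\<exists>N. \<forall>t\<le>N. Z \<le> l - t" by (rule exI[of _ "l - Z"]) simp
      qed
      then show "((\<lambda>t. N / (l - t)) \<longlongrightarrow> 0) at_bot"
        by (rule real_tendsto_divide_at_top[OF tendsto_const])
    qed
    then show "((\<lambda>t. - op_norm (closure (M (complex_of_real t))) * (norm (\<Gamma>\<^sub>0 f))\<^sup>2 - N / (l - t))
        \<longlongrightarrow> 0) at_bot" by simp
    show "\<forall>\<^sub>F t in at_bot. - op_norm (closure (M (complex_of_real t))) * (norm (\<Gamma>\<^sub>0 f))\<^sup>2 - N / (l - t) \<le> q"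
      unfolding eventually_at_bot_dense using est by blast
  qed simp
  then show ?thesis by (simp add: q_def)
qed

text \<open>
  Pairing \<open>f\<close> with \<open>g = \<gamma>(l) \<psi>\<close> in the form gives \<open>(\<Gamma>\<^sub>1 f, \<psi>)\<close>, and the form at \<open>g\<close> is \<open>(M(l) \<psi>, \<psi>)\<close>. So
  nonnegativity at \<open>f - b g\<close> reads \<open>0 \<le> q\<^sub>l(f) - 2 b Re (\<Gamma>\<^sub>1 f, \<psi>) + b\<^sup>2 (M(l) \<psi>, \<psi>)\<close>; the last term is at
  most \<open>b |\<psi>|\<^sup>2\<close>, and \<open>\<psi>\<close> may approach \<open>\<Gamma>\<^sub>1 f\<close> by density of \<open>ran \<Gamma>\<^sub>0\<close>.
\<close>

lemma boundary_bound:
  assumes form: "\<And>f f'. (f, f') \<in> T \<Longrightarrow> l * (norm f)\<^sup>2 \<le> Re (cinner f' f) + Re (cinner (\<Gamma>\<^sub>0 f) (\<Gamma>\<^sub>1 f))"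
    and l: "complex_of_real l \<in> resolvent_set A\<^sub>0"
    and k: "\<And>g. (g, complex_of_real l *\<^sub>C g) \<in> T \<Longrightarrow> norm (\<Gamma>\<^sub>1 g) \<le> k * norm (\<Gamma>\<^sub>0 g)"
    and b: "0 \<le> b" "b * k \<le> 1" and f: "(f, f') \<in> T"
  shows "b * (norm (\<Gamma>\<^sub>1 f))\<^sup>2 \<le> Re (cinner f' f) + Re (cinner (\<Gamma>\<^sub>0 f) (\<Gamma>\<^sub>1 f)) - l * (norm f)\<^sup>2"
proof -
  define q where "q = Re (cinner f' f) + Re (cinner (\<Gamma>\<^sub>0 f) (\<Gamma>\<^sub>1 f)) - l * (norm f)\<^sup>2"
  have test: "2 * b * Re (cinner (\<Gamma>\<^sub>1 f) \<psi>) \<le> q + b * (norm \<psi>)\<^sup>2" if \<psi>: "\<psi> \<in> \<Gamma>\<^sub>0 ` Domain T" for \<psi>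
  proof -
    obtain g where g: "(g, complex_of_real l *\<^sub>C g) \<in> T" "\<Gamma>\<^sub>0 g = \<psi>"
      by (rule gamma_exists[OF l \<psi>])
    have bg: "(complex_of_real b *\<^sub>C g, complex_of_real b *\<^sub>C complex_of_real l *\<^sub>C g) \<in> T"
      by (rule T_lin(4)[OF g(1)])
    have "\<Gamma>\<^sub>0 (b *\<^sub>R g) = b *\<^sub>R \<psi>" "\<Gamma>\<^sub>1 (b *\<^sub>R g) = b *\<^sub>R \<Gamma>\<^sub>1 g"
      using boundary_linear(1,2)[OF g(1), of "complex_of_real b"] g(2)
      by (simp_all add: scaleC_of_real)
    then have "l * (norm (f - b *\<^sub>R g))\<^sup>2 \<le> Re (cinner (f' - b *\<^sub>R l *\<^sub>R g) (f - b *\<^sub>R g))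
        + Re (cinner (\<Gamma>\<^sub>0 f - b *\<^sub>R \<psi>) (\<Gamma>\<^sub>1 f - b *\<^sub>R \<Gamma>\<^sub>1 g))"
      using form[OF T_lin(3)[OF f bg]] boundary_linear(5,6)[OF f bg]
      by (simp add: scaleC_of_real)
    moreover have "(norm (f - b *\<^sub>R g))\<^sup>2
        = (norm f)\<^sup>2 - 2 * (b * Re (cinner f g)) + b * (b * (norm g)\<^sup>2)"
      by (simp add: norm_diff_sq cinner_simps power_mult_distrib power2_eq_square[of b] mult.assoc)
    moreover have "Re (cinner (f' - b *\<^sub>R l *\<^sub>R g) (f - b *\<^sub>R g))
        = Re (cinner f' f) - b * Re (cinner f' g) - b * (l * Re (cinner f g))
          + b * (b * (l * (norm g)\<^sup>2))"
      using Re_cinner_commute[of g f] by (simp add: cinner_simps Re_cinner_self algebra_simps)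
    moreover have "Re (cinner (\<Gamma>\<^sub>0 f - b *\<^sub>R \<psi>) (\<Gamma>\<^sub>1 f - b *\<^sub>R \<Gamma>\<^sub>1 g))
        = Re (cinner (\<Gamma>\<^sub>0 f) (\<Gamma>\<^sub>1 f)) - b * Re (cinner (\<Gamma>\<^sub>0 f) (\<Gamma>\<^sub>1 g))
          - b * Re (cinner (\<Gamma>\<^sub>1 f) \<psi>) + b * (b * Re (cinner \<psi> (\<Gamma>\<^sub>1 g)))"
      using Re_cinner_commute[of \<psi> "\<Gamma>\<^sub>1 f"] by (simp add: cinner_simps algebra_simps)
    moreover have "Re (cinner f' g) - l * Re (cinner f g)
        = Re (cinner (\<Gamma>\<^sub>1 f) \<psi>) - Re (cinner (\<Gamma>\<^sub>0 f) (\<Gamma>\<^sub>1 g))"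
      using arg_cong[OF green[OF f g(1)], of Re] g(2) by (simp add: cinner_simps)
    then have "b * (Re (cinner f' g) - l * Re (cinner f g))
        = b * (Re (cinner (\<Gamma>\<^sub>1 f) \<psi>) - Re (cinner (\<Gamma>\<^sub>0 f) (\<Gamma>\<^sub>1 g)))" by simp
    ultimately have "2 * b * Re (cinner (\<Gamma>\<^sub>1 f) \<psi>) \<le> q + b\<^sup>2 * Re (cinner \<psi> (\<Gamma>\<^sub>1 g))"
      by (simp add: q_def power2_eq_square[of b] algebra_simps)
    also have "b\<^sup>2 * Re (cinner \<psi> (\<Gamma>\<^sub>1 g)) \<le> b * (norm \<psi>)\<^sup>2"
    proof -
      have "Re (cinner \<psi> (\<Gamma>\<^sub>1 g)) \<le> norm \<psi> * norm (\<Gamma>\<^sub>1 g)" using Re_cinner_bound abs_le_D1 by blast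
      also have "\<dots> \<le> norm \<psi> * (k * norm \<psi>)" using k[OF g(1)] g(2) by (intro mult_left_mono) auto
      finally have "b * (b * Re (cinner \<psi> (\<Gamma>\<^sub>1 g))) \<le> b * (b * (norm \<psi> * (k * norm \<psi>)))"
        using b(1) by (intro mult_left_mono)
      also have "\<dots> = b * ((b * k) * (norm \<psi>)\<^sup>2)" by (simp add: power2_eq_square mult_ac)
      also have "\<dots> \<le> b * (1 * (norm \<psi>)\<^sup>2)" using b by (intro mult_left_mono mult_right_mono) auto
      finally show ?thesis by (simp add: power2_eq_square mult.assoc)
    qed
    finally show ?thesis by simp
  qed
  obtain u where u: "\<And>n::nat. u n \<in> \<Gamma>\<^sub>0 ` Domain T" "u \<longlonglongrightarrow> \<Gamma>\<^sub>1 f"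
    by (rule dense_cases[OF range_G0_dense, of "\<Gamma>\<^sub>1 f"]) blast
  have "2 * b * Re (cinner (\<Gamma>\<^sub>1 f) (\<Gamma>\<^sub>1 f)) \<le> q + b * (norm (\<Gamma>\<^sub>1 f))\<^sup>2"
  proof (rule LIMSEQ_le)
    show "(\<lambda>n. 2 * b * Re (cinner (\<Gamma>\<^sub>1 f) (u n))) \<longlonglongrightarrow> 2 * b * Re (cinner (\<Gamma>\<^sub>1 f) (\<Gamma>\<^sub>1 f))"
      "(\<lambda>n. q + b * (norm (u n))\<^sup>2) \<longlonglongrightarrow> q + b * (norm (\<Gamma>\<^sub>1 f))\<^sup>2"
      by (intro tendsto_intros u)+
  qed (use test u(1) in blast)
  then show ?thesis by (simp add: q_def Re_cinner_self)
qed

section \<open>Extensions given by a boundary operator\<close>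

text \<open>
  On the domain of the extension \<open>((T - l) f, f) = q\<^sub>l(f) - (B \<Gamma>\<^sub>1 f, \<Gamma>\<^sub>1 f)\<close>, so an upper bound \<open>b\<close> of \<open>B\<close> is
  compensated by the control of \<open>\<Gamma>\<^sub>1 f\<close> through \<open>q\<^sub>l(f)\<close>.
\<close>

lemma bc_extension_lower_bound:
  assumes form: "\<And>f f'. (f, f') \<in> T \<Longrightarrow> l * (norm f)\<^sup>2 \<le> Re (cinner f' f) + Re (cinner (\<Gamma>\<^sub>0 f) (\<Gamma>\<^sub>1 f))"
    and l: "complex_of_real l \<in> resolvent_set A\<^sub>0"
    and k: "\<And>g. (g, complex_of_real l *\<^sub>C g) \<in> T \<Longrightarrow> norm (\<Gamma>\<^sub>1 g) \<le> k * norm (\<Gamma>\<^sub>0 g)"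
    and b: "0 \<le> b" "b * k \<le> 1" and B: "\<And>x y. (x, y) \<in> B \<Longrightarrow> Re (cinner y x) \<le> b * (norm x)\<^sup>2"
  shows "lower_bound (bc_extension T \<Gamma>\<^sub>0 \<Gamma>\<^sub>1 B) l"
  unfolding lower_bound_def in_bc_extension
proof (intro allI impI, elim conjE)
  fix f f' assume f: "(f, f') \<in> T" and fB: "(\<Gamma>\<^sub>1 f, \<Gamma>\<^sub>0 f) \<in> B"
  from boundary_bound[OF form l k b f] B[OF fB]
  show "l * (norm f)\<^sup>2 \<le> Re (cinner f' f)" by simp
qed

lemma bc_extension_symmetric:
  assumes "self_adjoint B"
  shows "linear_op (bc_extension T \<Gamma>\<^sub>0 \<Gamma>\<^sub>1 B)" "symmetric_op (bc_extension T \<Gamma>\<^sub>0 \<Gamma>\<^sub>1 B)"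
proof -
  note B = linear_opD[OF self_adjointD(1)[OF assms]]
  show "linear_op (bc_extension T \<Gamma>\<^sub>0 \<Gamma>\<^sub>1 B)"
  proof (rule linear_opI; unfold in_bc_extension)
    show "(0, 0) \<in> T \<and> (\<Gamma>\<^sub>1 0, \<Gamma>\<^sub>0 0) \<in> B" using T_lin(1) B(1) by (simp add: boundary_zero)
    fix x y x' y' assume *: "(x, y) \<in> T \<and> (\<Gamma>\<^sub>1 x, \<Gamma>\<^sub>0 x) \<in> B"
    show "(x', y') \<in> T \<and> (\<Gamma>\<^sub>1 x', \<Gamma>\<^sub>0 x') \<in> B \<Longrightarrow>
        (x + x', y + y') \<in> T \<and> (\<Gamma>\<^sub>1 (x + x'), \<Gamma>\<^sub>0 (x + x')) \<in> B"
      using * T_lin(2) B(2) boundary_linear(3,4) by auto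
    show "(a *\<^sub>C x, a *\<^sub>C y) \<in> T \<and> (\<Gamma>\<^sub>1 (a *\<^sub>C x), \<Gamma>\<^sub>0 (a *\<^sub>C x)) \<in> B" for a
      using * T_lin(4) B(4) boundary_linear(1,2) by auto
    show "(x, z) \<in> T \<and> (\<Gamma>\<^sub>1 x, \<Gamma>\<^sub>0 x) \<in> B \<Longrightarrow> y = z" for z using * T_lin(5) by blast
  qed
  show "symmetric_op (bc_extension T \<Gamma>\<^sub>0 \<Gamma>\<^sub>1 B)"
    unfolding symmetric_op_def
  proof (clarsimp simp: in_bc_extension)
    fix f f' g g'
    assume f: "(f, f') \<in> T" "(\<Gamma>\<^sub>1 f, \<Gamma>\<^sub>0 f) \<in> B" and g: "(g, g') \<in> T" "(\<Gamma>\<^sub>1 g, \<Gamma>\<^sub>0 g) \<in> B"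
    from green[OF f(1) g(1)] self_adjointD(3)[OF assms f(2) g(2)]
    show "cinner f' g = cinner f g'" by simp
  qed
qed

lemma S_subset_bc_extension:
  assumes "linear_op B" shows "S \<subseteq> bc_extension T \<Gamma>\<^sub>0 \<Gamma>\<^sub>1 B"
proof (clarify)
  fix f f' assume f: "(f, f') \<in> S"
  have adj: "cinner f' g = cinner f g'" if "(g, g') \<in> T" for g g'
    using T_subset that f by (auto simp: op_adjoint_def)
  \<comment> \<open>\<open>S\<close> is contained in the adjoint of \<open>A\<^sub>0\<close>, which is \<open>A\<^sub>0\<close>.\<close>
  have "(f, f') \<in> A\<^sub>0"
    by (rule self_adjointD(4)[OF A0_self_adjoint]) (metis adj cinner_commute in_A0)
  then have fT: "(f, f') \<in> T" "\<Gamma>\<^sub>0 f = 0" by (simp_all add: in_A0)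
  have "\<Gamma>\<^sub>1 f = 0"
  proof (rule dense_orthogonal_eq_0[OF range_G0_dense], elim imageE DomainE)
    fix y g g' assume g: "y = \<Gamma>\<^sub>0 g" "(g, g') \<in> T"
    have "cinner (\<Gamma>\<^sub>1 f) (\<Gamma>\<^sub>0 g) = 0"
      using green[OF fT(1) g(2)] adj[OF g(2)] by (simp add: fT(2))
    then show "cinner y (\<Gamma>\<^sub>1 f) = 0" using cinner_commute[of y "\<Gamma>\<^sub>1 f"] g(1) by simp
  qed
  then show "(f, f') \<in> bc_extension T \<Gamma>\<^sub>0 \<Gamma>\<^sub>1 B"
    using fT linear_opD(1)[OF assms] by (simp add: in_bc_extension)
qed

text \<open>
  With \<open>f = f0 + \<gamma>(l) \<phi>\<close>, \<open>f0 = (A\<^sub>0 - l)\<^sup>-\<^sup>1 h\<close>, the problem becomes \<open>\<phi> = B (m \<phi> + \<Gamma>\<^sub>1 f0)\<close>. The operator \<open>B m\<close> has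
  no symmetry, so the equation is moved to \<open>x = r \<phi>\<close> with \<open>r\<^sup>2 = m\<close>: there it reads
  \<open>(I - r B r) x = r B \<Gamma>\<^sub>1 f0\<close> with an everywhere defined symmetric operator on the left, and
  \<open>(r B r x, x) \<le> b (m x, x)\<close> makes it coercive when \<open>b k < 1\<close>.
\<close>

lemma bc_extension_surj:
  assumes l: "complex_of_real l \<in> resolvent_set A\<^sub>0"
    and m: "symmetric_map m" "\<And>x. 0 \<le> Re (cinner (m x) x)" "\<And>x. norm (m x) \<le> k * norm x"
    and mg: "\<And>g. (g, complex_of_real l *\<^sub>C g) \<in> T \<Longrightarrow> \<Gamma>\<^sub>1 g = m (\<Gamma>\<^sub>0 g)"
    and B: "self_adjoint B" "\<And>x y. (x, y) \<in> B \<Longrightarrow> Re (cinner y x) \<le> b * (norm x)\<^sup>2"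
    and b: "0 \<le> b" "b * k < 1"
    and root: "Range (op_sqrt (map_op m)) \<subseteq> Domain B"
    and Bm: "B `` range m \<subseteq> \<Gamma>\<^sub>0 ` Domain T"
    and dom: "\<Gamma>\<^sub>1 ` Domain T \<subseteq> Domain B" and BG: "B `` (\<Gamma>\<^sub>1 ` Domain T) \<subseteq> \<Gamma>\<^sub>0 ` Domain T"
  shows "\<exists>f. (f, h + complex_of_real l *\<^sub>C f) \<in> bc_extension T \<Gamma>\<^sub>0 \<Gamma>\<^sub>1 B"
proof -
  note Bl = linear_opD[OF self_adjointD(1)[OF B(1)]]
  obtain r where r: "op_sqrt (map_op m) = map_op r" "symmetric_map r" "\<forall>x. r (r x) = m x"
    using op_sqrt_map_op[OF m] by blast
  have "\<exists>y. (r x, y) \<in> B" for x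
  proof -
    have "r x \<in> Range (map_op r)" by (auto intro: RangeI[of x])
    then show ?thesis using root r(1) by (auto simp: Domain_iff)
  qed
  then obtain c where c: "\<And>x. (r x, c x) \<in> B" by metis
  define K where "K x = x - r (c x)" for x
  have K: "symmetric_map K"
    unfolding symmetric_map_def
  proof (intro allI)
    fix x y
    have "cinner (r (c x)) y = cinner x (r (c y))"
      using self_adjointD(3)[OF B(1) c[of x] c[of y]] by (simp add: symmetric_mapD[OF r(2)])
    then show "cinner (K x) y = cinner x (K y)" by (simp add: K_def cinner_simps)
  qed
  have coercive: "(1 - b * k) * (norm x)\<^sup>2 \<le> Re (cinner (K x) x)" for x
  proof -
    have "Re (cinner (r (c x)) x) = Re (cinner (c x) (r x))" by (simp add: symmetric_mapD[OF r(2)])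
    also have "\<dots> \<le> b * (norm (r x))\<^sup>2" by (rule B(2)[OF c])
    also have "(norm (r x))\<^sup>2 = Re (cinner (m x) x)"
      using symmetric_mapD[OF r(2), of "r x" x] r(3) by (simp add: Re_cinner_self[symmetric])
    also have "b * Re (cinner (m x) x) \<le> b * (norm (m x) * norm x)"
      using b(1) Re_cinner_bound abs_le_D1 by (intro mult_left_mono) blast+
    also have "\<dots> \<le> b * ((k * norm x) * norm x)"
      using b(1) m(3) by (intro mult_left_mono mult_right_mono) auto
    finally show ?thesis by (simp add: K_def cinner_simps Re_cinner_self power2_eq_square algebra_simps)
  qed
  obtain f0 where f0: "(f0, h + complex_of_real l *\<^sub>C f0) \<in> A\<^sub>0" using resolvent_set_surj[OF l] by blast
  then have f0T: "(f0, h + complex_of_real l *\<^sub>C f0) \<in> T" "\<Gamma>\<^sub>0 f0 = 0" by (simp_all add: in_A0)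
  then obtain d where d: "(\<Gamma>\<^sub>1 f0, d) \<in> B" using dom by (auto simp: Domain_iff)
  obtain x where x: "K x = r d"
    using coercive_symmetric_map_surj[OF K _ coercive] b(2) by (metis diff_gt_0_iff_gt)
  \<comment> \<open>\<open>\<phi> = B (r x + \<Gamma>\<^sub>1 f\<^sub>0)\<close> satisfies \<open>r \<phi> = x\<close>, hence \<open>\<phi> = B (m \<phi> + \<Gamma>\<^sub>1 f\<^sub>0)\<close>.\<close>
  define \<phi> where "\<phi> = c x + d"
  have "r \<phi> = x" using x by (simp add: \<phi>_def symmetric_map_linear[OF r(2)] K_def algebra_simps)
  then have rx: "r x = m \<phi>" using r(3) by metis
  have \<phi>B: "(m \<phi> + \<Gamma>\<^sub>1 f0, \<phi>) \<in> B" unfolding \<phi>_def using Bl(2)[OF c[of x] d] rx by (simp add: \<phi>_def)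
  have "c x \<in> \<Gamma>\<^sub>0 ` Domain T" "d \<in> \<Gamma>\<^sub>0 ` Domain T"
    using subsetD[OF Bm ImageI[OF c[of x]]] rx
      subsetD[OF BG ImageI[OF d imageI[OF DomainI[OF f0T(1)], of \<Gamma>\<^sub>1]]] by auto
  then have "\<phi> \<in> \<Gamma>\<^sub>0 ` Domain T"
  proof (elim imageE DomainE)
    fix u u' v v' assume u: "c x = \<Gamma>\<^sub>0 u" "(u, u') \<in> T" and v: "d = \<Gamma>\<^sub>0 v" "(v, v') \<in> T"
    show "\<phi> \<in> \<Gamma>\<^sub>0 ` Domain T"
      unfolding \<phi>_def u(1) v(1) boundary_linear(3)[OF u(2) v(2), symmetric]
      by (rule imageI, rule DomainI) (rule T_lin(2)[OF u(2) v(2)])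
  qed
  then obtain g where g: "(g, complex_of_real l *\<^sub>C g) \<in> T" "\<Gamma>\<^sub>0 g = \<phi>"
    by (rule gamma_exists[OF l])
  have "(f0 + g, h + complex_of_real l *\<^sub>C (f0 + g)) \<in> T"
    using T_lin(2)[OF f0T(1) g(1)] by (simp add: scaleC_add_right add.assoc)
  moreover have "(\<Gamma>\<^sub>1 (f0 + g), \<Gamma>\<^sub>0 (f0 + g)) \<in> B"
    using \<phi>B boundary_linear(3,4)[OF f0T(1) g(1)] mg[OF g(1)] g(2) f0T(2) by (simp add: add.commute)
  ultimately show ?thesis by (auto simp: in_bc_extension)
qed

text \<open>
  For \<open>f = (A\<^sub>B - z)\<^sup>-\<^sup>1 h\<close> the decomposition \<open>f = f0 + g\<close> has \<open>f0 = (A\<^sub>0 - z)\<^sup>-\<^sup>1 h\<close>, and the boundary condition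
  turns into \<open>(I - B M(z)) \<Gamma>\<^sub>0 g = B \<Gamma>\<^sub>1 f0 = B \<gamma>(z\<^sup>*)\<^sup>* h\<close>. This is the inclusion of graphs from left to
  right; it is an equality since the left side is everywhere defined and the right side
  single-valued.
\<close>

lemma krein_formula:
  assumes A\<^sub>0: "z \<in> resolvent_set A\<^sub>0" and A\<^sub>B: "z \<in> resolvent_set (bc_extension T \<Gamma>\<^sub>0 \<Gamma>\<^sub>1 B)"
    and B: "linear_op B" and dom: "\<Gamma>\<^sub>1 ` Domain T \<subseteq> Domain B"
  shows "single_valued ((Id -\<^sub>o B \<circ>\<^sub>o M z)\<inverse>)"
    and "(bc_extension T \<Gamma>\<^sub>0 \<Gamma>\<^sub>1 B -\<^sub>o scalar_op z)\<inverse> = (A\<^sub>0 -\<^sub>o scalar_op z)\<inverse>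
      +\<^sub>o \<gamma> z \<circ>\<^sub>o (Id -\<^sub>o B \<circ>\<^sub>o M z)\<inverse> \<circ>\<^sub>o B \<circ>\<^sub>o op_adjoint (\<gamma> (cnj z))" (is "?L = ?R")
proof -
  note Bl = linear_opD[OF B]
  have IBM: "(\<phi>, u) \<in> Id -\<^sub>o B \<circ>\<^sub>o M z \<longleftrightarrow>
      (\<exists>g. (g, z *\<^sub>C g) \<in> T \<and> \<phi> = \<Gamma>\<^sub>0 g \<and> (\<Gamma>\<^sub>1 g, \<phi> - u) \<in> B)" for \<phi> u
  proof -
    have "(\<phi>, u) \<in> Id -\<^sub>o X \<longleftrightarrow> (\<phi>, \<phi> - u) \<in> X" for X
      by (auto simp: op_diff_def intro!: exI[of _ "\<phi> - u"])
    then have "(\<phi>, u) \<in> Id -\<^sub>o B \<circ>\<^sub>o M z \<longleftrightarrow> (\<phi>, \<phi> - u) \<in> B \<circ>\<^sub>o M z" .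
    also have "\<dots> \<longleftrightarrow> (\<exists>g. (g, z *\<^sub>C g) \<in> T \<and> \<phi> = \<Gamma>\<^sub>0 g \<and> (\<Gamma>\<^sub>1 g, \<phi> - u) \<in> B)"
      by (auto simp: relcomp_unfold in_weyl_function)
    finally show ?thesis .
  qed
  show sv: "single_valued ((Id -\<^sub>o B \<circ>\<^sub>o M z)\<inverse>)"
  proof (rule single_valuedI, unfold converse_iff IBM, elim exE conjE)
    fix u \<phi> \<psi> g h
    assume g: "(g, z *\<^sub>C g) \<in> T" "\<phi> = \<Gamma>\<^sub>0 g" "(\<Gamma>\<^sub>1 g, \<phi> - u) \<in> B"
      and h: "(h, z *\<^sub>C h) \<in> T" "\<psi> = \<Gamma>\<^sub>0 h" "(\<Gamma>\<^sub>1 h, \<psi> - u) \<in> B"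
    \<comment> \<open>the difference is an eigenvector of the extension at the resolvent point \<open>z\<close>\<close>
    have "(g - h, 0 + z *\<^sub>C (g - h)) \<in> bc_extension T \<Gamma>\<^sub>0 \<Gamma>\<^sub>1 B"
      using T_lin(3)[OF g(1) h(1)] Bl(3)[OF g(3) h(3)] boundary_linear(5,6)[OF g(1) h(1)] g(2) h(2)
      by (simp add: in_bc_extension scaleC_diff_right)
    moreover have "(0, 0 + z *\<^sub>C 0) \<in> bc_extension T \<Gamma>\<^sub>0 \<Gamma>\<^sub>1 B"
      using T_lin(1) Bl(1) by (simp add: in_bc_extension boundary_zero)
    ultimately have "g - h = 0" by (rule resolvent_set_inj[OF A\<^sub>B])
    then show "\<phi> = \<psi>" using g(2) h(2) by simp
  qed
  have sub: "?L \<subseteq> ?R"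
  proof (clarsimp simp: in_diff_scalar_op in_bc_extension)
    fix f h assume f: "(f, h + z *\<^sub>C f) \<in> T" "(\<Gamma>\<^sub>1 f, \<Gamma>\<^sub>0 f) \<in> B"
    obtain f0 g where fg: "f = f0 + g" "(f0, (h + z *\<^sub>C f - z *\<^sub>C f) + z *\<^sub>C f0) \<in> A\<^sub>0"
      "(g, z *\<^sub>C g) \<in> T" "\<Gamma>\<^sub>0 g = \<Gamma>\<^sub>0 f" using decompose[OF A\<^sub>0 f(1)] .
    have f0: "(f0, h + z *\<^sub>C f0) \<in> A\<^sub>0" using fg(2) by simp
    then have f0T: "(f0, h + z *\<^sub>C f0) \<in> T" by (simp add: in_A0)
    have "\<Gamma>\<^sub>1 f0 \<in> Domain B" "\<Gamma>\<^sub>1 g \<in> Domain B" using dom f0T fg(3) by blast+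
    then obtain u v where u: "(\<Gamma>\<^sub>1 f0, u) \<in> B" and v: "(\<Gamma>\<^sub>1 g, v) \<in> B" by blast
    have "\<Gamma>\<^sub>1 f = \<Gamma>\<^sub>1 f0 + \<Gamma>\<^sub>1 g" using boundary_linear(4)[OF f0T fg(3)] fg(1) by simp
    then have "\<Gamma>\<^sub>0 f = u + v" using Bl(5)[OF f(2)] Bl(2)[OF u v] by simp
    then have "(\<Gamma>\<^sub>0 f, u) \<in> Id -\<^sub>o B \<circ>\<^sub>o M z"
      unfolding IBM by (intro exI[of _ g]) (simp add: fg(3,4) v)
    moreover have "(\<Gamma>\<^sub>0 f, g) \<in> \<gamma> z" using fg(3,4) by (simp add: in_gamma_field)
    moreover have "(h, \<Gamma>\<^sub>1 f0) \<in> op_adjoint (\<gamma> (cnj z))" by (rule gamma_adjoint[OF f0])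
    ultimately have "(h, g) \<in> \<gamma> z \<circ>\<^sub>o (Id -\<^sub>o B \<circ>\<^sub>o M z)\<inverse> \<circ>\<^sub>o B \<circ>\<^sub>o op_adjoint (\<gamma> (cnj z))"
      using u by (intro relcompI) auto
    moreover have "(h, f0) \<in> (A\<^sub>0 -\<^sub>o scalar_op z)\<inverse>" using f0 by (simp add: in_diff_scalar_op)
    ultimately show "(h, f) \<in> ?R" unfolding fg(1) by (intro op_addI)
  qed
  have R_unique: "f = f'" if "(h, f) \<in> ?R" "(h, f') \<in> ?R" for h f f'
  proof -
    have cz: "z \<in> resolvent_set A\<^sub>0 \<Longrightarrow> cnj z \<in> resolvent_set A\<^sub>0"
      by (rule resolvent_set_cnj[OF A0_self_adjoint])
    have "single_valued (op_adjoint (\<gamma> (cnj z)))"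
      by (rule single_valuedI) (rule gamma_adjoint_unique[OF cz[OF A\<^sub>0]])
    moreover have "single_valued B" using B by (simp add: linear_op_def)
    moreover have "single_valued (\<gamma> z)"
      by (rule single_valuedI) (auto simp: in_gamma_field intro: kernel_unique[OF A\<^sub>0])
    ultimately have 1: "single_valued (\<gamma> z \<circ>\<^sub>o (Id -\<^sub>o B \<circ>\<^sub>o M z)\<inverse> \<circ>\<^sub>o B \<circ>\<^sub>o op_adjoint (\<gamma> (cnj z)))"
      using sv by (intro single_valued_relcomp)
    have 2: "single_valued ((A\<^sub>0 -\<^sub>o scalar_op z)\<inverse>)" using A\<^sub>0 by (simp add: resolvent_set_def)
    show ?thesis using that single_valuedD[OF 1] single_valuedD[OF 2] unfolding op_add_def by blast
  qed
  show "?L = ?R"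
  proof
    show "?R \<subseteq> ?L"
    proof (rule subrelI)
      fix h f assume hf: "(h, f) \<in> ?R"
      have "h \<in> Domain ?L" using A\<^sub>B by (simp add: resolvent_set_def)
      then obtain f' where f': "(h, f') \<in> ?L" by blast
      then have "f = f'" using R_unique[OF hf] sub by blast
      then show "(h, f) \<in> ?L" using f' by simp
    qed
  qed (rule sub)
qed

end

section \<open>The positive part of a self-adjoint operator\<close>

locale pvm =
  fixes E :: "real set \<Rightarrow> 'a \<Rightarrow> 'a::complex_hilbert"
  assumes pvm: "projection_valued_measure E"
begin

abbreviation \<mu> :: "'a \<Rightarrow> real measure" where "\<mu> \<equiv> scalar_measure E"

lemma proj:
  assumes "X \<in> sets borel"
  shows "symmetric_map (E X)" "E X (E X x) = E X x"
  using pvm assms by (auto simp: projection_valued_measure_def symmetric_map_def)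

lemma proj_UNIV: "E UNIV x = x"
  using pvm by (simp add: projection_valued_measure_def)

lemma proj_sums:
  fixes F :: "nat \<Rightarrow> real set"
  assumes "range F \<subseteq> sets borel" "disjoint_family F"
  shows "(\<lambda>n. E (F n) x) sums E (\<Union>n. F n) x"
  using pvm assms unfolding projection_valued_measure_def by blast

lemmas proj_linear = symmetric_map_linear[OF proj(1)]

lemma proj_empty: "E {} x = 0"
proof -
  have "(\<lambda>n::nat. E {} x) sums E (\<Union>n::nat. {}) x"
    by (rule proj_sums) (auto simp: disjoint_family_on_def)
  then have "summable (\<lambda>n::nat. E {} x)" by (rule sums_summable)
  then show ?thesis by (simp add: summable_const_iff)
qed

lemma proj_Un:
  assumes "X \<in> sets borel" "Y \<in> sets borel" "X \<inter> Y = {}"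
  shows "E (X \<union> Y) x = E X x + E Y x"
proof -
  have "disjoint_family (binaryset X Y)"
    using assms(3) by (auto simp: disjoint_family_on_def binaryset_def)
  moreover have "range (binaryset X Y) \<subseteq> sets borel" using assms by (simp add: range_binaryset_eq)
  ultimately have "(\<lambda>n. E (binaryset X Y n) x) sums E (X \<union> Y) x"
    using proj_sums[of "binaryset X Y" x] by (simp add: UN_binaryset_eq)
  moreover have "(\<lambda>n. E (binaryset X Y n) x) sums (E X x + E Y x)"
    by (rule binaryset_sums[of "\<lambda>X. E X x"]) (rule proj_empty)
  ultimately show ?thesis by (rule sums_unique2)
qed

lemma proj_compl: "X \<in> sets borel \<Longrightarrow> E X x + E (- X) x = x"
  using proj_Un[of X "- X" x] by (simp add: proj_UNIV borel_comp)

text \<open>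
  With \<open>P = E(X)\<close> and \<open>Q = E(Y)\<close>, idempotence of \<open>P + Q\<close> gives \<open>P Q + Q P = 0\<close>; multiplying by \<open>P\<close>
  from the left and from the right shows that \<open>P Q\<close> and \<open>Q P\<close> are equal, hence zero.
\<close>

lemma proj_disjoint:
  assumes X: "X \<in> sets borel" and Y: "Y \<in> sets borel" and XY: "X \<inter> Y = {}"
  shows "E X (E Y x) = 0"
proof -
  have anti: "E X (E Y v) + E Y (E X v) = 0" for v
  proof -
    have "E (X \<union> Y) (E (X \<union> Y) v) = E (X \<union> Y) v" using X Y by (intro proj(2)) auto
    then show ?thesis
      unfolding proj_Un[OF X Y XY] proj_linear(1)[OF X] proj_linear(1)[OF Y] proj(2)[OF X] proj(2)[OF Y]
      by (simp add: algebra_simps)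
  qed
  have 1: "E X (E Y x) + E X (E Y (E X x)) = 0"
    using arg_cong[OF anti[of x], of "E X"]
    by (simp add: proj_linear(1)[OF X] proj_linear(5)[OF X] proj(2)[OF X])
  have 2: "E X (E Y (E X x)) + E Y (E X x) = 0"
    using anti[of "E X x"] by (simp add: proj(2)[OF X])
  have "E X (E Y x) = E Y (E X x)" using 1 2 by (metis add.commute add_right_cancel)
  with anti[of x] have "2 *\<^sub>R E X (E Y x) = 0" by (simp add: scaleR_2)
  then show ?thesis by simp
qed

lemma proj_subset:
  assumes X: "X \<in> sets borel" and Y: "Y \<in> sets borel" and YX: "Y \<subseteq> X"
  shows "E Y (E X x) = E Y x"
proof -
  have "E X x = E Y x + E (X - Y) x"
    using proj_Un[of Y "X - Y" x] X Y YX by (simp add: Un_absorb1)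
  then show ?thesis
    using proj_disjoint[of Y "X - Y" x] X Y by (simp add: proj_linear(1)[OF Y] proj(2)[OF Y])
qed

subsection \<open>The scalar measures\<close>

lemma Re_proj: "X \<in> sets borel \<Longrightarrow> Re (cinner (E X x) x) = (norm (E X x))\<^sup>2"
  using symmetric_mapD[OF proj(1), of X "E X x" x] proj(2)[of X x] by (simp add: Re_cinner_self)

lemma sets_scalar [simp, measurable_cong]: "sets (\<mu> x) = sets borel"
  and space_scalar [simp]: "space (\<mu> x) = UNIV"
  unfolding scalar_measure_def using sets.sigma_sets_eq[of "borel :: real measure"]
  by (simp_all add: sets_measure_of_conv space_measure_of_conv)

lemma emeasure_scalar: "X \<in> sets borel \<Longrightarrow> emeasure (\<mu> x) X = ennreal ((norm (E X x))\<^sup>2)"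
proof -
  assume X: "X \<in> sets borel"
  let ?m = "\<lambda>X. ennreal (Re (cinner (E X x) x))"
  have "emeasure (\<mu> x) X = ?m X"
    unfolding scalar_measure_def
  proof (rule emeasure_measure_of_sigma)
    show "sigma_algebra UNIV (sets (borel :: real measure))"
      using sets.sigma_algebra_axioms[of "borel :: real measure"] by simp
    show "positive (sets borel) ?m" by (simp add: positive_def proj_empty)
    show "countably_additive (sets borel) ?m"
      unfolding countably_additive_def
    proof (intro allI impI)
      fix F :: "nat \<Rightarrow> real set" assume F: "range F \<subseteq> sets borel" "disjoint_family F"
      have "(\<lambda>n. Re (cinner (E (F n) x) x)) sums Re (cinner (E (\<Union>n. F n) x) x)"
        by (intro bounded_linear.sums[OF bounded_linear_Re]
            bounded_linear.sums[OF bounded_bilinear.bounded_linear_left[OF bounded_bilinear_cinner]]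
            proj_sums F)
      moreover have "0 \<le> Re (cinner (E (F n) x) x)" for n using F(1) Re_proj[of "F n"] by auto
      ultimately show "(\<Sum>n. ?m (F n)) = ?m (\<Union>n. F n)"
        by (simp add: suminf_ennreal2 sums_iff)
    qed
  qed (rule X)
  then show ?thesis using X by (simp add: Re_proj)
qed

lemma finite_scalar: "finite_measure (\<mu> x)"
  by (rule finite_measureI) (simp add: emeasure_scalar)

lemma measure_scalar: "measure (\<mu> x) UNIV = (norm x)\<^sup>2"
  by (simp add: measure_def emeasure_scalar proj_UNIV)

lemma AE_scalar:
  assumes X: "X \<in> sets borel" and "E (- X) x = 0" shows "AE t in \<mu> x. t \<in> X"
proof (rule AE_I[of _ _ "- X"])
  show "emeasure (\<mu> x) (- X) = 0" using assms by (simp add: emeasure_scalar borel_comp)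
qed (use X in \<open>auto simp: borel_comp\<close>)

lemma scalar_scale: "\<mu> (c *\<^sub>C x) = density (\<mu> x) (\<lambda>_. ennreal ((cmod c)\<^sup>2))"
proof (rule measure_eqI)
  fix X assume "X \<in> sets (\<mu> (c *\<^sub>C x))"
  then have X: "X \<in> sets borel" by simp
  then show "emeasure (\<mu> (c *\<^sub>C x)) X = emeasure (density (\<mu> x) (\<lambda>_. ennreal ((cmod c)\<^sup>2))) X"
    by (simp add: emeasure_density_const emeasure_scalar proj_linear(3)[OF X] norm_scaleC
        power_mult_distrib ennreal_mult)
qed simp

lemma integral_scale:
  fixes f :: "real \<Rightarrow> real" assumes "f \<in> borel_measurable borel"
  shows "(\<integral>t. f t \<partial>\<mu> (c *\<^sub>C x)) = (cmod c)\<^sup>2 * (\<integral>t. f t \<partial>\<mu> x)"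
proof -
  have [measurable]: "f \<in> borel_measurable (\<mu> x)" using assms by simp
  show ?thesis unfolding scalar_scale by (subst integral_density) auto
qed

lemma scalar_unimodular: "cmod c = 1 \<Longrightarrow> \<mu> (c *\<^sub>C x) = \<mu> x"
  by (simp add: scalar_scale density_1)

text \<open>
  Inside \<open>X\<close> the measure of \<open>u\<close> depends on \<open>E(X) u\<close> only, because \<open>E(Y) = E(Y) E(X)\<close> for \<open>Y \<subseteq> X\<close>.
\<close>

lemma scalar_local:
  fixes f :: "real \<Rightarrow> real"
  assumes X: "X \<in> sets borel" and f: "f \<in> borel_measurable borel" and eq: "E X u = E X v"
  shows "integrable (\<mu> u) (\<lambda>t. indicator X t * f t) \<longleftrightarrow> integrable (\<mu> v) (\<lambda>t. indicator X t * f t)"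
    and "(\<integral>t. indicator X t * f t \<partial>\<mu> u) = (\<integral>t. indicator X t * f t \<partial>\<mu> v)"
proof -
  let ?g = "indicator X :: real \<Rightarrow> real"
  have e: "emeasure (density (\<mu> w) ?g) Y = ennreal ((norm (E Y (E X w)))\<^sup>2)" if Y: "Y \<in> sets borel" for Y w
  proof -
    have "emeasure (density (\<mu> w) ?g) Y = (\<integral>\<^sup>+ t. ennreal (?g t) * indicator Y t \<partial>\<mu> w)"
      using X Y by (intro emeasure_density) auto
    also have "\<dots> = (\<integral>\<^sup>+ t. indicator (X \<inter> Y) t \<partial>\<mu> w)"
      by (rule nn_integral_cong) (simp split: split_indicator)
    also have "\<dots> = ennreal ((norm (E (X \<inter> Y) w))\<^sup>2)" using X Y by (simp add: emeasure_scalar)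
    also have "E (X \<inter> Y) w = E (X \<inter> Y) (E X w)" using proj_subset[of X "X \<inter> Y" w] X Y by simp
    also have "\<dots> = E Y (E X w)"
    proof -
      have "E Y (E X w) = E (Y \<inter> X) (E X w) + E (Y - X) (E X w)"
        using proj_Un[of "Y \<inter> X" "Y - X"] X Y by (simp add: Int_Diff_disjoint Int_Diff_Un)
      moreover have "E (Y - X) (E X w) = 0" using X Y by (intro proj_disjoint) auto
      ultimately show ?thesis by (simp add: Int_commute)
    qed
    finally show ?thesis .
  qed
  have d: "density (\<mu> u) ?g = density (\<mu> v) ?g"
    by (rule measure_eqI) (simp_all add: e eq)
  have [measurable]: "f \<in> borel_measurable (\<mu> w)" "?g \<in> borel_measurable (\<mu> w)" for w
    using f X by simp_all
  have "integrable (density (\<mu> w) ?g) f \<longleftrightarrow> integrable (\<mu> w) (\<lambda>t. ?g t * f t)" for w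
    by (subst integrable_density) auto
  then show "integrable (\<mu> u) (\<lambda>t. ?g t * f t) \<longleftrightarrow> integrable (\<mu> v) (\<lambda>t. ?g t * f t)" using d by metis
  have "(\<integral>t. f t \<partial>density (\<mu> w) ?g) = (\<integral>t. ?g t * f t \<partial>\<mu> w)" for w
    by (subst integral_density) auto
  then show "(\<integral>t. ?g t * f t \<partial>\<mu> u) = (\<integral>t. ?g t * f t \<partial>\<mu> v)" using d by metis
qed

lemma indicator_split: "f t = indicator X t * f t + indicator (- X) t * (f t :: real)"
  by (simp add: indicator_def)

lemma integral_split:
  fixes f :: "real \<Rightarrow> real"
  assumes X: "X \<in> sets borel" and f: "integrable (\<mu> w) f"
  shows "(\<integral>t. f t \<partial>\<mu> w) = (\<integral>t. indicator X t * f t \<partial>\<mu> w) + (\<integral>t. indicator (- X) t * f t \<partial>\<mu> w)"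
proof -
  have "integrable (\<mu> w) (\<lambda>t. indicator Y t * f t)" if "Y \<in> sets borel" for Y
    using integrable_mult_indicator[of Y "\<mu> w" f] f that by simp
  then have "(\<integral>t. indicator X t * f t + indicator (- X) t * f t \<partial>\<mu> w)
    = (\<integral>t. indicator X t * f t \<partial>\<mu> w) + (\<integral>t. indicator (- X) t * f t \<partial>\<mu> w)"
    using X by (intro Bochner_Integration.integral_add) (auto simp: borel_comp)
  then show ?thesis using indicator_split[of f _ X] by simp
qed

text \<open>
  On sets this is the parallelogram identity for \<open>E(X) u\<close> and \<open>E(X) v\<close>. It makes the domains of
  spectral integrals closed under addition.
\<close>

lemma nn_integral_add_le:
  assumes f: "f \<in> borel_measurable borel"
  shows "(\<integral>\<^sup>+ t. f t \<partial>\<mu> (u + v)) \<le> 2 * (\<integral>\<^sup>+ t. f t \<partial>\<mu> u) + 2 * (\<integral>\<^sup>+ t. f t \<partial>\<mu> v)"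
  using f
proof (induction rule: borel_measurable_induct)
  case (cong f g)
  then have "f = g" by auto
  then show ?case using cong by simp
next
  case (set X)
  have "(norm (E X (u + v)))\<^sup>2 \<le> 2 * (norm (E X u))\<^sup>2 + 2 * (norm (E X v))\<^sup>2"
    using parallelogram[of "E X u" "E X v"] zero_le_power2[of "norm (E X u - E X v)"]
    unfolding proj_linear(1)[OF set] by linarith
  then have "ennreal ((norm (E X (u + v)))\<^sup>2) \<le> ennreal (2 * (norm (E X u))\<^sup>2 + 2 * (norm (E X v))\<^sup>2)"
    by (rule ennreal_leI)
  then show ?case using set by (simp add: emeasure_scalar ennreal_plus ennreal_mult)
next
  case (mult f c)
  have [measurable]: "f \<in> borel_measurable (\<mu> w)" for w using mult by simp
  from mult_left_mono[OF mult.IH, of c] show ?case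
    by (simp add: nn_integral_cmult distrib_left mult.left_commute)
next
  case (add f g)
  have [measurable]: "f \<in> borel_measurable (\<mu> w)" "g \<in> borel_measurable (\<mu> w)" for w
    using add by simp_all
  from add_mono[OF add.IH(1) add.IH(2)] show ?case
    by (simp add: nn_integral_add distrib_left add_ac)
next
  case (seq U)
  have "(\<integral>\<^sup>+ t. (SUP i. U i) t \<partial>\<mu> (u + v)) = (SUP i. \<integral>\<^sup>+ t. U i t \<partial>\<mu> (u + v))"
    unfolding SUP_apply by (rule nn_integral_monotone_convergence_SUP) (use seq in auto)
  also have "\<dots> \<le> 2 * (\<integral>\<^sup>+ t. (SUP i. U i) t \<partial>\<mu> u) + 2 * (\<integral>\<^sup>+ t. (SUP i. U i) t \<partial>\<mu> v)"
  proof (rule SUP_least)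
    fix i
    have "U i t \<le> (SUP i. U i) t" for t using SUP_upper[of i UNIV U] by (simp add: le_fun_def)
    then show "(\<integral>\<^sup>+ t. U i t \<partial>\<mu> (u + v))
        \<le> 2 * (\<integral>\<^sup>+ t. (SUP i. U i) t \<partial>\<mu> u) + 2 * (\<integral>\<^sup>+ t. (SUP i. U i) t \<partial>\<mu> v)"
      by (intro order_trans[OF seq.IH[of i]] add_mono mult_left_mono nn_integral_mono) auto
  qed
  finally show ?case .
qed

lemma square_integrable_add:
  assumes f: "f \<in> borel_measurable borel"
    and "integrable (\<mu> u) (\<lambda>t. (f t)\<^sup>2)" "integrable (\<mu> v) (\<lambda>t. (f t)\<^sup>2)"
  shows "integrable (\<mu> (u + v)) (\<lambda>t. (f t :: real)\<^sup>2)"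
proof (rule integrableI_nonneg)
  have [measurable]: "f \<in> borel_measurable borel" by (rule f)
  show "(\<lambda>t. (f t)\<^sup>2) \<in> borel_measurable (\<mu> (u + v))" by simp
  have fin: "(\<integral>\<^sup>+ t. ennreal ((f t)\<^sup>2) \<partial>\<mu> w) < \<infinity>" if "integrable (\<mu> w) (\<lambda>t. (f t)\<^sup>2)" for w
    using that by (simp add: integrable_iff_bounded)
  have "(\<integral>\<^sup>+ t. ennreal ((f t)\<^sup>2) \<partial>\<mu> (u + v))
      \<le> 2 * (\<integral>\<^sup>+ t. ennreal ((f t)\<^sup>2) \<partial>\<mu> u) + 2 * (\<integral>\<^sup>+ t. ennreal ((f t)\<^sup>2) \<partial>\<mu> v)"
    by (rule nn_integral_add_le) simp
  also have "\<dots> < \<infinity>" using fin[OF assms(2)] fin[OF assms(3)] by (simp add: ennreal_mult_less_top)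
  finally show "(\<integral>\<^sup>+ t. ennreal ((f t)\<^sup>2) \<partial>\<mu> (u + v)) < \<infinity>" .
qed simp

lemma integrable_if_square_integrable:
  assumes f: "f \<in> borel_measurable borel" and "integrable (\<mu> u) (\<lambda>t. (f t)\<^sup>2)"
  shows "integrable (\<mu> u) (f :: real \<Rightarrow> real)"
proof (rule Bochner_Integration.integrable_bound)
  interpret finite_measure "\<mu> u" by (rule finite_scalar)
  show "integrable (\<mu> u) (\<lambda>t. 1 + (f t)\<^sup>2)" using assms(2) by simp
  show "f \<in> borel_measurable (\<mu> u)" using f by simp
  have "\<bar>f t\<bar> \<le> 1 + (f t)\<^sup>2" for t
    using sum_squares_bound[of "\<bar>f t\<bar>" 1] zero_le_power2[of "f t"] by simp
  then show "AE t in \<mu> u. norm (f t) \<le> norm (1 + (f t)\<^sup>2)" by simp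
qed

subsection \<open>Spectral integrals\<close>

text \<open>
  The measures of \<open>u\<close> and \<open>v\<close> agree inside \<open>X\<close> when \<open>E(X) u = E(X) v\<close>, so the square integrability
  of \<open>f\<close> on \<open>X\<close> transfers from \<open>u\<close> to its projection.
\<close>

lemma square_integrable_proj:
  assumes X: "X \<in> sets borel" and f: "f \<in> borel_measurable borel"
    and u: "integrable (\<mu> u) (\<lambda>t. (indicator X t * f t)\<^sup>2)"
  shows "integrable (\<mu> (E X u)) (\<lambda>t. (f t :: real)\<^sup>2)"
proof -
  have f2: "(\<lambda>t. (f t)\<^sup>2) \<in> borel_measurable borel" using f by simp
  have sq: "(indicator X t * f t)\<^sup>2 = indicator X t * (f t)\<^sup>2" for t
    by (simp split: split_indicator)
  have "integrable (\<mu> (E X u)) (\<lambda>t. indicator X t * (f t)\<^sup>2)"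
    using scalar_local(1)[OF X f2, of "E X u" u] u proj(2)[OF X] by (simp add: sq)
  moreover have "integrable (\<mu> (E X u)) (\<lambda>t. indicator (- X) t * (f t)\<^sup>2)"
  proof -
    have X': "- X \<in> sets borel" using X by (simp add: borel_comp)
    have eq: "E (- X) (E X u) = E (- X) 0"
      using proj_disjoint[OF X' X] proj_linear(5)[OF X'] by simp
    have "\<mu> 0 = null_measure borel"
      by (rule measure_eqI) (simp_all add: emeasure_scalar proj_linear(5))
    then have "integrable (\<mu> 0) (\<lambda>t. indicator (- X) t * (f t)\<^sup>2)"
      using X' f by (simp add: integrable_iff_bounded)
    then show ?thesis by (simp only: scalar_local(1)[OF X' f2 eq])
  qed
  ultimately have "integrable (\<mu> (E X u)) (\<lambda>t. indicator X t * (f t)\<^sup>2 + indicator (- X) t * (f t)\<^sup>2)"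
    by (rule Bochner_Integration.integrable_add)
  then show ?thesis by (simp only: indicator_split[of "\<lambda>t. (f t)\<^sup>2" _ X, symmetric])
qed

lemma square_integrable_scaleC:
  assumes f: "f \<in> borel_measurable borel" and u: "integrable (\<mu> u) (\<lambda>t. (f t)\<^sup>2)"
  shows "integrable (\<mu> (c *\<^sub>C u)) (\<lambda>t. (f t :: real)\<^sup>2)"
proof -
  have [measurable]: "f \<in> borel_measurable (\<mu> u)" using f by simp
  show ?thesis unfolding scalar_scale using u by (subst integrable_density) auto
qed

lemma sum_i_powers:
  "(\<Sum>k<4. \<i> ^ k * g k) = g 0 + \<i> * g 1 - g 2 - \<i> * g 3"
proof -
  have "{..<4} = {0, 1, 2, 3::nat}" by auto
  then show ?thesis by (simp add: power3_eq_cube)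
qed

text \<open>
  In the polarized integral only the part on \<open>X\<close> survives when the second part is the same for the
  four vectors, as \<open>1 + \<i> + \<i>\<^sup>2 + \<i>\<^sup>3 = 0\<close>.
\<close>

lemma polarized_local:
  assumes X: "X \<in> sets borel" and f: "f \<in> borel_measurable borel"
    and w: "\<And>k. integrable (\<mu> (w k)) (\<lambda>t. (f t)\<^sup>2)" "\<And>k. E X (w k) = E X (v k)"
    and c: "\<And>k. (\<integral>t. indicator (- X) t * f t \<partial>\<mu> (w k)) = c"
  shows "(\<Sum>k<4. \<i> ^ k * complex_of_real (\<integral>t. f t \<partial>\<mu> (w k)))
    = (\<Sum>k<4. \<i> ^ k * complex_of_real (\<integral>t. indicator X t * f t \<partial>\<mu> (v k)))"
proof -
  have "(\<integral>t. f t \<partial>\<mu> (w k)) = (\<integral>t. indicator X t * f t \<partial>\<mu> (v k)) + c" for k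
    using integral_split[OF X integrable_if_square_integrable[OF f w(1)], of k] c[of k]
      scalar_local(2)[OF X f w(2)] by simp
  then show ?thesis unfolding sum_i_powers by (simp add: distrib_left)
qed

lemma polarized_proj:
  assumes X: "X \<in> sets borel" and f: "f \<in> borel_measurable borel"
    and x: "integrable (\<mu> x) (\<lambda>t. (f t)\<^sup>2)" and z: "integrable (\<mu> (E X z)) (\<lambda>t. (f t)\<^sup>2)"
  shows "(\<Sum>k<4. \<i> ^ k * complex_of_real (\<integral>t. f t \<partial>\<mu> (x + \<i> ^ k *\<^sub>C E X z)))
    = (\<Sum>k<4. \<i> ^ k * complex_of_real (\<integral>t. indicator X t * f t \<partial>\<mu> (x + \<i> ^ k *\<^sub>C z)))"
proof (rule polarized_local[OF X f])
  have X': "- X \<in> sets borel" using X by (simp add: borel_comp)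
  show "integrable (\<mu> (x + \<i> ^ k *\<^sub>C E X z)) (\<lambda>t. (f t)\<^sup>2)" for k
    by (intro square_integrable_add square_integrable_scaleC f x z)
  show "E X (x + \<i> ^ k *\<^sub>C E X z) = E X (x + \<i> ^ k *\<^sub>C z)" for k
    by (simp add: proj_linear(1,3)[OF X] proj(2)[OF X])
  show "(\<integral>t. indicator (- X) t * f t \<partial>\<mu> (x + \<i> ^ k *\<^sub>C E X z)) = (\<integral>t. indicator (- X) t * f t \<partial>\<mu> x)" for k
    by (rule scalar_local(2)[OF X' f]) (simp add: proj_linear(1,3)[OF X'] proj_disjoint[OF X' X])
qed

text \<open>
  Moving \<open>E(X)\<close> to the other side of the inner product, one compares polarized integrals at vectors
  whose components on the complement of \<open>X\<close> do not contribute. The first part says that \<open>E(X)\<close>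
  commutes with \<open>\<integral>f dE\<close>, the second that cutting \<open>f\<close> off amounts to projecting the value.
\<close>

lemma spectral_integral_proj:
  assumes X: "X \<in> sets borel" and f: "f \<in> borel_measurable borel"
    and xy: "(x, y) \<in> spectral_integral E f"
  shows "(E X x, E X y) \<in> spectral_integral E f"
    and "(x, E X y) \<in> spectral_integral E (\<lambda>t. indicator X t * f t)"
proof -
  have X': "- X \<in> sets borel" using X by (simp add: borel_comp)
  have x: "integrable (\<mu> x) (\<lambda>t. (f t)\<^sup>2)"
    using xy by (simp add: spectral_integral_def spectral_domain_def)
  have f2: "(\<lambda>t. (f t)\<^sup>2) \<in> borel_measurable borel" using f by simp
  have cut: "integrable (\<mu> u) (\<lambda>t. (indicator X t * f t)\<^sup>2)" if "integrable (\<mu> u) (\<lambda>t. (f t)\<^sup>2)" for u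
  proof -
    have "(indicator X t * f t)\<^sup>2 = indicator X t *\<^sub>R (f t)\<^sup>2" for t
      by (simp split: split_indicator)
    then show ?thesis using integrable_mult_indicator[of X "\<mu> u" "\<lambda>t. (f t)\<^sup>2"] that X by simp
  qed
  have val: "cinner (E X y) z
      = (\<Sum>k<4. \<i> ^ k * complex_of_real (\<integral>t. indicator X t * f t \<partial>\<mu> (x + \<i> ^ k *\<^sub>C z))) / 4"
    if "integrable (\<mu> z) (\<lambda>t. (indicator X t * f t)\<^sup>2)" for z
  proof -
    have Xz: "integrable (\<mu> (E X z)) (\<lambda>t. (f t)\<^sup>2)" by (rule square_integrable_proj[OF X f that])
    have "cinner (E X y) z = cinner y (E X z)" by (rule symmetric_mapD[OF proj(1)[OF X]])
    also have "\<dots> = (\<Sum>k<4. \<i> ^ k * complex_of_real (\<integral>t. f t \<partial>\<mu> (x + \<i> ^ k *\<^sub>C E X z))) / 4"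
      using xy Xz by (simp add: spectral_integral_def spectral_domain_def)
    finally show ?thesis unfolding polarized_proj[OF X f x Xz] .
  qed
  show "(x, E X y) \<in> spectral_integral E (\<lambda>t. indicator X t * f t)"
    using cut[OF x] val by (simp add: spectral_integral_def spectral_domain_def)
  have Xx: "integrable (\<mu> (E X x)) (\<lambda>t. (f t)\<^sup>2)" by (rule square_integrable_proj[OF X f cut[OF x]])
  have "cinner (E X y) z
      = (\<Sum>k<4. \<i> ^ k * complex_of_real (\<integral>t. f t \<partial>\<mu> (E X x + \<i> ^ k *\<^sub>C z))) / 4"
    if z: "integrable (\<mu> z) (\<lambda>t. (f t)\<^sup>2)" for z
  proof -
    have "(\<Sum>k<4. \<i> ^ k * complex_of_real (\<integral>t. f t \<partial>\<mu> (E X x + \<i> ^ k *\<^sub>C z)))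
      = (\<Sum>k<4. \<i> ^ k * complex_of_real (\<integral>t. indicator X t * f t \<partial>\<mu> (x + \<i> ^ k *\<^sub>C z)))"
    proof (rule polarized_local[OF X f])
      show "integrable (\<mu> (E X x + \<i> ^ k *\<^sub>C z)) (\<lambda>t. (f t)\<^sup>2)" for k
        by (intro square_integrable_add square_integrable_scaleC f Xx z)
      show "E X (E X x + \<i> ^ k *\<^sub>C z) = E X (x + \<i> ^ k *\<^sub>C z)" for k
        by (simp add: proj_linear(1)[OF X] proj(2)[OF X])
      show "(\<integral>t. indicator (- X) t * f t \<partial>\<mu> (E X x + \<i> ^ k *\<^sub>C z)) = (\<integral>t. indicator (- X) t * f t \<partial>\<mu> z)" for k
      proof -
        have "(\<integral>t. indicator (- X) t * f t \<partial>\<mu> (E X x + \<i> ^ k *\<^sub>C z))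
            = (\<integral>t. indicator (- X) t * f t \<partial>\<mu> (\<i> ^ k *\<^sub>C z))"
          by (rule scalar_local(2)[OF X' f]) (simp add: proj_linear(1)[OF X'] proj_disjoint[OF X' X])
        then show ?thesis by (simp add: scalar_unimodular norm_power)
      qed
    qed
    then show ?thesis using val[OF cut[OF z]] by simp
  qed
  then show "(E X x, E X y) \<in> spectral_integral E f"
    using Xx by (simp add: spectral_integral_def spectral_domain_def)
qed

lemma spectral_integral_form:
  assumes f: "f \<in> borel_measurable borel" and xy: "(x, y) \<in> spectral_integral E f"
  shows "Re (cinner y x) = (\<integral>t. f t \<partial>\<mu> x)"
proof -
  define J where "J k = (\<integral>t. f t \<partial>\<mu> (x + \<i> ^ k *\<^sub>C x))" for k :: nat
  have J: "J k = (cmod (1 + \<i> ^ k))\<^sup>2 * (\<integral>t. f t \<partial>\<mu> x)" for k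
    unfolding J_def using integral_scale[OF f, of "1 + \<i> ^ k" x] by (simp add: scaleC_add_left)
  have "(cmod (1 + \<i> ^ 0))\<^sup>2 = 4" "(cmod (1 + \<i> ^ 1))\<^sup>2 = 2" "(cmod (1 + \<i> ^ 2))\<^sup>2 = 0"
    "(cmod (1 + \<i> ^ 3))\<^sup>2 = 2"
    by (simp_all add: cmod_power2 power3_eq_cube)
  then have "J 0 = 4 * (\<integral>t. f t \<partial>\<mu> x)" "J 1 = 2 * (\<integral>t. f t \<partial>\<mu> x)" "J 2 = 0"
    "J 3 = 2 * (\<integral>t. f t \<partial>\<mu> x)"
    by (simp_all only: J mult_zero_left)
  moreover have "cinner y x = (\<Sum>k<4. \<i> ^ k * complex_of_real (J k)) / 4"
    using xy by (simp add: spectral_integral_def J_def)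
  ultimately show ?thesis by (simp add: sum_i_powers)
qed

text \<open>
  Let \<open>B = \<integral>t dE\<close> and let \<open>w\<close> be in its domain and in the range of \<open>E((c, \<infinity>))\<close>. Then \<open>(B w, w) - c |w|\<^sup>2\<close>
  is at most \<open>0\<close>, but it is the integral of \<open>t - c\<close> against the measure of \<open>w\<close>, which lives on
  \<open>t > c\<close>. So this measure vanishes.
\<close>

lemma spectral_measure_above_bound:
  assumes B: "self_adjoint (spectral_integral E (\<lambda>t. t))"
    and c: "\<And>x y. (x, y) \<in> spectral_integral E (\<lambda>t. t) \<Longrightarrow> Re (cinner y x) \<le> c * (norm x)\<^sup>2"
  shows "E {c<..} x = 0"
proof (rule dense_orthogonal_eq_0[OF self_adjointD(2)[OF B]])
  let ?X = "{c<..}"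
  fix u assume "u \<in> Domain (spectral_integral E (\<lambda>t. t))"
  then obtain v where uv: "(u, v) \<in> spectral_integral E (\<lambda>t. t)" by blast
  define w where "w = E ?X u"
  have wv: "(w, E ?X v) \<in> spectral_integral E (\<lambda>t. t)"
    unfolding w_def by (rule spectral_integral_proj(1)[OF _ _ uv]) simp_all
  have int: "integrable (\<mu> w) (\<lambda>t. t)"
    by (rule integrable_if_square_integrable)
      (use wv in \<open>simp_all add: spectral_integral_def spectral_domain_def\<close>)
  have "E (- ?X) w = 0" unfolding w_def by (rule proj_disjoint) (auto simp: borel_comp)
  then have above: "AE t in \<mu> w. t \<in> ?X" by (intro AE_scalar) simp_all
  interpret finite_measure "\<mu> w" by (rule finite_scalar)
  have "(\<integral>t. t - c \<partial>\<mu> w) = Re (cinner (E ?X v) w) - c * (norm w)\<^sup>2"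
  proof -
    have "Re (cinner (E ?X v) w) = (\<integral>t. t \<partial>\<mu> w)" by (rule spectral_integral_form[OF _ wv]) simp
    then show ?thesis using int by (simp add: measure_scalar mult.commute)
  qed
  then have "(\<integral>t. t - c \<partial>\<mu> w) \<le> 0" using c[OF wv] by linarith
  moreover have nn: "AE t in \<mu> w. 0 \<le> t - c" using above by eventually_elim simp
  then have "0 \<le> (\<integral>t. t - c \<partial>\<mu> w)" by (rule integral_nonneg_AE)
  ultimately have "(\<integral>t. t - c \<partial>\<mu> w) = 0" by simp
  then have "AE t in \<mu> w. t - c = 0"
    using integral_nonneg_eq_0_iff_AE[of "\<mu> w" "\<lambda>t. t - c"] int nn by simp
  with above have "AE t in \<mu> w. False" by eventually_elim simp
  then have "emeasure (\<mu> w) UNIV = 0" using AE_iff_null_sets[of UNIV "\<mu> w"] by (simp add: null_sets_def)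
  then have "w = 0" by (simp add: emeasure_scalar proj_UNIV)
  then show "cinner u (E ?X x) = 0"
    using symmetric_mapD[OF proj(1), of ?X u x] by (simp add: w_def)
qed

text \<open>
  Needed so that the norm of \<open>B\<^sub>+\<close> is a supremum of a bounded set. The integrand lies between \<open>0\<close> and \<open>c\<close>
  almost everywhere, which bounds the polarized integrals.
\<close>

lemma spectral_pos_part_bounded:
  assumes c: "0 \<le> c" "\<And>x. E {c<..} x = 0"
  shows "bounded_op (spectral_pos_part E)"
proof -
  let ?f = "\<lambda>t::real. indicator {0..} t * t"
  have f: "?f \<in> borel_measurable borel" by simp
  have AE_le: "AE t in \<mu> w. 0 \<le> ?f t \<and> ?f t \<le> c" for w
  proof -
    have "AE t in \<mu> w. t \<in> {..c}"
      by (rule AE_scalar) (simp_all add: c(2) Compl_atMost)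
    then show ?thesis by eventually_elim (use c(1) in \<open>auto simp: indicator_def\<close>)
  qed
  have dom: "w \<in> spectral_domain E ?f" for w
  proof -
    interpret finite_measure "\<mu> w" by (rule finite_scalar)
    have "AE t in \<mu> w. norm ((?f t)\<^sup>2) \<le> c\<^sup>2"
      using AE_le[of w] by eventually_elim (simp add: power_mono)
    then have "integrable (\<mu> w) (\<lambda>t. (?f t)\<^sup>2)"
      by (rule integrable_const_bound) simp
    then show ?thesis by (simp add: spectral_domain_def)
  qed
  have int: "0 \<le> (\<integral>t. ?f t \<partial>\<mu> w)" "(\<integral>t. ?f t \<partial>\<mu> w) \<le> c * (norm w)\<^sup>2" for w
  proof -
    interpret finite_measure "\<mu> w" by (rule finite_scalar)
    show "0 \<le> (\<integral>t. ?f t \<partial>\<mu> w)"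
      by (rule integral_nonneg_AE) (use AE_le[of w] in \<open>eventually_elim, simp\<close>)
    have "(\<integral>t. ?f t \<partial>\<mu> w) \<le> (\<integral>t. c \<partial>\<mu> w)"
    proof (rule integral_mono_AE)
      show "integrable (\<mu> w) ?f"
        by (rule integrable_if_square_integrable[OF f]) (use dom in \<open>simp add: spectral_domain_def\<close>)
      show "AE t in \<mu> w. ?f t \<le> c" using AE_le[of w] by eventually_elim simp
    qed simp
    then show "(\<integral>t. ?f t \<partial>\<mu> w) \<le> c * (norm w)\<^sup>2" by (simp add: measure_scalar mult.commute)
  qed
  have "norm y \<le> c * norm x" if xy: "(x, y) \<in> spectral_pos_part E" for x y
  proof (cases "y = 0")
    case False
    \<comment> \<open>Test with \<open>s y\<close>, \<open>s = |x| / |y|\<close>; of the four integrals the real part sees only two.\<close>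
    define s where "s = norm x / norm y"
    have "cinner y (s *\<^sub>R y) = (\<Sum>k<4. \<i> ^ k * complex_of_real (\<integral>t. ?f t \<partial>\<mu> (x + \<i> ^ k *\<^sub>C (s *\<^sub>R y)))) / 4"
      using xy dom by (simp add: spectral_pos_part_def spectral_integral_def)
    from arg_cong[OF this, of Re]
    have "4 * (s * (norm y)\<^sup>2) = (\<integral>t. ?f t \<partial>\<mu> (x + s *\<^sub>R y)) - (\<integral>t. ?f t \<partial>\<mu> (x + \<i>\<^sup>2 *\<^sub>C (s *\<^sub>R y)))"
      by (simp add: sum_i_powers cinner_simps Re_cinner_self)
    also have "\<dots> \<le> c * (norm (x + s *\<^sub>R y))\<^sup>2"
      using int(1)[of "x + \<i>\<^sup>2 *\<^sub>C (s *\<^sub>R y)"] int(2)[of "x + s *\<^sub>R y"] by linarith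
    also have "\<dots> \<le> c * (2 * norm x)\<^sup>2"
    proof (intro mult_left_mono power_mono c norm_ge_zero)
      show "norm (x + s *\<^sub>R y) \<le> 2 * norm x"
        using norm_triangle_ineq[of x "s *\<^sub>R y"] False by (simp add: s_def)
    qed
    finally have "norm x * norm y \<le> norm x * (c * norm x)"
      using False by (simp add: s_def power2_eq_square power_mult_distrib mult_ac)
    moreover have "x \<noteq> 0 \<or> norm y \<le> c * norm x"
    proof (rule ccontr)
      assume "\<not> ?thesis"
      then have x0: "x = 0" by simp
      have "cinner y y = (\<Sum>k<4. \<i> ^ k * complex_of_real (\<integral>t. ?f t \<partial>\<mu> (x + \<i> ^ k *\<^sub>C y))) / 4"
        using xy dom by (simp add: spectral_pos_part_def spectral_integral_def)
      also have "\<dots> = 0" by (simp add: x0 scalar_unimodular norm_power sum_i_powers)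
      finally show False using False by simp
    qed
    ultimately show ?thesis by (auto simp: c(1))
  qed (use c in simp)
  then show ?thesis unfolding bounded_op_def by (intro exI[of _ c]) auto
qed

end

text \<open>
  Split \<open>B x\<close> into its components on \<open>[0, \<infinity>)\<close> and on the negative half-line: the first is \<open>B\<^sub>+ x\<close>, and the
  second contributes \<open>\<integral>t \<le> 0\<close> to the form.
\<close>

lemma spectral_pos_part_form_bound:
  assumes E: "is_spectral_measure E B" and B: "self_adjoint B" "bounded_from_above B"
  shows "0 \<le> op_norm (spectral_pos_part E)"
    and "(x, y) \<in> B \<Longrightarrow> Re (cinner y x) \<le> op_norm (spectral_pos_part E) * (norm x)\<^sup>2"
proof -
  interpret pvm E using E by unfold_locales (simp add: is_spectral_measure_def)
  have BE: "B = spectral_integral E (\<lambda>t. t)" using E by (simp add: is_spectral_measure_def)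
  obtain c0 where c0: "\<forall>(f, f')\<in>B. Re (cinner f' f) \<le> c0 * (norm f)\<^sup>2"
    using B(2) by (auto simp: bounded_from_above_def)
  define c where "c = max c0 0"
  have c: "Re (cinner y x) \<le> c * (norm x)\<^sup>2" if "(x, y) \<in> B" for x y
  proof -
    have "Re (cinner y x) \<le> c0 * (norm x)\<^sup>2" using c0 that by auto
    also have "\<dots> \<le> c * (norm x)\<^sup>2" by (intro mult_right_mono) (auto simp: c_def)
    finally show ?thesis .
  qed
  have bd: "bounded_op (spectral_pos_part E)"
  proof (rule spectral_pos_part_bounded)
    show "0 \<le> c" by (simp add: c_def)
    show "E {c<..} x = 0" for x
      by (rule spectral_measure_above_bound) (use B(1) c in \<open>simp_all add: BE\<close>)
  qed
  let ?X = "{0..} :: real set"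
  have pos: "(x, E ?X y) \<in> spectral_pos_part E" if "(x, y) \<in> B" for x y
    unfolding spectral_pos_part_def
    by (rule spectral_integral_proj(2)) (use that in \<open>simp_all add: BE\<close>)
  have "(0, 0) \<in> spectral_pos_part E"
    using pos[OF linear_opD(1)[OF self_adjointD(1)[OF B(1)]]] by (simp add: proj_linear(5))
  then show "0 \<le> op_norm (spectral_pos_part E)" by (rule op_norm_nonneg[OF bd])
  assume xy: "(x, y) \<in> B"
  have X': "- ?X \<in> sets borel" by (simp add: borel_comp)
  have "Re (cinner (E (- ?X) y) x) \<le> 0"
  proof -
    have "(E (- ?X) x, E (- ?X) y) \<in> spectral_integral E (\<lambda>t. t)"
      by (rule spectral_integral_proj(1)[OF X']) (use xy in \<open>simp_all add: BE\<close>)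
    from spectral_integral_form[OF _ this]
    have "Re (cinner (E (- ?X) y) (E (- ?X) x)) = (\<integral>t. t \<partial>\<mu> (E (- ?X) x))" by simp
    also have "\<dots> = - (\<integral>t. - t \<partial>\<mu> (E (- ?X) x))" by simp
    also have "\<dots> \<le> 0"
    proof -
      have "E (- (- ?X)) (E (- ?X) x) = 0" by (rule proj_disjoint) (use X' in auto)
      then have "AE t in \<mu> (E (- ?X) x). t \<in> - ?X" by (rule AE_scalar[OF X'])
      then have "AE t in \<mu> (E (- ?X) x). 0 \<le> - t" by eventually_elim simp
      from integral_nonneg_AE[OF this] show ?thesis by simp
    qed
    finally show ?thesis
      using symmetric_mapD[OF proj(1)[OF X'], of "E (- ?X) y" x] proj(2)[OF X', of y] by simp
  qed
  moreover have "Re (cinner (E ?X y) x) \<le> op_norm (spectral_pos_part E) * (norm x)\<^sup>2"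
  proof -
    have "Re (cinner (E ?X y) x) \<le> norm (E ?X y) * norm x" using Re_cinner_bound abs_le_D1 by blast
    also have "\<dots> \<le> (op_norm (spectral_pos_part E) * norm x) * norm x"
      by (intro mult_right_mono op_norm_bound[OF bd pos[OF xy]]) simp
    finally show ?thesis by (simp add: power2_eq_square mult.assoc)
  qed
  moreover have "cinner y x = cinner (E ?X y) x + cinner (E (- ?X) y) x"
    using cinner_add_left[of "E ?X y" "E (- ?X) y" x] proj_compl[of ?X y] by simp
  then have "Re (cinner y x) = Re (cinner (E ?X y) x) + Re (cinner (E (- ?X) y) x)"
    by (simp del: Compl_atLeast)
  ultimately show "Re (cinner y x) \<le> op_norm (spectral_pos_part E) * (norm x)\<^sup>2" by linarith
qed

section \<open>Semibounded self-adjoint extensions\<close>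

lemma le_min_spectrumI:
  assumes A: "self_adjoint A" and lb: "\<And>l. ereal l < m \<Longrightarrow> lower_bound A l"
  shows "m \<le> min_spectrum A"
proof (rule dense_le)
  fix x assume "x < m"
  then show "x \<le> min_spectrum A"
    by (cases x) (use lower_bound_imp_min_spectrum[OF A lb] in auto)
qed

locale decaying_weyl = quasi_boundary S T \<Gamma>\<^sub>0 \<Gamma>\<^sub>1
  for S T :: "('h::complex_hilbert, 'h) op" and \<Gamma>\<^sub>0 \<Gamma>\<^sub>1 :: "'h \<Rightarrow> 'g::complex_hilbert" +
  assumes A0_below: "bounded_from_below A\<^sub>0"
    and M_bounded: "\<exists>z\<in>resolvent_set A\<^sub>0. bounded_op (M z)"
    and decay: "((\<lambda>t::real. op_norm (closure (M t))) \<longlongrightarrow> 0) at_bot"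
begin

lemma below_spectrum:
  assumes t: "ereal t < min_spectrum A\<^sub>0"
  shows "complex_of_real t \<in> resolvent_set A\<^sub>0"
    and "(f, f') \<in> T \<Longrightarrow> t * (norm f)\<^sup>2 \<le> Re (cinner f' f) + Re (cinner (\<Gamma>\<^sub>0 f) (\<Gamma>\<^sub>1 f))"
proof -
  show "complex_of_real t \<in> resolvent_set A\<^sub>0" by (rule min_spectrum_imp_resolvent[OF t])
  obtain w where w: "w \<in> resolvent_set A\<^sub>0" "bounded_op (M w)" using M_bounded by blast
  show "t * (norm f)\<^sup>2 \<le> Re (cinner f' f) + Re (cinner (\<Gamma>\<^sub>0 f) (\<Gamma>\<^sub>1 f))" if "(f, f') \<in> T"
    by (rule form_nonneg[OF w decay min_spectrum_imp_lower_bound[OF A0_self_adjoint A0_below t] that])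
qed

text \<open>
  On \<open>ker (T - t)\<close> the form reduces to \<open>(\<phi>, M(t) \<phi>)\<close>, so its nonnegativity is that of the Weyl function.
\<close>

lemma weyl_closure_nonneg:
  assumes t: "ereal t < min_spectrum A\<^sub>0"
  obtains m where "closure (M t) = map_op m" "symmetric_map m" "\<forall>x. 0 \<le> Re (cinner (m x) x)"
    "\<forall>x. norm (m x) \<le> op_norm (closure (M t)) * norm x" "0 \<le> op_norm (closure (M t))"
    "\<forall>g. (g, complex_of_real t *\<^sub>C g) \<in> T \<longrightarrow> \<Gamma>\<^sub>1 g = m (\<Gamma>\<^sub>0 g)"
proof -
  note rt = below_spectrum(1)[OF t]
  obtain w where w: "w \<in> resolvent_set A\<^sub>0" "bounded_op (M w)" using M_bounded by blast
  obtain m where m: "closure (M t) = map_op m" "symmetric_map m"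
    "\<forall>x. norm (m x) \<le> op_norm (closure (M t)) * norm x" "0 \<le> op_norm (closure (M t))"
    "\<forall>g. (g, complex_of_real t *\<^sub>C g) \<in> T \<longrightarrow> \<Gamma>\<^sub>1 g = m (\<Gamma>\<^sub>0 g)"
    using weyl_closure[OF rt w] .
  have "0 \<le> Re (cinner (m x) x)" for x
  proof -
    obtain u v where uv: "\<And>n::nat. (u n, v n) \<in> M t" "u \<longlonglongrightarrow> x" "v \<longlonglongrightarrow> m x"
      by (rule closure_graph_cases[of x "m x" "M t"]) (auto simp: m(1))
    have "0 \<le> Re (cinner (v n) (u n))" for n
    proof -
      obtain g where g: "(g, complex_of_real t *\<^sub>C g) \<in> T" "u n = \<Gamma>\<^sub>0 g" "v n = \<Gamma>\<^sub>1 g"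
        using uv(1)[of n] by (auto simp: in_weyl_function)
      from below_spectrum(2)[OF t g(1)] show ?thesis
        using Re_cinner_commute[of "u n" "v n"] by (simp add: g(2,3) cinner_simps Re_cinner_self)
    qed
    moreover have "(\<lambda>n. Re (cinner (v n) (u n))) \<longlonglongrightarrow> Re (cinner (m x) x)"
      by (intro tendsto_intros uv)
    ultimately show ?thesis by (intro LIMSEQ_le_const) auto
  qed
  then show ?thesis using that[OF m(1,2) _ m(3,4,5)] by blast
qed

lemma extension_lower_bound:
  assumes t: "ereal t < min_spectrum A\<^sub>0" and b: "0 \<le> b" "b * op_norm (closure (M t)) \<le> 1"
    and B: "\<And>x y. (x, y) \<in> B \<Longrightarrow> Re (cinner y x) \<le> b * (norm x)\<^sup>2"
  shows "lower_bound (bc_extension T \<Gamma>\<^sub>0 \<Gamma>\<^sub>1 B) t"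
proof -
  obtain m where m: "\<forall>x. norm (m x) \<le> op_norm (closure (M t)) * norm x"
    "\<forall>g. (g, complex_of_real t *\<^sub>C g) \<in> T \<longrightarrow> \<Gamma>\<^sub>1 g = m (\<Gamma>\<^sub>0 g)"
    by (rule weyl_closure_nonneg[OF t]) blast
  show ?thesis
    by (rule bc_extension_lower_bound[OF below_spectrum(2)[OF t] below_spectrum(1)[OF t] _ b B])
      (use m in auto)
qed

text \<open>
  When \<open>t\<close> is a resolvent point of \<open>A\<^sub>1\<close>, also \<open>dom T = ker \<Gamma>\<^sub>1 + ker (T - t)\<close>. This reduces the second
  alternative of the last hypothesis of the theorem to the first.
\<close>

lemma range_G1_subset:
  assumes t: "complex_of_real t \<in> resolvent_set (op_restrict T (\<lambda>f. \<Gamma>\<^sub>1 f = 0))"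
  shows "\<Gamma>\<^sub>1 ` Domain T \<subseteq> Range (M t)"
proof (clarify)
  fix f f' assume f: "(f, f') \<in> T"
  obtain h where "(h, (f' - complex_of_real t *\<^sub>C f) + complex_of_real t *\<^sub>C h)
      \<in> op_restrict T (\<lambda>f. \<Gamma>\<^sub>1 f = 0)"
    using resolvent_set_surj[OF t] by blast
  then have h: "(h, (f' - complex_of_real t *\<^sub>C f) + complex_of_real t *\<^sub>C h) \<in> T" "\<Gamma>\<^sub>1 h = 0"
    by (simp_all add: in_op_restrict)
  have "(f - h, complex_of_real t *\<^sub>C (f - h)) \<in> T"
    using T_lin(3)[OF f h(1)] by (simp add: scaleC_diff_right algebra_simps)
  moreover have "\<Gamma>\<^sub>1 (f - h) = \<Gamma>\<^sub>1 f" using boundary_linear(6)[OF f h(1)] h(2) by simp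
  ultimately have "(\<Gamma>\<^sub>0 (f - h), \<Gamma>\<^sub>1 f) \<in> M t" by (auto simp: in_weyl_function)
  then show "\<Gamma>\<^sub>1 f \<in> Range (M t)" by blast
qed

text \<open>
  Far enough to the left, \<open>t\<close> satisfies the three requirements of the construction: it lies below
  the spectrum of \<open>A\<^sub>0\<close>, the product of the bound of \<open>B\<close> with the norm of \<open>M(t)\<close> is below \<open>1\<close>, and \<open>t\<close> is a
  resolvent point of \<open>A\<^sub>1\<close> if \<open>A\<^sub>1\<close> is self-adjoint and bounded from below.
\<close>

lemma extension_self_adjoint:
  assumes B: "self_adjoint B" "bounded_from_above B"
    and root: "\<And>t. ereal t < min_spectrum A\<^sub>0 \<Longrightarrow> Range (op_sqrt (closure (M t))) \<subseteq> Domain B"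
    and BM: "\<And>t. ereal t < min_spectrum A\<^sub>0 \<Longrightarrow> B `` Range (closure (M t)) \<subseteq> \<Gamma>\<^sub>0 ` Domain T"
    and dom: "\<Gamma>\<^sub>1 ` Domain T \<subseteq> Domain B"
    and alt: "B `` (\<Gamma>\<^sub>1 ` Domain T) \<subseteq> \<Gamma>\<^sub>0 ` Domain T
      \<or> (self_adjoint (op_restrict T (\<lambda>f. \<Gamma>\<^sub>1 f = 0))
          \<and> bounded_from_below (op_restrict T (\<lambda>f. \<Gamma>\<^sub>1 f = 0)))"
  shows "self_adjoint (bc_extension T \<Gamma>\<^sub>0 \<Gamma>\<^sub>1 B) \<and> bounded_from_below (bc_extension T \<Gamma>\<^sub>0 \<Gamma>\<^sub>1 B)"
proof -
  let ?A1 = "op_restrict T (\<lambda>f. \<Gamma>\<^sub>1 f = 0)"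
  obtain b0 where b0: "\<forall>(f, f')\<in>B. Re (cinner f' f) \<le> b0 * (norm f)\<^sup>2"
    using B(2) by (auto simp: bounded_from_above_def)
  define b where "b = max b0 0"
  have b: "0 \<le> b" by (simp add: b_def)
  have Bb: "Re (cinner y x) \<le> b * (norm x)\<^sup>2" if "(x, y) \<in> B" for x y
  proof -
    have "Re (cinner y x) \<le> b0 * (norm x)\<^sup>2" using b0 that by auto
    also have "\<dots> \<le> b * (norm x)\<^sup>2" by (intro mult_right_mono) (auto simp: b_def)
    finally show ?thesis .
  qed
  obtain c where c: "lower_bound A\<^sub>0 c" using A0_below by (auto simp: bounded_from_below_iff)
  have A1: "\<exists>d. \<forall>t<d. B `` (\<Gamma>\<^sub>1 ` Domain T) \<subseteq> \<Gamma>\<^sub>0 ` Domain T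
      \<or> complex_of_real t \<in> resolvent_set ?A1"
    using alt lower_bound_below_resolvent[of ?A1] by (auto simp: bounded_from_below_iff)
  then obtain d where d: "\<forall>t<d. B `` (\<Gamma>\<^sub>1 ` Domain T) \<subseteq> \<Gamma>\<^sub>0 ` Domain T
      \<or> complex_of_real t \<in> resolvent_set ?A1" ..
  have "\<forall>\<^sub>F t in at_bot. op_norm (closure (M (complex_of_real t))) < 1 / (b + 1)"
    using order_tendstoD(2)[OF decay, of "1 / (b + 1)"] b by simp
  then have "\<forall>\<^sub>F t in at_bot. op_norm (closure (M (complex_of_real t))) < 1 / (b + 1) \<and> t < c \<and> t < d"
    using eventually_gt_at_bot[of c] eventually_gt_at_bot[of d] by eventually_elim simp
  then obtain t where t: "op_norm (closure (M (complex_of_real t))) < 1 / (b + 1)" "t < c" "t < d"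
    using eventually_happens'[OF trivial_limit_at_bot_linorder] by blast
  have tm: "ereal t < min_spectrum A\<^sub>0"
    using lower_bound_imp_min_spectrum[OF A0_self_adjoint c] t(2)
    by (meson ereal_less(2) less_ereal.simps(1) less_le_trans)
  obtain m where m: "closure (M t) = map_op m" "symmetric_map m" "\<forall>x. 0 \<le> Re (cinner (m x) x)"
    "\<forall>x. norm (m x) \<le> op_norm (closure (M t)) * norm x" "0 \<le> op_norm (closure (M t))"
    "\<forall>g. (g, complex_of_real t *\<^sub>C g) \<in> T \<longrightarrow> \<Gamma>\<^sub>1 g = m (\<Gamma>\<^sub>0 g)"
    using weyl_closure_nonneg[OF tm] .
  have small: "b * op_norm (closure (M t)) < 1"
  proof -
    have "b * op_norm (closure (M t)) \<le> (b + 1) * op_norm (closure (M t))"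
      using m(5) by (intro mult_right_mono) auto
    also have "\<dots> < 1" using t(1) b by (simp add: field_simps)
    finally show ?thesis .
  qed
  have BG: "B `` (\<Gamma>\<^sub>1 ` Domain T) \<subseteq> \<Gamma>\<^sub>0 ` Domain T"
    using d[rule_format, OF t(3)]
  proof
    assume "complex_of_real t \<in> resolvent_set ?A1"
    then have "\<Gamma>\<^sub>1 ` Domain T \<subseteq> Range (M t)" by (rule range_G1_subset)
    also have "\<dots> \<subseteq> Range (closure (M t))" by (rule Range_mono[OF closure_subset])
    finally show ?thesis using BM[OF tm] by blast
  qed
  have Rm: "Range (map_op m) = range m" by (auto simp: map_op_def)
  have surj: "\<exists>f. (f, h + complex_of_real t *\<^sub>C f) \<in> bc_extension T \<Gamma>\<^sub>0 \<Gamma>\<^sub>1 B" for h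
    by (rule bc_extension_surj[OF below_spectrum(1)[OF tm] m(2) _ _ _ B(1) Bb b small _ _ dom BG])
      (use m root[OF tm] BM[OF tm] in \<open>simp_all add: Rm\<close>)
  have "self_adjoint (bc_extension T \<Gamma>\<^sub>0 \<Gamma>\<^sub>1 B)"
    by (rule symmetric_surj_self_adjoint[OF bc_extension_symmetric[OF B(1)] surj])
  moreover have "lower_bound (bc_extension T \<Gamma>\<^sub>0 \<Gamma>\<^sub>1 B) t"
    using extension_lower_bound[OF tm b _ Bb] small by simp
  ultimately show ?thesis by (auto simp: bounded_from_below_iff)
qed

end

theorem theorem2p8:
  fixes S T A\<^sub>0 A\<^sub>1 A\<^sub>B :: "('h::complex_hilbert, 'h) op"
    and \<Gamma>\<^sub>0 \<Gamma>\<^sub>1 :: "'h \<Rightarrow> 'g::complex_hilbert"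
    and \<gamma> :: "complex \<Rightarrow> ('g, 'h) op"
    and M :: "complex \<Rightarrow> ('g, 'g) op"
    and B :: "('g, 'g) op"
  defines "A\<^sub>0 \<equiv> op_restrict T (\<lambda>f. \<Gamma>\<^sub>0 f = 0)"
    and "A\<^sub>1 \<equiv> op_restrict T (\<lambda>f. \<Gamma>\<^sub>1 f = 0)"
    and "\<gamma> \<equiv> gamma_field T \<Gamma>\<^sub>0"
    and "M \<equiv> weyl_function T \<Gamma>\<^sub>0 \<Gamma>\<^sub>1"
    and "A\<^sub>B \<equiv> bc_extension T \<Gamma>\<^sub>0 \<Gamma>\<^sub>1 B"
  assumes S: "linear_op S" "densely_defined S" "closed S" "symmetric_op S"
    and triple: "quasi_boundary_triple S T \<Gamma>\<^sub>0 \<Gamma>\<^sub>1"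
    and A0_below: "bounded_from_below A\<^sub>0"
    and M_bounded: "\<exists>z\<in>resolvent_set A\<^sub>0. bounded_op (M z)"
    and B: "self_adjoint B" "bounded_from_above B"
    and i: "((\<lambda>t::real. op_norm (closure (M t))) \<longlongrightarrow> 0) at_bot"
    and ii: "\<And>t::real. t < min_spectrum A\<^sub>0 \<Longrightarrow> Range (op_sqrt (closure (M t))) \<subseteq> Domain B"
    and iii: "\<And>t::real. t < min_spectrum A\<^sub>0 \<Longrightarrow> B `` Range (closure (M t)) \<subseteq> \<Gamma>\<^sub>0 ` Domain T"
    and iv: "\<Gamma>\<^sub>1 ` Domain T \<subseteq> Domain B"
    and v: "B `` (\<Gamma>\<^sub>1 ` Domain T) \<subseteq> \<Gamma>\<^sub>0 ` Domain T \<or> (self_adjoint A\<^sub>1 \<and> bounded_from_below A\<^sub>1)"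
  shows "self_adjoint A\<^sub>B \<and> S \<subseteq> A\<^sub>B \<and> bounded_from_below A\<^sub>B
    \<and> (\<forall>z \<in> resolvent_set A\<^sub>B \<inter> resolvent_set A\<^sub>0.
         single_valued ((Id -\<^sub>o B \<circ>\<^sub>o M z)\<inverse>) \<and>
         (A\<^sub>B -\<^sub>o scalar_op z)\<inverse> =
           (A\<^sub>0 -\<^sub>o scalar_op z)\<inverse>
           +\<^sub>o \<gamma> z \<circ>\<^sub>o (Id -\<^sub>o B \<circ>\<^sub>o M z)\<inverse> \<circ>\<^sub>o B \<circ>\<^sub>o op_adjoint (\<gamma> (cnj z)))
    \<and> (nonpos_op B \<longrightarrow> min_spectrum A\<^sub>0 \<le> min_spectrum A\<^sub>B)
    \<and> (\<forall>\<alpha> \<mu> C :: real. \<forall>E.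
         0 < \<alpha> \<and> \<alpha> \<le> 1 \<and> \<mu> \<le> min_spectrum A\<^sub>0 \<and> 0 < C \<and>
         (\<forall>t<\<mu>. op_norm (closure (M t)) \<le> C / (\<mu> - t) powr \<alpha>) \<and>
         is_spectral_measure E B
         \<longrightarrow> \<mu> - (C * op_norm (spectral_pos_part E)) powr (1 / \<alpha>) \<le> min_spectrum A\<^sub>B)"
proof -
  interpret decaying_weyl S T \<Gamma>\<^sub>0 \<Gamma>\<^sub>1
    using triple A0_below M_bounded i unfolding A\<^sub>0_def M_def by unfold_locales
  have sa: "self_adjoint A\<^sub>B" "bounded_from_below A\<^sub>B"
    using extension_self_adjoint[OF B] ii iii iv v unfolding A\<^sub>0_def A\<^sub>1_def M_def A\<^sub>B_def by blast+
  have lin: "linear_op B" by (rule self_adjointD(1)[OF B(1)])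
  have a: "min_spectrum A\<^sub>0 \<le> min_spectrum A\<^sub>B" if "nonpos_op B"
  proof (rule le_min_spectrumI[OF sa(1)])
    fix l :: real assume "ereal l < min_spectrum A\<^sub>0"
    then show "lower_bound A\<^sub>B l"
      unfolding A\<^sub>B_def A\<^sub>0_def
      by (rule extension_lower_bound[where b = 0]) (use that in \<open>auto simp: nonpos_op_def\<close>)
  qed
  have b: "ereal (\<mu> - (C * op_norm (spectral_pos_part E)) powr (1 / \<alpha>)) \<le> min_spectrum A\<^sub>B"
    if \<alpha>: "0 < \<alpha>" and \<mu>: "ereal \<mu> \<le> min_spectrum A\<^sub>0" and C: "0 < C"
      and M: "\<forall>t<\<mu>. op_norm (closure (M (complex_of_real t))) \<le> C / (\<mu> - t) powr \<alpha>"
      and E: "is_spectral_measure E B" for \<alpha> \<mu> C E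
  proof (rule le_min_spectrumI[OF sa(1)])
    define \<beta> where "\<beta> = op_norm (spectral_pos_part E)"
    note form = spectral_pos_part_form_bound[OF E B, folded \<beta>_def]
    fix l :: real assume l: "ereal l < ereal (\<mu> - (C * op_norm (spectral_pos_part E)) powr (1 / \<alpha>))"
    then have gap: "(C * \<beta>) powr (1 / \<alpha>) < \<mu> - l" by (simp add: \<beta>_def)
    have l\<mu>: "l < \<mu>" using gap powr_ge_zero[of "C * \<beta>" "1 / \<alpha>"] by linarith
    \<comment> \<open>the value of the claimed bound is exactly what makes \<open>\<beta> C / (\<mu> - l)\<^sup>\<alpha> \<le> 1\<close>\<close>
    have "C * \<beta> = ((C * \<beta>) powr (1 / \<alpha>)) powr \<alpha>"
      using \<alpha> C form(1) by (simp add: powr_powr)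
    also have "\<dots> \<le> (\<mu> - l) powr \<alpha>" using gap \<alpha> by (intro powr_mono2) auto
    finally have "\<beta> * (C / (\<mu> - l) powr \<alpha>) \<le> 1" using l\<mu> by (simp add: field_simps)
    moreover have "\<beta> * op_norm (closure (M (complex_of_real l))) \<le> \<beta> * (C / (\<mu> - l) powr \<alpha>)"
      using M l\<mu> form(1) by (intro mult_left_mono) auto
    ultimately have small: "\<beta> * op_norm (closure (M (complex_of_real l))) \<le> 1" by linarith
    have "ereal l < min_spectrum A\<^sub>0" using \<mu> l\<mu> by (meson less_ereal.simps(1) less_le_trans)
    then show "lower_bound A\<^sub>B l"
      using extension_lower_bound[of l \<beta> B] form small unfolding A\<^sub>B_def A\<^sub>0_def M_def by blast
  qed
  have krein: "single_valued ((Id -\<^sub>o B \<circ>\<^sub>o M z)\<inverse>) \<and>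
      (A\<^sub>B -\<^sub>o scalar_op z)\<inverse> = (A\<^sub>0 -\<^sub>o scalar_op z)\<inverse>
        +\<^sub>o \<gamma> z \<circ>\<^sub>o (Id -\<^sub>o B \<circ>\<^sub>o M z)\<inverse> \<circ>\<^sub>o B \<circ>\<^sub>o op_adjoint (\<gamma> (cnj z))"
    if "z \<in> resolvent_set A\<^sub>B" "z \<in> resolvent_set A\<^sub>0" for z
    using krein_formula[of z B] that lin iv unfolding A\<^sub>B_def A\<^sub>0_def \<gamma>_def M_def by blast
  have "S \<subseteq> A\<^sub>B" unfolding A\<^sub>B_def by (rule S_subset_bc_extension[OF lin])
  then show ?thesis using sa a b krein by blast
qed

end
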